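(* Let $d,p\in\mathbb N$ and suppose that the matrices $\kappa(s,t)$ (defined in the context) are positive definite for all $0\le s<t$. For fixed $\mathbf a,\mathbf b\in\mathbb R^d$ and $T>0$, let the process $(\mathbf U_t)_{t\in[0,T)}$ be given by $$\mathbf U_t:=\mathbf n_{\mathbf a,\mathbf b}(0,t)+\Gamma(t,T)\int_0^t\Gamma(u,T)^{-1}\Sigma(u)\,\mathrm d\mathbf B_u,\qquad t\in[0,T).$$ Then for any $t\in[0,T)$ the distribution of $\mathbf U_t$ is Gauss with mean $\mathbf n_{\mathbf a,\mathbf b}(0,t)$ and covariance matrix $\Sigma(0,t)$. Especially, $\mathbf U_t\to\mathbf b$ almost surely (and hence in probability) and in $L^2$ as $t\uparrow T$. Hence the process $(\mathbf U_t)_{t\in[0,T)}$ can be extended to an almost surely (and hence stochastically) and $L^2$-continuous process $(\mathbf U_t)_{t\in[0,T]}$ with $\mathbf U_0=\mathbf a$ and $\mathbf U_T=\mathbf b$. Moreover, $(\mathbf U_t)_{t\in[0,T]}$ is a Gauss-Markov process, and for any $\mathbf x\in\mathbb R^d$ and $0\le s<t<T$ the transition density $\mathbb R^d\ni\mathbf y\mapsto p^{\mathbf U}_{s,t}(\mathbf x,\mathbf y)$ of $\mathbf U_t$ given $\mathbf U_s=\mathbf x$ is $$p^{\mathbf U}_{s,t}(\mathbf x,\mathbf y)=\frac1{\sqrt{(2\pi)^d\det\Sigma(s,t)}}\exp\left\{-\frac12\Big\langle\Sigma(s,t)^{-1}\big(\mathbf y-\mathbf n_{\mathbf x,\mathbf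 b}(s,t)\big),\ \mathbf y-\mathbf n_{\mathbf x,\mathbf b}(s,t)\Big\rangle\right\},$$ which coincides with $$\frac{p^{\mathbf Z}_{s,t}(\mathbf x,\mathbf y)\,p^{\mathbf Z}_{t,T}(\mathbf y,\mathbf b)}{p^{\mathbf Z}_{s,T}(\mathbf x,\mathbf b)}.$$
   Context: $Q:\mathbb R_+\to\mathbb R^{d\times d}$, $\Sigma:\mathbb R_+\to\mathbb R^{d\times p}$, $\mathbf r:\mathbb R_+\to\mathbb R^d$ are continuous functions, and $(\mathbf B_t)_{t\ge0}$ is a $p$-dimensional standard Wiener process on a filtered probability space satisfying the usual conditions. "Gauss" means normal (possibly degenerate). Evolution matrices: $E(t,s)\in\mathbb R^{d\times d}$, $s,t\ge0$, is the unique solution of $\partial_1E(t,s)=Q(t)E(t,s)$, $E(s,s)=I_d$. One has $E(t,s)E(s,r)=E(t,r)$ and $E(t,s)^{-1}=E(s,t)$. For $0\le s\le t$: $\kappa(s,t):=\int_s^tE(t,u)\Sigma(u)\Sigma(u)^\top E(t,u)^\top\,\mathrm du$ and $\Gamma(s,t):=E(s,t)\kappa(s,t)=\int_s^tE(s,u)\Sigma(u)\Sigma(u)^\top E(t,u)^\top\,\mathrm du$. For $\mathbf x\in\mathbb R^d$, $0\le s\le t$: $\mathbf m^+_{\mathbf x}(s,t):=\mathbf x+\int_s^tE(s,u)\mathbf r(u)\,\mathrm du$, $\ \mathbf m^-_{\mathbf x}(s,t):=\mathbf x-\int_s^tE(t,u)\mathbf r(u)\,\mathrm du$, $\ \mathbf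 m_{\mathbf x}(s,t):=E(t,s)\mathbf m^+_{\mathbf x}(s,t)$. For fixed $T>0$, $0\le s\le t<T$ and $\mathbf a,\mathbf b\in\mathbb R^d$ (two-argument $\Sigma(s,t)$ is different from the coefficient $\Sigma(u)$): $\Sigma(s,t):=\Gamma(t,T)\Gamma(s,T)^{-1}\Gamma(s,t)$ and $$\mathbf n_{\mathbf a,\mathbf b}(s,t):=\Gamma(t,T)\Gamma(s,T)^{-1}\mathbf m^+_{\mathbf a}(s,t)+\Gamma(s,t)^\top\big(\Gamma(s,T)^\top\big)^{-1}\mathbf m^-_{\mathbf b}(t,T).$$ For $0\le s<t$ and $\mathbf x,\mathbf y\in\mathbb R^d$, $$p^{\mathbf Z}_{s,t}(\mathbf x,\mathbf y)=\frac1{\sqrt{(2\pi)^d\det\kappa(s,t)}}\exp\left\{-\tfrac12\big\langle\kappa(s,t)^{-1}(\mathbf y-\mathbf m_{\mathbf x}(s,t)),\mathbf y-\mathbf m_{\mathbf x}(s,t)\big\rangle\right\}$$ are the transition densities of the linear process $\mathrm d\mathbf Z_t=(Q(t)\mathbf Z_t+\mathbf r(t))\,\mathrm dt+\Sigma(t)\,\mathrm d\mathbf B_t$, where $\mathbf Z_0$ is Gauss and independent of $\mathbf B$. *)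

theory Defs
  imports "HOL-Probability.Probability"
begin

section \<open>Linear algebra and the deterministic data\<close>

definition pos_def :: "real^'n^'n \<Rightarrow> bool" where
  "pos_def A \<longleftrightarrow> transpose A = A \<and> (\<forall>x. x \<noteq> 0 \<longrightarrow> 0 < (A *v x) \<bullet> x)"

text \<open>The matrices \<open>E(t,s)\<close> solve \<open>\<partial>\<^sub>1 E(t,s) = Q(t) E(t,s)\<close>, \<open>E(s,s) = I\<close> on the closed half line,
  so the derivative at \<open>t = 0\<close> is one-sided. For continuous \<open>Q\<close> there is exactly one such family
  (on nonnegative arguments); this predicate says that \<open>E\<close> is that family.\<close>

definition evolution_matrices :: "(real \<Rightarrow> real^'d^'d) \<Rightarrow> (real \<Rightarrow> real \<Rightarrow> real^'d^'d) \<Rightarrow> bool" where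
  "evolution_matrices Q E \<longleftrightarrow>
     (\<forall>s\<ge>0. E s s = mat 1 \<and>
        (\<forall>t\<ge>0. ((\<lambda>t. E t s) has_vector_derivative (Q t ** E t s)) (at t within {0..})))"

definition kappa :: "(real \<Rightarrow> real \<Rightarrow> real^'d^'d) \<Rightarrow> (real \<Rightarrow> real^'p^'d) \<Rightarrow> real \<Rightarrow> real \<Rightarrow> real^'d^'d" where
  "kappa E Sg s t =
     integral {s..t} (\<lambda>u. E t u ** Sg u ** transpose (Sg u) ** transpose (E t u))"

definition Gam :: "(real \<Rightarrow> real \<Rightarrow> real^'d^'d) \<Rightarrow> (real \<Rightarrow> real^'p^'d) \<Rightarrow> real \<Rightarrow> real \<Rightarrow> real^'d^'d" where
  "Gam E Sg s t = E s t ** kappa E Sg s t"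

definition mplus :: "(real \<Rightarrow> real \<Rightarrow> real^'d^'d) \<Rightarrow> (real \<Rightarrow> real^'d) \<Rightarrow> real^'d \<Rightarrow> real \<Rightarrow> real \<Rightarrow> real^'d" where
  "mplus E r x s t = x + integral {s..t} (\<lambda>u. E s u *v r u)"

definition mminus :: "(real \<Rightarrow> real \<Rightarrow> real^'d^'d) \<Rightarrow> (real \<Rightarrow> real^'d) \<Rightarrow> real^'d \<Rightarrow> real \<Rightarrow> real \<Rightarrow> real^'d" where
  "mminus E r x s t = x - integral {s..t} (\<lambda>u. E t u *v r u)"

definition mlin :: "(real \<Rightarrow> real \<Rightarrow> real^'d^'d) \<Rightarrow> (real \<Rightarrow> real^'d) \<Rightarrow> real^'d \<Rightarrow> real \<Rightarrow> real \<Rightarrow> real^'d" where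
  "mlin E r x s t = E t s *v mplus E r x s t"

text \<open>The two-argument \<open>\<Sigma>(s,t)\<close>, not to be confused with the diffusion coefficient \<open>Sg\<close>.\<close>

definition bridge_cov ::
    "(real \<Rightarrow> real \<Rightarrow> real^'d^'d) \<Rightarrow> (real \<Rightarrow> real^'p^'d) \<Rightarrow> real \<Rightarrow> real \<Rightarrow> real \<Rightarrow> real^'d^'d" where
  "bridge_cov E Sg T s t = Gam E Sg t T ** matrix_inv (Gam E Sg s T) ** Gam E Sg s t"

text \<open>\<open>n\<^sub>a\<^sub>b(s,t)\<close>.\<close>

definition bridge_mean ::
    "(real \<Rightarrow> real \<Rightarrow> real^'d^'d) \<Rightarrow> (real \<Rightarrow> real^'p^'d) \<Rightarrow> (real \<Rightarrow> real^'d) \<Rightarrow> real \<Rightarrow>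
       real^'d \<Rightarrow> real^'d \<Rightarrow> real \<Rightarrow> real \<Rightarrow> real^'d" where
  "bridge_mean E Sg r T a b s t =
     (Gam E Sg t T ** matrix_inv (Gam E Sg s T)) *v mplus E r a s t
     + (transpose (Gam E Sg s t) ** matrix_inv (transpose (Gam E Sg s T))) *v mminus E r b t T"

definition gauss_density :: "real^'d \<Rightarrow> real^'d^'d \<Rightarrow> real^'d \<Rightarrow> real" where
  "gauss_density m C y =
     1 / sqrt ((2 * pi) ^ CARD('d) * det C) * exp (- (1/2) * ((matrix_inv C *v (y - m)) \<bullet> (y - m)))"

definition pZ ::
    "(real \<Rightarrow> real \<Rightarrow> real^'d^'d) \<Rightarrow> (real \<Rightarrow> real^'p^'d) \<Rightarrow> (real \<Rightarrow> real^'d) \<Rightarrow>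
       real \<Rightarrow> real \<Rightarrow> real^'d \<Rightarrow> real^'d \<Rightarrow> real" where
  "pZ E Sg r s t x y = gauss_density (mlin E r x s t) (kappa E Sg s t) y"

section \<open>Gauss vectors and modes of convergence\<close>

definition normal_law :: "real \<Rightarrow> real \<Rightarrow> real measure" where
  "normal_law \<mu> \<sigma> =
     (if \<sigma> = 0 then return borel \<mu> else density lborel (\<lambda>x. ennreal (normal_density \<mu> \<sigma> x)))"

text \<open>Possibly degenerate: every linear functional has a (possibly degenerate) normal law.\<close>

definition gauss_vector :: "'a measure \<Rightarrow> ('a \<Rightarrow> 'b::euclidean_space) \<Rightarrow> bool" where
  "gauss_vector M X \<longleftrightarrow> X \<in> borel_measurable M \<and>
     (\<forall>c. \<exists>\<mu> \<sigma>. 0 \<le> \<sigma> \<and> distr M borel (\<lambda>\<omega>. c \<bullet> X \<omega>) = normal_law \<mu> \<sigma>)"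

definition cov_matrix :: "'a measure \<Rightarrow> ('a \<Rightarrow> real^'d) \<Rightarrow> real^'d^'d" where
  "cov_matrix M X = (\<chi> i j. \<integral>\<omega>. (X \<omega> $ i - (\<integral>\<omega>'. X \<omega>' $ i \<partial>M)) * (X \<omega> $ j - (\<integral>\<omega>'. X \<omega>' $ j \<partial>M)) \<partial>M)"

definition gauss_with :: "'a measure \<Rightarrow> ('a \<Rightarrow> real^'d) \<Rightarrow> real^'d \<Rightarrow> real^'d^'d \<Rightarrow> bool" where
  "gauss_with M X m C \<longleftrightarrow>
     gauss_vector M X \<and> integral\<^sup>L M X = m \<and> cov_matrix M X = C"

definition tendsto_prob ::
    "'a measure \<Rightarrow> ('i \<Rightarrow> 'a \<Rightarrow> 'b::euclidean_space) \<Rightarrow> ('a \<Rightarrow> 'b) \<Rightarrow> 'i filter \<Rightarrow> bool" where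
  "tendsto_prob M X Y \<F> \<longleftrightarrow>
     (\<forall>\<^sub>F i in \<F>. X i \<in> borel_measurable M) \<and> Y \<in> borel_measurable M \<and>
     (\<forall>\<epsilon>>0. ((\<lambda>i. measure M {\<omega> \<in> space M. \<epsilon> < dist (X i \<omega>) (Y \<omega>)}) \<longlongrightarrow> 0) \<F>)"

definition square_integrable :: "'a measure \<Rightarrow> ('a \<Rightarrow> 'b::euclidean_space) \<Rightarrow> bool" where
  "square_integrable M X \<longleftrightarrow> X \<in> borel_measurable M \<and> integrable M (\<lambda>\<omega>. (norm (X \<omega>))\<^sup>2)"

definition tendsto_L2 ::
    "'a measure \<Rightarrow> ('i \<Rightarrow> 'a \<Rightarrow> 'b::euclidean_space) \<Rightarrow> ('a \<Rightarrow> 'b) \<Rightarrow> 'i filter \<Rightarrow> bool" where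
  "tendsto_L2 M X Y \<F> \<longleftrightarrow>
     (\<forall>\<^sub>F i in \<F>. square_integrable M (X i)) \<and> square_integrable M Y \<and>
     ((\<lambda>i. \<integral>\<^sup>+\<omega>. ennreal ((norm (X i \<omega> - Y \<omega>))\<^sup>2) \<partial>M) \<longlongrightarrow> 0) \<F>"

section \<open>Filtrations, Wiener processes, stochastic integrals\<close>

definition usual_filtered_space :: "'a measure \<Rightarrow> (real \<Rightarrow> 'a measure) \<Rightarrow> bool" where
  "usual_filtered_space M F \<longleftrightarrow> prob_space M \<and> complete_measure M \<and>
     (\<forall>t\<ge>0. subalgebra M (F t)) \<and>
     (\<forall>s t. 0 \<le> s \<and> s \<le> t \<longrightarrow> sets (F s) \<subseteq> sets (F t)) \<and>
     null_sets M \<subseteq> sets (F 0) \<and>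
     (\<forall>t\<ge>0. sets (F t) = (\<Inter>u\<in>{t<..}. sets (F u)))"

definition wiener_process ::
    "'a measure \<Rightarrow> (real \<Rightarrow> 'a measure) \<Rightarrow> (real \<Rightarrow> 'a \<Rightarrow> real^'p) \<Rightarrow> bool" where
  "wiener_process M F B \<longleftrightarrow>
     (\<forall>t\<ge>0. B t \<in> borel_measurable (F t)) \<and>
     (AE \<omega> in M. B 0 \<omega> = 0) \<and>
     (AE \<omega> in M. continuous_on {0..} (\<lambda>t. B t \<omega>)) \<and>
     (\<forall>s t. 0 \<le> s \<and> s \<le> t \<longrightarrow>
        prob_space.indep_set M (sets (F s))
          (sets (vimage_algebra (space M) (\<lambda>\<omega>. B t \<omega> - B s \<omega>) borel)) \<and>
        gauss_with M (\<lambda>\<omega>. B t \<omega> - B s \<omega>) 0 ((t - s) *\<^sub>R mat 1))"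

text \<open>Simple integrands \<open>\<Sum>k<n. 1\<^bsub>(\<tau>\<^sub>k, \<tau>\<^sub>k\<^sub>+\<^sub>1]\<^esub> \<xi>\<^sub>k\<close> with bounded \<open>F(\<tau>\<^sub>k)\<close>-measurable
  matrix-valued \<open>\<xi>\<^sub>k\<close>, and their integrals.\<close>

definition simple_integrand ::
    "'a measure \<Rightarrow> (real \<Rightarrow> 'a measure) \<Rightarrow> nat \<Rightarrow> (nat \<Rightarrow> real) \<Rightarrow> (nat \<Rightarrow> 'a \<Rightarrow> real^'p^'d) \<Rightarrow> bool" where
  "simple_integrand M F n \<tau> \<xi> \<longleftrightarrow> 0 \<le> \<tau> 0 \<and> (\<forall>k<n. \<tau> k \<le> \<tau> (Suc k)) \<and>
     (\<forall>k<n. \<xi> k \<in> borel_measurable (F (\<tau> k)) \<and> bounded (\<xi> k ` space M))"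

definition simple_value ::
    "nat \<Rightarrow> (nat \<Rightarrow> real) \<Rightarrow> (nat \<Rightarrow> 'a \<Rightarrow> real^'p^'d) \<Rightarrow> real \<Rightarrow> 'a \<Rightarrow> real^'p^'d" where
  "simple_value n \<tau> \<xi> u \<omega> = (\<Sum>k<n. indicator {\<tau> k<..\<tau> (Suc k)} u *\<^sub>R \<xi> k \<omega>)"

definition simple_integral ::
    "(real \<Rightarrow> 'a \<Rightarrow> real^'p) \<Rightarrow> nat \<Rightarrow> (nat \<Rightarrow> real) \<Rightarrow> (nat \<Rightarrow> 'a \<Rightarrow> real^'p^'d) \<Rightarrow> real \<Rightarrow> 'a \<Rightarrow> real^'d" where
  "simple_integral B n \<tau> \<xi> t \<omega> = (\<Sum>k<n. \<xi> k \<omega> *v (B (min t (\<tau> (Suc k))) \<omega> - B (min t (\<tau> k)) \<omega>))"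

text \<open>\<open>ito_integral M F B T H J\<close>: the process \<open>J\<close> is (a version with almost surely continuous paths of)
  \<open>(\<integral>\<^sub>0\<^sup>t H\<^sub>u dB\<^sub>u)\<close> for \<open>t \<in> [0,T)\<close>. As in Karatzas and Shreve (Definition 3.2.9), the integral of a
  progressively measurable \<open>H\<close> with finite second moments is characterised by
  \<open>\<integral>\<^sub>0\<^sup>t H\<^sup>k dB \<longrightarrow> J\<^sub>t\<close> in mean square for every sequence of simple integrands \<open>H\<^sup>k\<close> approximating \<open>H\<close>
  in mean square on \<open>[0,t]\<close>. Such sequences exist, and the Ito isometry makes the limit independent
  of the choice, so \<open>J\<close> is unique up to indistinguishability. The matrix norm is the Frobenius norm.\<close>

definition ito_integral ::
    "'a measure \<Rightarrow> (real \<Rightarrow> 'a measure) \<Rightarrow> (real \<Rightarrow> 'a \<Rightarrow> real^'p) \<Rightarrow> real \<Rightarrow>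
       (real \<Rightarrow> 'a \<Rightarrow> real^'p^'d) \<Rightarrow> (real \<Rightarrow> 'a \<Rightarrow> real^'d) \<Rightarrow> bool" where
  "ito_integral M F B T H J \<longleftrightarrow>
     (\<forall>t\<in>{0..<T}.
        (\<lambda>(u, \<omega>). H u \<omega>) \<in> borel_measurable (restrict_space borel {0..t} \<Otimes>\<^sub>M F t) \<and>
        (\<integral>\<^sup>+\<omega>. (\<integral>\<^sup>+u\<in>{0..t}. ennreal ((norm (H u \<omega>))\<^sup>2) \<partial>lborel) \<partial>M) < \<infinity>) \<and>
     (\<forall>t\<in>{0..<T}. J t \<in> borel_measurable (F t)) \<and>
     (AE \<omega> in M. continuous_on {0..<T} (\<lambda>t. J t \<omega>)) \<and>
     (\<forall>t\<in>{0..<T}. \<forall>n \<tau> \<xi>.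
        (\<forall>k. simple_integrand M F (n k) (\<tau> k) (\<xi> k)) \<longrightarrow>
        (\<lambda>k. \<integral>\<^sup>+\<omega>. (\<integral>\<^sup>+u\<in>{0..t}.
            ennreal ((norm (H u \<omega> - simple_value (n k) (\<tau> k) (\<xi> k) u \<omega>))\<^sup>2) \<partial>lborel) \<partial>M) \<longlonglongrightarrow> 0 \<longrightarrow>
        (\<lambda>k. \<integral>\<^sup>+\<omega>. ennreal ((norm (J t \<omega> - simple_integral B (n k) (\<tau> k) (\<xi> k) t \<omega>))\<^sup>2) \<partial>M) \<longlonglongrightarrow> 0)"

section \<open>Gauss processes, Markov processes, transition densities\<close>

text \<open>All finite-dimensional distributions are Gauss. Linear functionals of the stacked vector
  \<open>(X\<^sub>t)\<close>, \<open>t \<in> K\<close>, are exactly the sums below.\<close>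

definition gauss_process :: "'a measure \<Rightarrow> real set \<Rightarrow> (real \<Rightarrow> 'a \<Rightarrow> 'b::euclidean_space) \<Rightarrow> bool" where
  "gauss_process M I X \<longleftrightarrow> (\<forall>t\<in>I. X t \<in> borel_measurable M) \<and>
     (\<forall>K c. finite K \<and> K \<subseteq> I \<longrightarrow> gauss_vector M (\<lambda>\<omega>. \<Sum>t\<in>K. c t \<bullet> X t \<omega>))"

definition past ::
    "'a measure \<Rightarrow> real set \<Rightarrow> (real \<Rightarrow> 'a \<Rightarrow> 'b::topological_space) \<Rightarrow> real \<Rightarrow> 'a measure" where
  "past M I X s =
     sigma (space M) {X r -` A \<inter> space M | r A. r \<in> I \<and> r \<le> s \<and> A \<in> sets borel}"

definition markov_process ::
    "'a measure \<Rightarrow> real set \<Rightarrow> (real \<Rightarrow> 'a \<Rightarrow> 'b::euclidean_space) \<Rightarrow> bool" where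
  "markov_process M I X \<longleftrightarrow> (\<forall>t\<in>I. X t \<in> borel_measurable M) \<and>
     (\<forall>s\<in>I. \<forall>t\<in>I. s \<le> t \<longrightarrow> (\<forall>A\<in>sets borel. AE \<omega> in M.
        real_cond_exp M (past M I X s) (indicator (X t -` A \<inter> space M)) \<omega> =
        real_cond_exp M (vimage_algebra (space M) (X s) borel) (indicator (X t -` A \<inter> space M)) \<omega>))"

text \<open>The law of \<open>X\<^sub>t\<close> given \<open>X\<^sub>s = x\<close> is determined only up to null sets of \<open>x\<close>. As usual, having
  transition densities \<open>p s t x\<close> for \<^emph>\<open>all\<close> \<open>x\<close> means that these form a transition function (probability
  densities satisfying the Chapman-Kolmogorov equation) and that \<open>X\<close> is Markov with this
  transition function.\<close>

definition transition_densities ::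
    "'a measure \<Rightarrow> real set \<Rightarrow> (real \<Rightarrow> 'a \<Rightarrow> 'b::euclidean_space) \<Rightarrow>
       (real \<Rightarrow> real \<Rightarrow> 'b \<Rightarrow> 'b \<Rightarrow> real) \<Rightarrow> bool" where
  "transition_densities M I X p \<longleftrightarrow>
     (\<forall>t\<in>I. X t \<in> borel_measurable M) \<and>
     (\<forall>s\<in>I. \<forall>t\<in>I. s < t \<longrightarrow>
        (\<lambda>(x, y). p s t x y) \<in> borel_measurable (borel \<Otimes>\<^sub>M borel) \<and>
        (\<forall>x y. 0 \<le> p s t x y) \<and>
        (\<forall>x. (\<integral>\<^sup>+y. ennreal (p s t x y) \<partial>lborel) = 1) \<and>
        (\<forall>A\<in>sets borel. AE \<omega> in M.
           real_cond_exp M (past M I X s) (indicator (X t -` A \<inter> space M)) \<omega> =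
           (LINT y:A|lborel. p s t (X s \<omega>) y))) \<and>
     (\<forall>s\<in>I. \<forall>u\<in>I. \<forall>t\<in>I. s < u \<and> u < t \<longrightarrow> (\<forall>x. AE z in lborel.
        ennreal (p s t x z) = (\<integral>\<^sup>+y. ennreal (p s u x y * p u t y z) \<partial>lborel)))"

end

theory Submission
  imports Defs
begin

text \<open>In the frame moving with the flow \<open>E(0,t)\<close> the bridge becomes \<open>R t (\<Lambda> 0 x + \<Phi>(T)\<^sup>T J t)\<close>, where
  \<open>R t\<close> is the remaining covariance on \<open>[t,T]\<close>, \<open>\<Lambda> t = R t\<^sup>-\<^sup>1\<close>, and the Wiener integral \<open>\<Phi>(T)\<^sup>T J\<close> has independent
  Gauss increments with covariance \<open>\<Lambda> t - \<Lambda> s\<close>. Means, covariances and densities are then matrix algebra.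
  The law of the increments of \<open>J\<close> given the past is read off from characteristic functions, by passing to
  the limit in Riemann sums; uniqueness of multivariate characteristic functions turns this into the
  Markov property and the transition densities.

  Almost sure convergence at \<open>T\<close> is delicate in several dimensions, since the eigenvalues of \<open>R t\<close> may
  vanish at different rates. It follows by reversing time: with \<open>N t = (\<Lambda> t - \<Lambda> 0)\<^sup>-\<^sup>1\<close>, the Gauss process
  \<open>N t \<Phi>(T)\<^sup>T J t\<close> has increments of covariance \<open>N s - N t\<close>, where \<open>N t \<rightarrow> 0\<close>, and a maximal inequality for
  fourth moments controls its supremum on \<open>[s,T)\<close> by the trace of \<open>N s\<close>.\<close>

section \<open>Matrices\<close>

text \<open>Two difficulties shape the proof. The stochastic integral is known only through mean
  square limits, yet conditional laws are wanted. Testing against bounded factors Z measurable at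
  time s settles this: the identity E(Z exp(i c.(J t - J s))) = E(Z) exp(-c.(\<open>C s t\<close>
  c)/2) survives such limits and contains independence and the Gauss law at once. The other
  difficulty is that the noise of the bridge is \<open>R t\<close> times a martingale Y whose
  covariance D t = \<open>\<Lambda> t - \<Lambda> 0\<close> explodes at \<open>T\<close>. For s
  \<le> t the covariance of Y s and Y t is D s, so that of N s Y s and N t Y t, with N the inverse
  of D, is N t: a matrix form of the time inversion that passes from B t to B t / t. Moreover
  \<open>R t\<close> D t = 1 - \<open>R t\<close> \<open>\<Lambda> 0\<close> stays bounded, so it is
  enough that N t Y t vanishes at \<open>T\<close>. Fourth moments serve because for Gauss
  increments they are quadratic in the clock: halving the clock divides the bound by four, and a
  bisection closes up without martingale theory.\<close>

lemma matrix_inv_unique: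
  fixes A B :: "real^'n^'n"
  assumes "A ** B = mat 1"
  shows "matrix_inv A = B"
proof -
  have BA: "B ** A = mat 1"
    using assms matrix_left_right_inverse by blast
  have "A ** matrix_inv A = mat 1 \<and> matrix_inv A ** A = mat 1"
    unfolding matrix_inv_def by (rule someI[of _ B]) (simp add: assms BA)
  then have "matrix_inv A = B ** (A ** matrix_inv A)"
    by (metis BA matrix_mul_assoc matrix_mul_lid)
  then show ?thesis
    using \<open>A ** matrix_inv A = mat 1 \<and> _\<close> by simp
qed

lemma matrix_inv_right: "A ** matrix_inv A = mat 1"
  and matrix_inv_left: "matrix_inv A ** A = mat 1"
  if "invertible (A :: real^'n^'n)"
proof -
  obtain B where "A ** B = mat 1"
    using \<open>invertible A\<close> by (auto simp: invertible_def)
  then show "A ** matrix_inv A = mat 1" "matrix_inv A ** A = mat 1"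
    using matrix_inv_unique matrix_left_right_inverse by blast+
qed

lemma matrix_inv_mult:
  fixes A B :: "real^'n^'n"
  assumes "invertible A" "invertible B"
  shows "matrix_inv (A ** B) = matrix_inv B ** matrix_inv A"
proof (rule matrix_inv_unique)
  have "A ** B ** (matrix_inv B ** matrix_inv A) = A ** (B ** matrix_inv B) ** matrix_inv A"
    by (simp add: matrix_mul_assoc)
  then show "A ** B ** (matrix_inv B ** matrix_inv A) = mat 1"
    by (simp add: assms matrix_inv_right)
qed

lemma matrix_inv_transpose:
  fixes A :: "real^'n^'n"
  assumes "invertible A"
  shows "matrix_inv (transpose A) = transpose (matrix_inv A)"
  by (rule matrix_inv_unique)
    (metis assms matrix_inv_left matrix_transpose_mul transpose_mat)

lemma det_matrix_inv:
  fixes A :: "real^'n^'n"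
  assumes "invertible A"
  shows "det (matrix_inv A) = inverse (det A)"
  by (metis assms det_I det_mul inverse_unique matrix_inv_right)

lemma matrix_add_rdistrib: "(B + C) ** A = B ** A + (C :: real^'m^'k) ** A"
  by (vector matrix_matrix_mult_def sum.distrib distrib_right)

lemma matrix_diff_ldistrib: "A ** (B - C) = A ** B - A ** (C :: real^'k^'m)"
  and matrix_diff_rdistrib: "(B' - C') ** A' = B' ** A' - (C' :: real^'m^'k) ** A'"
  by (vector matrix_matrix_mult_def sum_subtractf left_diff_distrib right_diff_distrib)+

lemma transpose_add: "transpose (A + B) = transpose A + transpose B"
  and transpose_diff: "transpose (A' - B') = transpose A' - transpose (B' :: real^'k^'m)"
  by (vector transpose_def)+

lemma inner_transpose_left: "(transpose A *v x) \<bullet> y = x \<bullet> (A *v y)"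
  for A :: "real^'n^'m"
  using dot_lmul_matrix[of x A y] by simp

lemma inner_matrix_symmetric:
  assumes "transpose A = (A :: real^'n^'n)"
  shows "(A *v x) \<bullet> y = x \<bullet> (A *v y)"
  using inner_transpose_left[of A x y] assms by metis

lemma matrix_mul_assoc_rev: "(A ** B) ** C = A ** (B ** C)"
  for C :: "real^'k^'l"
  by (simp add: matrix_mul_assoc)

lemma matrix_mul_cancel:
  fixes A B :: "real^'n^'n" and C :: "real^'m^'n"
  assumes "A ** B = mat 1"
  shows "A ** (B ** C) = C"
  by (simp add: matrix_mul_assoc assms)

lemma matrix_vector_mul_cancel:
  fixes A B :: "real^'n^'n"
  assumes "A ** B = mat 1"
  shows "A *v (B *v x) = x"
  by (simp add: matrix_vector_mul_assoc assms)

lemma bounded_bilinear_matrix_matrix_mult [bounded_bilinear]: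
  "bounded_bilinear ((**) :: real^'n^'m \<Rightarrow> real^'k^'n \<Rightarrow> real^'k^'m)"
  by (simp add: bilinear_conv_bounded_bilinear[symmetric] bilinear_def matrix_add_ldistrib
      matrix_add_rdistrib matrix_scalar_ac scalar_matrix_assoc linear_iff)

lemma bounded_bilinear_matrix_vector_mult [bounded_bilinear]:
  "bounded_bilinear ((*v) :: real^'n^'m \<Rightarrow> real^'n \<Rightarrow> real^'m)"
  by (simp add: bilinear_conv_bounded_bilinear[symmetric] bilinear_def linear_iff
      matrix_vector_right_distrib matrix_vector_mult_add_rdistrib matrix_vector_mult_scaleR
      scaleR_matrix_vector_assoc)

lemma bounded_linear_transpose [bounded_linear]:
  "bounded_linear (transpose :: real^'n^'m \<Rightarrow> real^'m^'n)"
  by (simp add: linear_conv_bounded_linear[symmetric] linear_iff transpose_add transpose_scalar)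

section \<open>Continuity of determinants and inverses\<close>

lemma continuous_on_det [continuous_intros]:
  fixes A :: "'a::topological_space \<Rightarrow> real^'n^'n"
  assumes "continuous_on S A"
  shows "continuous_on S (\<lambda>x. det (A x))"
  unfolding det_def by (intro continuous_intros assms)

text \<open>Cramer's rule for the j-th column of the inverse, the solution of A x = e_j. The entries
  are thus quotients of polynomials in the entries of \<open>A\<close>, which is what makes
  inversion continuous.\<close>

lemma matrix_inv_nth_cramer:
  fixes A :: "real^'n^'n"
  assumes "invertible A"
  shows "matrix_inv A $ i $ j = det (\<chi> k l. if l = i then mat 1 $ k $ j else A $ k $ l) / det A"
proof -
  have "A *v column j (matrix_inv A) = column j (mat 1)"
    by (metis assms matrix_inv_right matrix_vector_mul_assoc matrix_vector_mult_basis)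
  then have "column j (matrix_inv A) =
      (\<chi> k. det (\<chi> i l. if l = k then column j (mat 1) $ i else A $ i $ l) / det A)"
    using cramer[of A] assms invertible_det_nz[of A] by blast
  then show ?thesis
    by (simp add: column_def vec_eq_iff cong: if_cong)
qed

lemma continuous_on_matrix_inv:
  fixes A :: "'a::topological_space \<Rightarrow> real^'n^'n"
  assumes "continuous_on S A" and inv: "\<And>x. x \<in> S \<Longrightarrow> invertible (A x)"
  shows "continuous_on S (\<lambda>x. matrix_inv (A x))"
proof -
  have "continuous_on S (\<lambda>x. matrix_inv (A x) $ i $ j)" for i j
  proof (subst continuous_on_cong[OF refl matrix_inv_nth_cramer[OF inv]])
    have *: "continuous_on S (\<lambda>x. if l = i then mat 1 $ k $ j else A x $ k $ l)" for k l
      by (cases "l = i") (auto intro!: continuous_intros assms)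
    show "continuous_on S (\<lambda>x. det (\<chi> k l. if l = i then mat 1 $ k $ j else A x $ k $ l) / det (A x))"
      using inv by (intro continuous_intros continuous_on_vec_lambda assms *)
        (auto simp: invertible_det_nz)
  qed
  then have "continuous_on S (\<lambda>x. \<chi> i. \<chi> j. matrix_inv (A x) $ i $ j)"
    by (intro continuous_on_vec_lambda)
  then show ?thesis by simp
qed

section \<open>Positive definite matrices\<close>

lemma pos_def_invertible: "invertible A" if "pos_def (A :: real^'n^'n)"
proof -
  have "A *v x = 0 \<Longrightarrow> x = 0" for x
    using that unfolding pos_def_def by (metis inner_zero_left less_irrefl)
  then show ?thesis
    using matrix_left_invertible_ker[of A] by (simp add: invertible_left_inverse)
qed

lemma pos_def_symmetric: "pos_def A \<Longrightarrow> transpose A = A"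
  by (simp add: pos_def_def)

lemma pos_def_congruence:
  fixes A L :: "real^'n^'n"
  assumes "pos_def A" "invertible L"
  shows "pos_def (L ** A ** transpose L)"
  unfolding pos_def_def
proof (intro conjI allI impI)
  show "transpose (L ** A ** transpose L) = L ** A ** transpose L"
    by (simp add: matrix_transpose_mul pos_def_symmetric[OF assms(1)] matrix_mul_assoc)
  fix x :: "real^'n" assume "x \<noteq> 0"
  then have "transpose L *v x \<noteq> 0"
    using transpose_invertible[OF assms(2)] inj_matrix_vector_mult
    by (metis matrix_vector_mult_0_right matrix_left_invertible_ker invertible_def)
  then have "0 < (A *v (transpose L *v x)) \<bullet> (transpose L *v x)"
    using assms(1) unfolding pos_def_def by blast
  also have "\<dots> = (L ** A ** transpose L *v x) \<bullet> x"
    by (metis inner_commute inner_transpose_left matrix_vector_mul_assoc)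
  finally show "0 < (L ** A ** transpose L *v x) \<bullet> x" .
qed

lemma pos_def_matrix_inv:
  fixes A :: "real^'n^'n"
  assumes "pos_def A"
  shows "pos_def (matrix_inv A)"
proof -
  note inv = pos_def_invertible[OF assms] 
  have "invertible (matrix_inv A)"
    using inv matrix_inv_left invertible_right_inverse by blast
  then have "pos_def (matrix_inv A ** A ** transpose (matrix_inv A))"
    by (rule pos_def_congruence[OF assms])
  then show ?thesis
    by (simp add: matrix_inv_left inv flip: matrix_inv_transpose)
       (simp add: pos_def_symmetric[OF assms])
qed

text \<open>Gram-Schmidt for the scalar product given by \<open>C\<close>, one index at a time.
  While fewer vectors than the dimension have been chosen, some nonzero \<open>x\<close> is
  orthogonal to all \<open>C *v v i\<close>, hence \<open>C\<close>-orthogonal to all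
  \<open>v i\<close>. Indexing by sets of coordinates lets the full family be read as the rows of a
  square matrix.\<close>

lemma pos_def_orthonormal_family:
  fixes C :: "real^'n^'n"
  assumes C: "pos_def C" and "finite (I :: 'n set)"
  shows "\<exists>v. \<forall>i\<in>I. \<forall>j\<in>I. v i \<bullet> (C *v v j) = of_bool (i = j)"
  using assms(2)
proof induction
  case (insert k I)
  then obtain v where v: "\<And>i j. i \<in> I \<Longrightarrow> j \<in> I \<Longrightarrow> v i \<bullet> (C *v v j) = of_bool (i = j)"
    by auto
  have "dim ((\<lambda>i. C *v v i) ` I) \<le> card I"
    by (meson card_image_le dim_le_card' finite_imageI insert.hyps(1) le_trans)
  also have "\<dots> < DIM(real^'n)"
    using insert.hyps psubset_card_mono[of UNIV I] by auto
  finally obtain x where x: "x \<noteq> 0" "\<And>y. y \<in> span ((\<lambda>i. C *v v i) ` I) \<Longrightarrow> orthogonal x y"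
    by (rule orthogonal_to_subspace_exists) (rule that)
  have ortho: "x \<bullet> (C *v v i) = 0" if "i \<in> I" for i
    using x(2)[OF span_base] that by (simp add: orthogonal_def)
  have pos: "0 < x \<bullet> (C *v x)"
    using C x(1) by (simp add: pos_def_def inner_commute)
  define w where "w = v(k := x /\<^sub>R sqrt (x \<bullet> (C *v x)))"
  have sym: "y \<bullet> (C *v z) = z \<bullet> (C *v y)" for y z
    using inner_matrix_symmetric[OF pos_def_symmetric[OF C]] by (metis inner_commute)
  have "w i \<bullet> (C *v w j) = of_bool (i = j)" if "i \<in> insert k I" "j \<in> insert k I" for i j
    using that insert.hyps(2) v ortho pos sym[of "v i" x]
    by (auto simp: w_def matrix_vector_mult_scaleR field_simps)
  then show ?case by blast
qed simp

text \<open>The \<open>C\<close>-orthonormal family, written as the rows of \<open>V\<close>,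
  satisfies V C V^T = 1, so the inverse of \<open>V\<close> can serve as \<open>L\<close>. This
  factor takes the place of a spectral square root: it carries \<open>std_gauss\<close> to the Gauss
  measure with covariance \<open>C\<close>.\<close>

lemma pos_def_factorization:
  fixes C :: "real^'n^'n"
  assumes C: "pos_def C"
  obtains L :: "real^'n^'n" where "invertible L" "C = L ** transpose L"
proof -
  obtain v :: "'n \<Rightarrow> real^'n" where v: "\<And>i j. v i \<bullet> (C *v v j) = of_bool (i = j)"
    using pos_def_orthonormal_family[OF C, of UNIV] by auto
  define V :: "real^'n^'n" where "V = (\<chi> i j. v i $ j)"
  have "V ** C ** transpose V = mat 1"
  proof (simp only: vec_eq_iff, intro allI)
    fix i j
    have "(V ** C ** transpose V) $ i $ j = v i \<bullet> (C *v v j)"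
      unfolding matrix_mul_assoc_rev
      by (simp add: V_def matrix_matrix_mult_def matrix_vector_mult_def transpose_def inner_vec_def)
    then show "(V ** C ** transpose V) $ i $ j = mat 1 $ i $ j"
      using v by (simp add: mat_def)
  qed
  then have 1: "V ** (C ** transpose V) = mat 1"
    by (simp add: matrix_mul_assoc)
  then have inv: "invertible V"
    using invertible_right_inverse by blast
  have 2: "C ** transpose V = matrix_inv V"
    using matrix_inv_unique[OF 1] by simp
  have "C = C ** (transpose V ** matrix_inv (transpose V))"
    by (simp add: matrix_inv_right transpose_invertible inv)
  also have "\<dots> = matrix_inv V ** transpose (matrix_inv V)"
    by (simp add: matrix_mul_assoc 2 matrix_inv_transpose inv)
  finally have C': "C = matrix_inv V ** transpose (matrix_inv V)" .
  have "invertible (matrix_inv V)"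
    using matrix_inv_left[OF inv] invertible_right_inverse[of "matrix_inv V"] by blast
  then show ?thesis
    using C' by (rule that)
qed

lemma pos_def_add: "pos_def A \<Longrightarrow> pos_def B \<Longrightarrow> pos_def (A + B :: real^'n^'n)"
  unfolding pos_def_def
  by (auto simp: transpose_add matrix_vector_mult_add_rdistrib inner_add_left intro!: add_pos_pos)

text \<open>The exponent of a Gauss density does not change when vector and covariance are both
  transformed by \<open>L\<close>; hence densities may be computed in the moving frame.\<close>

lemma matrix_inv_congruence:
  fixes A L :: "real^'n^'n"
  assumes "invertible A" "invertible L"
  shows "(matrix_inv (L ** A ** transpose L) *v (L *v x)) \<bullet> (L *v x) = (matrix_inv A *v x) \<bullet> x"
proof -
  have "matrix_inv (L ** A ** transpose L) = transpose (matrix_inv L) ** (matrix_inv A ** matrix_inv L)"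
    using assms by (simp add: matrix_inv_mult invertible_mult transpose_invertible matrix_inv_transpose)
  then have "matrix_inv (L ** A ** transpose L) *v (L *v x) =
      transpose (matrix_inv L) *v (matrix_inv A *v (matrix_inv L *v (L *v x)))"
    by (simp only: matrix_vector_mul_assoc matrix_mul_assoc)
  then show ?thesis
    using assms by (simp only: inner_transpose_left matrix_vector_mul_cancel matrix_inv_left)
qed

section \<open>Linear changes of variables in Lebesgue measure\<close>

text \<open>Fubini with the coordinate along \<open>b\<close> innermost: by \<open>h_inv\<close> the
  shift is constant on each line parallel to \<open>b\<close>, so the inner integral is merely
  translated.\<close>

lemma nn_integral_lborel_shear:
  fixes b :: "'a::euclidean_space"
  assumes b: "b \<in> Basis"
    and h [measurable]: "h \<in> borel_measurable borel" and h_inv: "\<And>x y. h (x + y *\<^sub>R b) = h x"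
    and f [measurable]: "f \<in> borel_measurable borel"
  shows "(\<integral>\<^sup>+x. f (x + h x *\<^sub>R b) \<partial>lborel) = (\<integral>\<^sup>+x. f x \<partial>lborel)"
proof -
  interpret product_sigma_finite "\<lambda>_::'a. lborel :: real measure"
    by standard
  let ?I = "Basis - {b} :: 'a set"
  let ?S = "\<lambda>g. \<Sum>c\<in>?I. g c *\<^sub>R c"
  have ins: "insert b ?I = Basis"
    using b by auto
  have upd: "(\<Sum>c\<in>Basis. (g(b := y)) c *\<^sub>R c) = ?S g + y *\<^sub>R b" for g y
    using sum.remove[OF finite_Basis b, of "\<lambda>c. (g(b := y)) c *\<^sub>R c"] by (simp add: add.commute)
  have fub: "(\<integral>\<^sup>+x. F x \<partial>lborel) = (\<integral>\<^sup>+g. (\<integral>\<^sup>+y. F (?S g + y *\<^sub>R b) \<partial>lborel) \<partial>(\<Pi>\<^sub>M c\<in>?I. lborel))"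
    if [measurable]: "F \<in> borel_measurable borel" for F :: "'a \<Rightarrow> ennreal"
  proof -
    have "(\<integral>\<^sup>+x. F x \<partial>lborel) = (\<integral>\<^sup>+g. F (\<Sum>c\<in>Basis. g c *\<^sub>R c) \<partial>(\<Pi>\<^sub>M c\<in>Basis. lborel))"
      unfolding lborel_eq[where 'a='a] by (rule nn_integral_distr) measurable
    also have "\<dots> = (\<integral>\<^sup>+g. (\<integral>\<^sup>+y. F (\<Sum>c\<in>Basis. (g(b := y)) c *\<^sub>R c) \<partial>lborel) \<partial>(\<Pi>\<^sub>M c\<in>?I. lborel))"
    proof -
      have "(\<lambda>g. F (\<Sum>c\<in>Basis. g c *\<^sub>R c)) \<in> borel_measurable (\<Pi>\<^sub>M c\<in>insert b ?I. lborel)"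
        unfolding ins by (rule measurable_compose[OF _ that]) measurable
      moreover have "finite ?I" "b \<notin> ?I"
        by auto
      ultimately show ?thesis
        using product_nn_integral_insert[of ?I b "\<lambda>g. F (\<Sum>c\<in>Basis. g c *\<^sub>R c)"]
        unfolding ins by blast
    qed
    finally show ?thesis by (simp only: upd)
  qed
  have trans: "(\<integral>\<^sup>+y. F (t + y) \<partial>lborel) = (\<integral>\<^sup>+y. F y \<partial>lborel)"
    if [measurable]: "F \<in> borel_measurable borel" for F :: "real \<Rightarrow> ennreal" and t
    by (subst (2) lborel_distr_plus[of t, symmetric]) (simp add: nn_integral_distr)
  have "(\<integral>\<^sup>+y. f (?S g + y *\<^sub>R b + h (?S g + y *\<^sub>R b) *\<^sub>R b) \<partial>lborel) =
      (\<integral>\<^sup>+y. f (?S g + y *\<^sub>R b) \<partial>lborel)" for g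
    unfolding h_inv using trans[of "\<lambda>y. f (?S g + y *\<^sub>R b)" "h (?S g)"]
    by (simp add: scaleR_add_left ac_simps)
  then show ?thesis
    by (simp add: fub)
qed

lemma prod_Basis_vec: "(\<Prod>b\<in>(Basis :: (real^'n) set). g b) = (\<Prod>i\<in>UNIV. g (axis i 1))"
proof -
  have "inj (\<lambda>i :: 'n. axis i (1 :: real))"
    by (simp add: inj_on_def axis_eq_axis)
  moreover have "(Basis :: (real^'n) set) = (\<lambda>i. axis i 1) ` UNIV"
    by (auto simp: Basis_vec_def)
  ultimately show ?thesis
    by (rule prod.reindex_cong) simp
qed

lemma sum_Basis_vec: "(\<Sum>b\<in>(Basis :: (real^'n) set). g b) = (\<Sum>i\<in>UNIV. g (axis i 1))"
proof -
  have "inj (\<lambda>i :: 'n. axis i (1 :: real))"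
    by (simp add: inj_on_def axis_eq_axis)
  moreover have "(Basis :: (real^'n) set) = (\<lambda>i. axis i 1) ` UNIV"
    by (auto simp: Basis_vec_def)
  ultimately show ?thesis
    by (rule sum.reindex_cong) simp
qed

lemma axis_in_BasisD: "b \<in> (Basis :: (real^'n) set) \<Longrightarrow> \<exists>i. b = axis i 1"
  by (auto simp: Basis_vec_def)

text \<open>\<open>T\<close> is an involution, so the preimage of a box is again a box, with the
  same side lengths in another order; boxes determine \<open>lborel\<close>.\<close>

lemma lborel_distr_swap:
  fixes m n :: "'n::finite"
  defines "T \<equiv> (\<lambda>x :: real^'n. \<chi> i. x $ Transposition.transpose m n i)"
  shows "distr lborel borel T = lborel"
proof (rule lborel_eqI[symmetric])
  have [measurable]: "T \<in> borel_measurable borel"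
    unfolding T_def by (intro borel_measurable_continuous_onI continuous_intros continuous_on_vec_lambda)
  have TT: "T (T x) = x" for x
    by (simp add: T_def vec_eq_iff)
  fix l u :: "real^'n" assume le: "\<And>b. b \<in> Basis \<Longrightarrow> l \<bullet> b \<le> u \<bullet> b"
  then have le': "l $ i \<le> u $ i" for i
    using le[of "axis i 1"] by (simp add: inner_axis axis_in_Basis_iff)
  have "T -` box l u = box (T l) (T u)"
  proof (intro set_eqI)
    fix x
    have "(\<forall>i. l $ i < T x $ i \<and> T x $ i < u $ i) \<longleftrightarrow> (\<forall>i. T l $ i < x $ i \<and> x $ i < T u $ i)"
      unfolding T_def by simp (metis transpose_involutory)
    then show "x \<in> T -` box l u \<longleftrightarrow> x \<in> box (T l) (T u)"
      by (simp add: mem_box_cart)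
  qed
  then have "emeasure (distr lborel borel T) (box l u) = emeasure lborel (box (T l) (T u))"
    by (simp add: emeasure_distr)
  also have "\<dots> = (\<Prod>i\<in>UNIV. (T u - T l) $ i)"
    using le' by (subst emeasure_lborel_box_eq)
      (auto simp: prod_Basis_vec inner_axis T_def dest!: axis_in_BasisD)
  also have "(\<Prod>i\<in>UNIV. (T u - T l) $ i) = (\<Prod>i\<in>UNIV. (u - l) $ i)"
    using prod.reindex_bij_betw[of "Transposition.transpose m n" UNIV UNIV "\<lambda>i. (u - l) $ i"]
    by (simp add: T_def)
  finally show "emeasure (distr lborel borel T) (box l u) = (\<Prod>b\<in>Basis. (u - l) \<bullet> b)"
    by (simp add: prod_Basis_vec inner_axis)
qed simp

text \<open>The formula is multiplicative in the matrix, so it is enough to have it for diagonal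
  matrices, transpositions of two coordinates and shears.\<close>

lemma nn_integral_lborel_matrix:
  fixes A :: "real^'n^'n" and f :: "real^'n \<Rightarrow> ennreal"
  assumes "invertible A" and "f \<in> borel_measurable borel"
  shows "ennreal \<bar>det A\<bar> * (\<integral>\<^sup>+x. f (A *v x) \<partial>lborel) = (\<integral>\<^sup>+x. f x \<partial>lborel)"
proof -
  have meas: "(\<lambda>x. f (A *v x)) \<in> borel_measurable borel"
    if "f \<in> borel_measurable borel" for A :: "real^'n^'n" and f :: "real^'n \<Rightarrow> ennreal"
    using that by (rule measurable_compose[rotated])
      (intro borel_measurable_continuous_onI continuous_intros)
  \<comment> \<open>Invertibility belongs to the induction predicate because the induction also
    visits matrices with a zero row, for which the formula fails. It passes from a product to both
    factors.\<close>
  define P where "P A \<longleftrightarrow> (invertible A \<longrightarrow> (\<forall>f\<in>borel_measurable borel.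
      ennreal \<bar>det A\<bar> * (\<integral>\<^sup>+x. f (A *v x) \<partial>lborel) = (\<integral>\<^sup>+x. f x \<partial>lborel)))" for A :: "real^'n^'n"
  have "P A"
  proof (rule induct_matrix_elementary[of P])
    fix A B assume P: "P A" "P B"
    show "P (A ** B)"
      unfolding P_def
    proof (intro impI ballI)
      fix f :: "real^'n \<Rightarrow> ennreal"
      assume "invertible (A ** B)" and f: "f \<in> borel_measurable borel"
      then have inv: "invertible A" "invertible B"
        by (auto simp: invertible_det_nz det_mul)
      have "(\<integral>\<^sup>+x. f x \<partial>lborel) = ennreal \<bar>det A\<bar> * (\<integral>\<^sup>+x. f (A *v x) \<partial>lborel)"
        using P(1) inv f by (simp add: P_def)
      also have "(\<integral>\<^sup>+x. f (A *v x) \<partial>lborel) = ennreal \<bar>det B\<bar> * (\<integral>\<^sup>+x. f (A *v (B *v x)) \<partial>lborel)"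
        using P(2)[unfolded P_def, rule_format, OF inv(2) meas[OF f, of A]] by simp
      finally show "ennreal \<bar>det (A ** B)\<bar> * (\<integral>\<^sup>+x. f (A ** B *v x) \<partial>lborel) = (\<integral>\<^sup>+x. f x \<partial>lborel)"
        by (simp add: matrix_vector_mul_assoc det_mul abs_mult ennreal_mult mult.assoc)
    qed
  next
    fix A :: "real^'n^'n" and i assume "row i A = 0"
    then show "P A"
      using det_zero_row(2)[of i A] by (simp add: P_def invertible_det_nz)
  next
    fix A :: "real^'n^'n" assume diag: "\<And>i j. i \<noteq> j \<Longrightarrow> A $ i $ j = 0"
    have det: "det A = (\<Prod>i\<in>UNIV. A $ i $ i)"
      using diag by (rule det_diagonal)
    show "P A"
      unfolding P_def
    proof (intro impI ballI)
      fix f :: "real^'n \<Rightarrow> ennreal"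
      assume "invertible A" and f [measurable]: "f \<in> borel_measurable borel"
      then have nz: "A $ i $ i \<noteq> 0" for i
        using det by (auto simp: invertible_det_nz)
      define c where "c b = b \<bullet> (A *v b)" for b
      have c: "c (axis i 1) = A $ i $ i" for i
        by (simp add: c_def inner_axis' matrix_vector_mult_basis column_def)
      have "c j \<noteq> 0" if "j \<in> Basis" for j
        using that nz c by (auto simp: Basis_vec_def)
      note affine = lborel_affine_euclidean[of c 0, OF this]
      have AT: "(\<Sum>j\<in>Basis. (c j * (x \<bullet> j)) *\<^sub>R j) = A *v x" for x
      proof -
        have "A $ i $ i * x $ i = (\<Sum>j\<in>UNIV. A $ i $ j * x $ j)" for i
          by (subst sum.remove[of _ i]) (auto simp: diag)
        moreover have "(\<Sum>j\<in>UNIV. ((A $ j $ j * x $ j) *\<^sub>R axis j 1) $ i) = A $ i $ i * x $ i" for i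
          by (simp add: axis_def if_distrib cong: if_cong)
        ultimately show ?thesis
          by (simp add: sum_Basis_vec c inner_axis vec_eq_iff matrix_vector_mult_def)
      qed
      have [measurable]: "(\<lambda>x. A *v x) \<in> borel_measurable borel"
        by (intro borel_measurable_continuous_onI continuous_intros)
      have detc: "ennreal (\<Prod>j\<in>Basis. \<bar>c j\<bar>) = ennreal \<bar>det A\<bar>"
        by (simp add: prod_Basis_vec c det abs_prod)
      have "lborel = density (distr lborel borel (\<lambda>x. A *v x)) (\<lambda>_. ennreal \<bar>det A\<bar>)"
        using affine by (simp only: add_0 AT detc)
      then have "(\<integral>\<^sup>+x. f x \<partial>lborel) =
          (\<integral>\<^sup>+x. f x \<partial>density (distr lborel borel (\<lambda>x. A *v x)) (\<lambda>_. ennreal \<bar>det A\<bar>))"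
        by (rule arg_cong)
      also have "\<dots> = ennreal \<bar>det A\<bar> * (\<integral>\<^sup>+x. f (A *v x) \<partial>lborel)"
        by (simp add: nn_integral_density nn_integral_cmult nn_integral_distr)
      finally have "(\<integral>\<^sup>+x. f x \<partial>lborel) = ennreal \<bar>det A\<bar> * (\<integral>\<^sup>+x. f (A *v x) \<partial>lborel)" .
      then show "ennreal \<bar>det A\<bar> * (\<integral>\<^sup>+x. f (A *v x) \<partial>lborel) = (\<integral>\<^sup>+x. f x \<partial>lborel)" ..
    qed
  next
    fix m n :: 'n assume "m \<noteq> n"
    let ?A = "(\<chi> i j. mat 1 $ i $ Transposition.transpose m n j) :: real^'n^'n"
    have A: "?A *v x = (\<chi> i. x $ Transposition.transpose m n i)" for x
    proof -
      have "(\<Sum>j\<in>UNIV. mat 1 $ i $ Transposition.transpose m n j * x $ j) =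
          (\<Sum>j\<in>UNIV. mat 1 $ i $ j * x $ Transposition.transpose m n j)" for i
        by (rule sum.reindex_bij_witness[of _ "Transposition.transpose m n" "Transposition.transpose m n"]) auto
      also have "\<dots> i = x $ Transposition.transpose m n i" for i
        by (simp add: mat_def if_distrib[of "\<lambda>a. a * _"] cong: if_cong)
      finally show ?thesis
        by (simp add: matrix_vector_mult_def)
    qed
    \<comment> \<open>The matrix is an involution, so its determinant squares to 1; the absolute
      value hides the sign.\<close>
    have "\<bar>det ?A\<bar> = 1"
    proof -
      have "?A ** ?A = mat 1"
        by (simp add: matrix_eq A flip: matrix_vector_mul_assoc)
      then have "det ?A * det ?A = 1"
        by (metis det_I det_mul)
      then show ?thesis
        by (simp add: abs_square_eq_1 flip: power2_eq_square)
    qed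
    moreover have [measurable]: "(\<lambda>x. \<chi> i. x $ Transposition.transpose m n i) \<in> borel_measurable (borel :: (real^'n) measure)"
      by (intro borel_measurable_continuous_onI continuous_intros continuous_on_vec_lambda)
    moreover have "(\<integral>\<^sup>+x. f (\<chi> i. x $ Transposition.transpose m n i) \<partial>lborel) = (\<integral>\<^sup>+x. f x \<partial>lborel)"
      if [measurable]: "f \<in> borel_measurable borel" for f :: "real^'n \<Rightarrow> ennreal"
      by (subst (2) lborel_distr_swap[of m n, symmetric]) (simp add: nn_integral_distr)
    ultimately show "P ?A"
      unfolding P_def A by simp
  next
    fix m n :: 'n and c :: real assume mn: "m \<noteq> n"
    let ?A = "(\<chi> i j. if i = m \<and> j = n then c else of_bool (i = j)) :: real^'n^'n"
    have A: "?A *v x = x + (c * x $ n) *\<^sub>R axis m 1" for x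
    proof (subst vec_eq_iff, intro allI)
      fix i
      have "(\<Sum>j\<in>UNIV. (if i = m \<and> j = n then c else of_bool (i = j)) * x $ j) =
          (\<Sum>j\<in>UNIV. of_bool (i = j) * x $ j) + (\<Sum>j\<in>UNIV. if j = n then of_bool (i = m) * c * x $ j else 0)"
        unfolding sum.distrib[symmetric] using mn by (intro sum.cong) auto
      then show "(?A *v x) $ i = (x + (c * x $ n) *\<^sub>R axis m 1) $ i"
        by (auto simp: matrix_vector_mult_def axis_def)
    qed
    have "det ?A = 1"
    proof -
      have "?A = (\<chi> i. if i = m then row m (mat 1) + c *s row n (mat 1) else row i (mat 1))"
        using mn by (auto simp: vec_eq_iff row_def mat_def)
      then show ?thesis
        using det_row_operation[OF mn, of "mat 1 :: real^'n^'n" c] by simp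
    qed
    moreover have "(\<integral>\<^sup>+x. f (x + (c * x $ n) *\<^sub>R axis m 1) \<partial>lborel) = (\<integral>\<^sup>+x. f x \<partial>lborel)"
      if "f \<in> borel_measurable borel" for f :: "real^'n \<Rightarrow> ennreal"
    proof (rule nn_integral_lborel_shear)
      show "(\<lambda>x :: real^'n. c * x $ n) \<in> borel_measurable borel"
        by (intro borel_measurable_continuous_onI continuous_intros)
      show "c * (x + y *\<^sub>R axis m 1) $ n = c * x $ n" for x :: "real^'n" and y
        using mn by (simp add: axis_def)
    qed (simp_all add: that)
    ultimately show "P ?A"
      by (auto simp only: P_def A abs_one ennreal_1 mult_1)
  qed
  then show ?thesis
    using assms by (simp add: P_def)
qed

section \<open>The standard Gauss measure and uniqueness of characteristic functions\<close>

text \<open>A product over the coordinates, so that integrals against \<open>lborel\<close> factor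
  by Fubini; the closed form with the norm is \<open>std_gauss_density_eq\<close>.\<close>

definition std_gauss_density :: "'a::euclidean_space \<Rightarrow> real" where
  "std_gauss_density x = (\<Prod>b\<in>Basis. std_normal_density (x \<bullet> b))"

definition std_gauss :: "'a::euclidean_space measure" where
  "std_gauss = density lborel (\<lambda>x. ennreal (std_gauss_density x))"

lemma std_gauss_density_pos: "0 < std_gauss_density x"
  unfolding std_gauss_density_def by (intro prod_pos) (simp add: normal_density_pos)

lemma std_gauss_density_eq:
  "std_gauss_density (x :: 'a::euclidean_space) = (1 / sqrt (2 * pi)) ^ DIM('a) * exp (- (norm x)\<^sup>2 / 2)"
proof -
  have "std_gauss_density x = (\<Prod>b\<in>(Basis :: 'a set). 1 / sqrt (2 * pi)) * (\<Prod>b\<in>Basis. exp (- (x \<bullet> b)\<^sup>2 / 2))"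
    unfolding std_gauss_density_def std_normal_density_def by (rule prod.distrib)
  also have "(\<Prod>b\<in>Basis. exp (- (x \<bullet> b)\<^sup>2 / 2)) = exp (- (norm x)\<^sup>2 / 2)"
    by (simp add: exp_sum[symmetric] norm_eq_sqrt_inner euclidean_inner[of x x] sum_nonneg
        power2_eq_square sum_negf sum_divide_distrib)
  finally show ?thesis by simp
qed

lemma measurable_std_gauss_density [measurable]: "std_gauss_density \<in> borel_measurable borel"
  unfolding std_gauss_density_def by measurable

lemma sets_std_gauss [simp, measurable_cong]: "sets std_gauss = sets borel"
  and space_std_gauss [simp]: "space std_gauss = UNIV"
  by (simp_all add: std_gauss_def)

interpretation lborel_Basis: product_sigma_finite "\<lambda>_::'a::euclidean_space. lborel :: real measure"
  by standard

text \<open>With \<open>lborel\<close> written as a product measure, the integral becomes a product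
  of one-dimensional characteristic functions.\<close>

lemma char_std_gauss:
  fixes c :: "'a::euclidean_space"
  shows "(\<integral>x. iexp (c \<bullet> x) \<partial>std_gauss) = exp (- (norm c)\<^sup>2 / 2)"
proof -
  have 1: "integrable lborel (\<lambda>x. complex_of_real (std_normal_density x) * iexp (t * x))"
    for t :: real
    by (rule Bochner_Integration.integrable_bound[OF integrable_normal_density[of 1 0]])
      (auto simp: norm_mult)
  have 2: "(\<integral>x. complex_of_real (std_normal_density x) * iexp (t * x) \<partial>lborel) = exp (- t\<^sup>2 / 2)" for t
    using fun_cong[OF char_std_normal_distribution, of t]
    by (simp add: char_def integral_density scaleR_conv_of_real)
  have "(\<integral>x. iexp (c \<bullet> x) \<partial>std_gauss) =
      (\<integral>x. complex_of_real (std_gauss_density x) * iexp (c \<bullet> x) \<partial>lborel)"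
    unfolding std_gauss_def
    by (subst integral_density) (auto simp: std_gauss_density_pos less_imp_le scaleR_conv_of_real)
  also have "\<dots> = (\<integral>g. (\<Prod>b\<in>Basis. complex_of_real (std_normal_density (g b)) * iexp ((c \<bullet> b) * g b))
      \<partial>(\<Pi>\<^sub>M b\<in>(Basis::'a set). lborel))"
    by (subst lborel_eq, subst integral_distr)
      (auto simp: std_gauss_density_def prod.distrib exp_sum[symmetric] sum_distrib_left inner_sum_right
        intro!: Bochner_Integration.integral_cong arg_cong[where f=exp] sum.cong)
  also have "\<dots> = (\<Prod>b\<in>Basis. exp (- (c \<bullet> b)\<^sup>2 / 2))"
    by (subst lborel_Basis.product_integral_prod) (simp_all only: 1 2 finite_Basis of_real_prod)
  also have "(\<Prod>b\<in>Basis. exp (- (c \<bullet> b)\<^sup>2 / 2)) = exp (- (norm c)\<^sup>2 / 2)"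
    by (simp add: exp_sum[symmetric] norm_eq_sqrt_inner euclidean_inner[of c c] sum_nonneg
        power2_eq_square sum_negf sum_divide_distrib)
  finally show ?thesis .
qed

lemma prob_space_std_gauss: "prob_space (std_gauss :: 'a::euclidean_space measure)"
proof
  have "(\<integral>\<^sup>+x. ennreal (std_gauss_density x) \<partial>(lborel :: 'a measure)) =
      (\<integral>\<^sup>+g. (\<Prod>b\<in>Basis. ennreal (std_normal_density (g b))) \<partial>(\<Pi>\<^sub>M b\<in>(Basis::'a set). lborel))"
    by (subst lborel_eq, subst nn_integral_distr) (auto simp: std_gauss_density_def prod_ennreal)
  also have "\<dots> = (\<Prod>b\<in>(Basis :: 'a set). \<integral>\<^sup>+x. ennreal (std_normal_density x) \<partial>lborel)"
    by (subst lborel_Basis.product_nn_integral_prod) simp_all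
  also have "\<dots> = 1"
    by (simp add: nn_integral_eq_integral)
  finally show "emeasure std_gauss (space std_gauss :: 'a set) = 1"
    by (simp add: std_gauss_def emeasure_density)
qed

lemma nn_integral_lborel_affine:
  fixes f :: "'a::euclidean_space \<Rightarrow> ennreal"
  assumes [measurable]: "f \<in> borel_measurable borel" and "c \<noteq> 0"
  shows "(\<integral>\<^sup>+x. f x \<partial>lborel) = ennreal (\<bar>c\<bar> ^ DIM('a)) * (\<integral>\<^sup>+x. f (t + c *\<^sub>R x) \<partial>lborel)"
proof -
  have "(\<integral>\<^sup>+x. f x \<partial>lborel) =
      (\<integral>\<^sup>+x. f x \<partial>density (distr lborel borel (\<lambda>x. t + c *\<^sub>R x)) (\<lambda>_. ennreal (\<bar>c\<bar> ^ DIM('a))))"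
    using arg_cong[OF lborel_affine[OF \<open>c \<noteq> 0\<close>], of "\<lambda>M. integral\<^sup>N M f" t] by simp
  also have "\<dots> = ennreal (\<bar>c\<bar> ^ DIM('a)) * (\<integral>\<^sup>+x. f (t + c *\<^sub>R x) \<partial>lborel)"
    by (simp add: nn_integral_density nn_integral_cmult nn_integral_distr)
  finally show ?thesis .
qed

lemma std_gauss_density_char:
  fixes x :: "'a::euclidean_space"
  shows "complex_of_real (std_gauss_density x) =
    (1 / sqrt (2 * pi)) ^ DIM('a) * (\<integral>w. iexp (x \<bullet> w) \<partial>std_gauss)"
  unfolding char_std_gauss std_gauss_density_eq by simp

text \<open>Convolution with a Gauss measure of variance \<open>\<sigma>\<^sup>2\<close> only depends on the characteristic function,
  because the Gauss density is itself a characteristic function.\<close>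

lemma gauss_smoothing_char:
  fixes M :: "'a::euclidean_space measure"
  assumes "finite_measure M" and sets: "sets M = sets borel" and \<sigma>: "0 < \<sigma>"
  shows "complex_of_real (\<integral>y. std_gauss_density ((x - y) /\<^sub>R \<sigma>) \<partial>M) =
    (1 / sqrt (2 * pi)) ^ DIM('a) *
    (\<integral>w. iexp ((x \<bullet> w) / \<sigma>) * (\<integral>y. iexp (- (w /\<^sub>R \<sigma>) \<bullet> y) \<partial>M) \<partial>std_gauss)"
proof -
  interpret M: finite_measure M by fact
  interpret G: prob_space "std_gauss :: 'a measure" by (rule prob_space_std_gauss)
  interpret P: pair_sigma_finite M "std_gauss :: 'a measure" ..
  interpret PF: finite_measure "M \<Otimes>\<^sub>M (std_gauss :: 'a measure)"
    by (rule finite_measure_pair_measure) unfold_locales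
  note [measurable_cong] = sets
  have int: "integrable (M \<Otimes>\<^sub>M std_gauss) (\<lambda>(y, w). iexp (((x - y) /\<^sub>R \<sigma>) \<bullet> w))"
    by (rule PF.integrable_const_bound[where B=1]) auto
  have "complex_of_real (\<integral>y. std_gauss_density ((x - y) /\<^sub>R \<sigma>) \<partial>M) =
      (\<integral>y. (1 / sqrt (2 * pi)) ^ DIM('a) * (\<integral>w. iexp (((x - y) /\<^sub>R \<sigma>) \<bullet> w) \<partial>std_gauss) \<partial>M)"
    unfolding integral_complex_of_real[symmetric] std_gauss_density_char ..
  also have "\<dots> = (1 / sqrt (2 * pi)) ^ DIM('a) *
      (\<integral>y. (\<integral>w. iexp (((x - y) /\<^sub>R \<sigma>) \<bullet> w) \<partial>std_gauss) \<partial>M)"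
    by (rule integral_mult_right_zero)
  also have "(\<integral>y. (\<integral>w. iexp (((x - y) /\<^sub>R \<sigma>) \<bullet> w) \<partial>std_gauss) \<partial>M) =
      (\<integral>w. (\<integral>y. iexp (((x - y) /\<^sub>R \<sigma>) \<bullet> w) \<partial>M) \<partial>std_gauss)"
    using P.Fubini_integral[OF int] by simp
  also have "\<dots> = (\<integral>w. iexp ((x \<bullet> w) / \<sigma>) * (\<integral>y. iexp (- (w /\<^sub>R \<sigma>) \<bullet> y) \<partial>M) \<partial>std_gauss)"
  proof (rule Bochner_Integration.integral_cong[OF refl])
    fix w :: 'a
    have "iexp (((x - y) /\<^sub>R \<sigma>) \<bullet> w) = iexp ((x \<bullet> w) / \<sigma>) * iexp (- (w /\<^sub>R \<sigma>) \<bullet> y)" for y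
    proof -
      have "((x - y) /\<^sub>R \<sigma>) \<bullet> w = (x \<bullet> w) / \<sigma> + - (w /\<^sub>R \<sigma>) \<bullet> y"
        by (simp add: inner_diff_left inner_commute[of w y] divide_inverse right_diff_distrib mult.commute)
      then show ?thesis
        by (simp only: exp_add[symmetric] of_real_add distrib_left)
    qed
    then show "(\<integral>y. iexp (((x - y) /\<^sub>R \<sigma>) \<bullet> w) \<partial>M) =
        iexp ((x \<bullet> w) / \<sigma>) * (\<integral>y. iexp (- (w /\<^sub>R \<sigma>) \<bullet> y) \<partial>M)"
      by simp
  qed
  finally show ?thesis .
qed

text \<open>The noisy variable y + \<sigma> z has the density x -> \<sigma>^-d \<integral> g((x -
  y)/\<sigma>) dM(y), where g is the standard Gauss density. The power of \<sigma> is kept on the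
  left so that nothing has to be divided in \<open>ennreal\<close>.\<close>

lemma gauss_smoothing_integral:
  fixes M :: "'a::euclidean_space measure"
  assumes "finite_measure M" and sets: "sets M = sets borel" and \<sigma>: "0 < \<sigma>"
    and f [measurable]: "f \<in> borel_measurable borel"
  shows "ennreal (\<sigma> ^ DIM('a)) * (\<integral>\<^sup>+(y, z). f (y + \<sigma> *\<^sub>R z) \<partial>(M \<Otimes>\<^sub>M std_gauss)) =
    (\<integral>\<^sup>+x. f x * ennreal (\<integral>y. std_gauss_density ((x - y) /\<^sub>R \<sigma>) \<partial>M) \<partial>lborel)"
proof -
  interpret M: finite_measure M by fact
  interpret G: prob_space "std_gauss :: 'a measure" by (rule prob_space_std_gauss)
  interpret P: pair_sigma_finite M "lborel :: 'a measure" ..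
  note [measurable_cong] = sets
  have le: "std_gauss_density z \<le> (1 / sqrt (2 * pi)) ^ DIM('a)" for z :: 'a
    unfolding std_gauss_density_eq by (simp add: mult_left_le divide_right_mono field_simps)
  have int: "integrable M (\<lambda>y. std_gauss_density ((x - y) /\<^sub>R \<sigma>))" for x
    by (rule M.integrable_const_bound[where B="(1 / sqrt (2 * pi)) ^ DIM('a)"])
      (auto simp: abs_of_pos[OF std_gauss_density_pos] intro!: AE_I2 le simp del: power_one_over)
  have "(\<integral>\<^sup>+x. f x * ennreal (\<integral>y. std_gauss_density ((x - y) /\<^sub>R \<sigma>) \<partial>M) \<partial>lborel) =
      (\<integral>\<^sup>+x. (\<integral>\<^sup>+y. f x * ennreal (std_gauss_density ((x - y) /\<^sub>R \<sigma>)) \<partial>M) \<partial>lborel)"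
    by (simp add: nn_integral_cmult nn_integral_eq_integral[OF int] std_gauss_density_pos less_imp_le)
  also have "\<dots> = (\<integral>\<^sup>+y. (\<integral>\<^sup>+x. f x * ennreal (std_gauss_density ((x - y) /\<^sub>R \<sigma>)) \<partial>lborel) \<partial>M)"
    by (rule P.Fubini') measurable
  also have "\<dots> = (\<integral>\<^sup>+y. ennreal (\<sigma> ^ DIM('a)) * (\<integral>\<^sup>+z. f (y + \<sigma> *\<^sub>R z) \<partial>std_gauss) \<partial>M)"
  proof (rule nn_integral_cong)
    fix y
    have "(\<integral>\<^sup>+x. f x * ennreal (std_gauss_density ((x - y) /\<^sub>R \<sigma>)) \<partial>lborel) =
        ennreal (\<sigma> ^ DIM('a)) * (\<integral>\<^sup>+z. f (y + \<sigma> *\<^sub>R z) * ennreal (std_gauss_density z) \<partial>lborel)"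
      using \<sigma> by (subst nn_integral_lborel_affine[where c=\<sigma> and t=y]) simp_all
    then show "(\<integral>\<^sup>+x. f x * ennreal (std_gauss_density ((x - y) /\<^sub>R \<sigma>)) \<partial>lborel) =
        ennreal (\<sigma> ^ DIM('a)) * (\<integral>\<^sup>+z. f (y + \<sigma> *\<^sub>R z) \<partial>std_gauss)"
      by (simp add: std_gauss_def nn_integral_density mult.commute)
  qed
  also have "\<dots> = ennreal (\<sigma> ^ DIM('a)) * (\<integral>\<^sup>+y. (\<integral>\<^sup>+z. f (y + \<sigma> *\<^sub>R z) \<partial>std_gauss) \<partial>M)"
    by (rule nn_integral_cmult) measurable
  also have "(\<integral>\<^sup>+y. (\<integral>\<^sup>+z. f (y + \<sigma> *\<^sub>R z) \<partial>std_gauss) \<partial>M) =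
      (\<integral>\<^sup>+(y, z). f (y + \<sigma> *\<^sub>R z) \<partial>(M \<Otimes>\<^sub>M std_gauss))"
    by (subst G.nn_integral_fst[symmetric]) simp_all
  finally show ?thesis ..
qed

text \<open>The way back from the smoothed measure: as the noise level tends to 0 the integral of
  \<open>f\<close> against \<open>M\<close> is recovered. Dominated convergence applies because
  \<open>f\<close> is bounded by 1 on a finite measure.\<close>

lemma gauss_smoothing_tendsto:
  fixes M :: "'a::euclidean_space measure" and f :: "'a \<Rightarrow> real"
  assumes "finite_measure M" and sets: "sets M = sets borel"
    and cont: "continuous_on UNIV f" and bound: "\<And>x. f x \<in> {0..1}"
  shows "(\<lambda>n. \<integral>\<^sup>+(y, z). ennreal (f (y + inverse (real (Suc n)) *\<^sub>R z)) \<partial>(M \<Otimes>\<^sub>M std_gauss))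
    \<longlonglongrightarrow> (\<integral>\<^sup>+y. ennreal (f y) \<partial>M)"
proof -
  interpret M: finite_measure M by fact
  interpret G: prob_space "std_gauss :: 'a measure" by (rule prob_space_std_gauss)
  interpret PF: finite_measure "M \<Otimes>\<^sub>M (std_gauss :: 'a measure)"
    by (rule finite_measure_pair_measure) unfold_locales
  note [measurable_cong] = sets
  have [measurable]: "f \<in> borel_measurable borel"
    using cont by (rule borel_measurable_continuous_onI)
  have "(\<lambda>n. \<integral>\<^sup>+p. ennreal (f (fst p + inverse (real (Suc n)) *\<^sub>R snd p)) \<partial>(M \<Otimes>\<^sub>M std_gauss))
      \<longlonglongrightarrow> (\<integral>\<^sup>+p. ennreal (f (fst p)) \<partial>(M \<Otimes>\<^sub>M (std_gauss :: 'a measure)))"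
  proof (rule nn_integral_dominated_convergence[where w="\<lambda>_. 1"])
    show "AE p in M \<Otimes>\<^sub>M std_gauss. (\<lambda>n. ennreal (f (fst p + inverse (real (Suc n)) *\<^sub>R snd p))) \<longlonglongrightarrow> ennreal (f (fst p))"
    proof (rule AE_I2, rule tendsto_ennrealI)
      fix p :: "'a \<times> 'a"
      have "(\<lambda>n. fst p + inverse (real (Suc n)) *\<^sub>R snd p) \<longlonglongrightarrow> fst p + 0 *\<^sub>R snd p"
        by (intro tendsto_intros LIMSEQ_inverse_real_of_nat)
      then show "(\<lambda>n. f (fst p + inverse (real (Suc n)) *\<^sub>R snd p)) \<longlonglongrightarrow> f (fst p)"
        using cont by (intro isCont_tendsto_compose[of _ f]) (auto simp: continuous_on_eq_continuous_at)
    qed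
    show "(\<integral>\<^sup>+p. 1 \<partial>(M \<Otimes>\<^sub>M (std_gauss :: 'a measure))) < \<infinity>"
      using PF.emeasure_finite by (simp add: less_top[symmetric])
    show "\<And>i. AE p in M \<Otimes>\<^sub>M std_gauss. ennreal (f (fst p + inverse (real (Suc i)) *\<^sub>R snd p)) \<le> 1"
      using bound by (intro AE_I2) (auto simp: ennreal_le_1)
  qed measurable
  moreover have "(\<integral>\<^sup>+p. ennreal (f (fst p)) \<partial>(M \<Otimes>\<^sub>M (std_gauss :: 'a measure))) = (\<integral>\<^sup>+y. ennreal (f y) \<partial>M)"
    by (subst G.nn_integral_fst[symmetric]) (simp_all add: G.emeasure_space_1[simplified])
  ultimately show ?thesis
    by (simp add: case_prod_unfold)
qed

text \<open>The indicator of a closed set is a limit of the bounded continuous functions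
  \<open>f n\<close>, so integrals of continuous functions determine the measure on closed sets,
  which form an intersection-stable generator.\<close>

lemma measure_eq_if_closed_eq:
  fixes M N :: "'a::metric_space measure"
  assumes fin: "finite_measure M" "finite_measure N" and sets: "sets M = sets borel" "sets N = sets borel"
    and eq: "\<And>f. continuous_on UNIV f \<Longrightarrow> (\<And>x. f x \<in> {0..1 :: real}) \<Longrightarrow>
      (\<integral>\<^sup>+x. ennreal (f x) \<partial>M) = (\<integral>\<^sup>+x. ennreal (f x) \<partial>N)"
  shows "M = N"
proof -
  have closed: "emeasure M C = emeasure N C" if C: "closed C" for C
  \<comment> \<open>The empty set is treated apart because \<open>infdist x {}\<close> is 0 by
    convention.\<close>
  proof (cases "C = {}")
    case False
    define f where "f n x = max 0 (1 - real n * infdist x C)" for n x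
    have lim: "(\<lambda>n. ennreal (f n x)) \<longlonglongrightarrow> indicator C x" for x
    proof (cases "x \<in> C")
      case True
      then show ?thesis by (simp add: f_def)
    next
      case False
      then have pos: "0 < infdist x C"
        using C \<open>C \<noteq> {}\<close> by (simp add: infdist_pos_not_in_closed)
      have "\<forall>\<^sub>F n in sequentially. f n x = 0"
        using eventually_gt_at_top[of "nat \<lceil>1 / infdist x C\<rceil>"]
      proof eventually_elim
        case (elim n)
        then have "1 / infdist x C \<le> n" by linarith
        then show ?case using pos by (simp add: f_def field_simps)
      qed
      then have "(\<lambda>n. f n x) \<longlonglongrightarrow> 0"
        by (rule tendsto_eventually)
      then have "(\<lambda>n. ennreal (f n x)) \<longlonglongrightarrow> ennreal 0"
        by (rule tendsto_ennrealI)
      then show ?thesis using False by simp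
    qed
    have cont: "continuous_on UNIV (f n)" for n
      unfolding f_def by (intro continuous_intros)
    have bound: "f n x \<in> {0..1}" for n x
      by (auto simp: f_def infdist_nonneg)
    have "(\<lambda>n. \<integral>\<^sup>+x. ennreal (f n x) \<partial>K) \<longlonglongrightarrow> emeasure K C"
      if "finite_measure K" and [measurable_cong]: "sets K = sets borel" for K :: "'a measure"
    proof -
      interpret K: finite_measure K by fact
      have [measurable]: "f n \<in> borel_measurable K" for n
        using borel_measurable_continuous_onI[OF cont] measurable_cong_sets[OF that(2) refl] by blast
      have [measurable]: "C \<in> sets K"
        using C that(2) by simp
      have "(\<lambda>n. \<integral>\<^sup>+x. ennreal (f n x) \<partial>K) \<longlonglongrightarrow> (\<integral>\<^sup>+x. indicator C x \<partial>K)"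
      proof (rule nn_integral_dominated_convergence[where w="\<lambda>_. 1"])
        show "(\<integral>\<^sup>+x. 1 \<partial>K) < \<infinity>"
          using K.emeasure_finite by (simp add: less_top[symmetric])
        show "AE x in K. ennreal (f i x) \<le> 1" for i
          using bound by (intro AE_I2) (simp add: ennreal_le_1)
      qed (simp_all add: lim)
      then show ?thesis by simp
    qed
    from this[OF fin(1) sets(1)] this[OF fin(2) sets(2)] show ?thesis
      using LIMSEQ_unique by (simp add: eq[OF cont bound])
  qed simp
  show ?thesis
  proof (rule measure_eqI_generator_eq[where E="Collect closed" and \<Omega>=UNIV and A="\<lambda>_. UNIV"])
    show "sets M = sigma_sets UNIV (Collect closed)" "sets N = sigma_sets UNIV (Collect closed)"
      by (simp_all add: sets borel_eq_closed)
    interpret M: finite_measure M by fact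
    show "emeasure M UNIV \<noteq> \<infinity>" for i :: nat
      by simp
  qed (auto simp: Int_stable_def closed)
qed

theorem char_uniqueness:
  fixes M N :: "'a::euclidean_space measure"
  assumes fin: "finite_measure M" "finite_measure N" and sets: "sets M = sets borel" "sets N = sets borel"
    and eq: "\<And>c. (\<integral>x. iexp (c \<bullet> x) \<partial>M) = (\<integral>x. iexp (c \<bullet> x) \<partial>N)"
  shows "M = N"
proof (rule measure_eq_if_closed_eq[OF fin sets])
  fix f :: "'a \<Rightarrow> real" assume f: "continuous_on UNIV f" "\<And>x. f x \<in> {0..1}"
  then have [measurable]: "f \<in> borel_measurable borel"
    by (intro borel_measurable_continuous_onI)
  have dens: "(\<integral>y. std_gauss_density ((x - y) /\<^sub>R \<sigma>) \<partial>M) = (\<integral>y. std_gauss_density ((x - y) /\<^sub>R \<sigma>) \<partial>N)"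
    if "0 < \<sigma>" for x \<sigma>
    unfolding of_real_eq_iff[where 'a=complex, symmetric]
      gauss_smoothing_char[OF fin(1) sets(1) that] gauss_smoothing_char[OF fin(2) sets(2) that] eq ..
  have "(\<integral>\<^sup>+(y, z). ennreal (f (y + \<sigma> *\<^sub>R z)) \<partial>(M \<Otimes>\<^sub>M std_gauss)) =
      (\<integral>\<^sup>+(y, z). ennreal (f (y + \<sigma> *\<^sub>R z)) \<partial>(N \<Otimes>\<^sub>M std_gauss))" if "0 < \<sigma>" for \<sigma>
  proof -
    have "ennreal (\<sigma> ^ DIM('a)) * (\<integral>\<^sup>+(y, z). ennreal (f (y + \<sigma> *\<^sub>R z)) \<partial>(M \<Otimes>\<^sub>M std_gauss)) =
        ennreal (\<sigma> ^ DIM('a)) * (\<integral>\<^sup>+(y, z). ennreal (f (y + \<sigma> *\<^sub>R z)) \<partial>(N \<Otimes>\<^sub>M std_gauss))"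
      using gauss_smoothing_integral[OF fin(1) sets(1) that, of "\<lambda>x. ennreal (f x)"]
        gauss_smoothing_integral[OF fin(2) sets(2) that, of "\<lambda>x. ennreal (f x)"]
      by (simp add: dens[OF that])
    then show ?thesis
      using that by (simp add: ennreal_mult_cancel_left)
  qed
  then show "(\<integral>\<^sup>+x. ennreal (f x) \<partial>M) = (\<integral>\<^sup>+x. ennreal (f x) \<partial>N)"
    using gauss_smoothing_tendsto[OF fin(1) sets(1) f] gauss_smoothing_tendsto[OF fin(2) sets(2) f]
    by (simp add: LIMSEQ_unique)
qed

section \<open>Gauss measures\<close>

lemma measurable_matrix_vector_mult [measurable]: "(*v) A \<in> borel_measurable borel"
  for A :: "real^'n^'m"
  by (intro borel_measurable_continuous_onI continuous_intros)

text \<open>Substituting y = m + L x turns the quadratic form into the squared norm of x. The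
  covariance has determinant (det L)^2, whose root in the normalising constant cancels the
  Jacobian.\<close>

lemma gauss_density_factorization:
  fixes L :: "real^'n^'n"
  assumes L: "invertible L"
  shows "\<bar>det L\<bar> * gauss_density m (L ** transpose L) (m + L *v x) = std_gauss_density x"
proof -
  have inv: "matrix_inv (L ** transpose L) = transpose (matrix_inv L) ** matrix_inv L"
    using L by (simp add: matrix_inv_mult transpose_invertible matrix_inv_transpose)
  have "(matrix_inv (L ** transpose L) *v (L *v x)) \<bullet> (L *v x) =
      (transpose (matrix_inv L) *v (matrix_inv L *v (L *v x))) \<bullet> (L *v x)"
    unfolding inv by (simp add: matrix_vector_mul_assoc matrix_mul_assoc)
  also have "\<dots> = x \<bullet> x"
    unfolding inner_transpose_left matrix_vector_mul_cancel[OF matrix_inv_left[OF L]] ..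
  finally have quad: "(matrix_inv (L ** transpose L) *v (L *v x)) \<bullet> (L *v x) = (norm x)\<^sup>2"
    by (simp add: power2_norm_eq_inner)
  have "sqrt ((2 * pi) ^ CARD('n) * det (L ** transpose L)) = sqrt (2 * pi) ^ CARD('n) * \<bar>det L\<bar>"
    by (simp add: det_mul real_sqrt_mult real_sqrt_power power_mult_distrib)
  moreover have "det L \<noteq> 0"
    using L by (simp add: invertible_det_nz)
  ultimately show ?thesis
    using quad by (simp add: gauss_density_def std_gauss_density_eq field_simps)
qed

lemma measurable_gauss_density [measurable]: "gauss_density m C \<in> borel_measurable borel"
  unfolding gauss_density_def
  by (intro borel_measurable_continuous_onI continuous_intros)

lemma gauss_density_nonneg: "pos_def C \<Longrightarrow> 0 \<le> gauss_density m C x"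
proof -
  assume "pos_def C"
  then obtain L :: "real^'a^'a" where L: "C = L ** transpose L"
    using pos_def_factorization by blast
  have "0 \<le> det C"
    unfolding L by (simp add: det_mul)
  then show ?thesis
    by (simp add: gauss_density_def)
qed

definition gauss_measure :: "real^'n \<Rightarrow> real^'n^'n \<Rightarrow> (real^'n) measure" where
  "gauss_measure m C = density lborel (\<lambda>y. ennreal (gauss_density m C y))"

lemma sets_gauss_measure [simp, measurable_cong]: "sets (gauss_measure m C) = sets borel"
  and space_gauss_measure [simp]: "space (gauss_measure m C) = UNIV"
  by (simp_all add: gauss_measure_def)

text \<open>A translation followed by the linear change of variables. Facts about
  \<open>gauss_measure\<close> with positive definite covariance are thereby reduced to
  \<open>std_gauss\<close>.\<close>

lemma gauss_measure_eq_distr: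
  fixes L :: "real^'n^'n"
  assumes L: "invertible L"
  shows "gauss_measure m (L ** transpose L) = distr std_gauss borel (\<lambda>x. m + L *v x)"
proof (rule measure_eqI)
  fix A assume "A \<in> sets (gauss_measure m (L ** transpose L))"
  then have [measurable]: "A \<in> sets borel" by simp
  let ?g = "\<lambda>y. ennreal (gauss_density m (L ** transpose L) y) * indicator A y"
  have "emeasure (gauss_measure m (L ** transpose L)) A = (\<integral>\<^sup>+y. ?g y \<partial>lborel)"
    by (simp add: gauss_measure_def emeasure_density)
  also have "\<dots> = (\<integral>\<^sup>+y. ?g (m + y) \<partial>lborel)"
    using nn_integral_lborel_affine[of ?g 1 m] by simp
  also have "\<dots> = ennreal \<bar>det L\<bar> * (\<integral>\<^sup>+x. ?g (m + L *v x) \<partial>lborel)"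
    by (rule nn_integral_lborel_matrix[symmetric, OF L]) measurable
  also have "\<dots> = (\<integral>\<^sup>+x. ennreal \<bar>det L\<bar> * ?g (m + L *v x) \<partial>lborel)"
    by (rule nn_integral_cmult[symmetric]) measurable
  also have "\<dots> = (\<integral>\<^sup>+x. ennreal (std_gauss_density x) * indicator A (m + L *v x) \<partial>lborel)"
    unfolding gauss_density_factorization[OF L, of m, symmetric]
    by (simp add: ennreal_mult' mult.assoc)
  also have "\<dots> = (\<integral>\<^sup>+x. indicator A (m + L *v x) \<partial>std_gauss)"
    unfolding std_gauss_def by (subst nn_integral_density) simp_all
  also have "\<dots> = (\<integral>\<^sup>+y. indicator A y \<partial>distr std_gauss borel (\<lambda>x. m + L *v x))"
    by (subst nn_integral_distr) simp_all
  finally show "emeasure (gauss_measure m (L ** transpose L)) A =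
      emeasure (distr std_gauss borel (\<lambda>x. m + L *v x)) A"
    by simp
qed simp

lemma prob_space_gauss_measure: "pos_def C \<Longrightarrow> prob_space (gauss_measure m C)"
  by (erule pos_def_factorization)
    (auto simp: gauss_measure_eq_distr intro!: prob_space.prob_space_distr[OF prob_space_std_gauss])

lemma char_gauss_measure:
  fixes C :: "real^'n^'n"
  assumes "pos_def C"
  shows "(\<integral>y. iexp (c \<bullet> y) \<partial>gauss_measure m C) = iexp (c \<bullet> m) * exp (- (c \<bullet> (C *v c)) / 2)"
proof -
  obtain L :: "real^'n^'n" where L: "invertible L" "C = L ** transpose L"
    using assms by (rule pos_def_factorization)
  have "(\<integral>y. iexp (c \<bullet> y) \<partial>gauss_measure m C) = (\<integral>x. iexp (c \<bullet> (m + L *v x)) \<partial>std_gauss)"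
    unfolding L(2) gauss_measure_eq_distr[OF L(1)] by (subst integral_distr) simp_all
  also have "\<dots> = (\<integral>x. iexp (c \<bullet> m) * iexp ((transpose L *v c) \<bullet> x) \<partial>std_gauss)"
    unfolding inner_transpose_left exp_add[symmetric] by (simp add: inner_add_right distrib_left)
  also have "\<dots> = iexp (c \<bullet> m) * exp (- (norm (transpose L *v c))\<^sup>2 / 2)"
    by (simp only: integral_mult_right_zero char_std_gauss)
  also have "(norm (transpose L *v c))\<^sup>2 = c \<bullet> (C *v c)"
    unfolding power2_norm_eq_inner inner_transpose_left L(2) matrix_vector_mul_assoc ..
  finally show ?thesis .
qed

lemma gauss_density_translate: "gauss_density (c + m) A (c + y) = gauss_density m A y"
  by (simp add: gauss_density_def)

text \<open>Conditioning a Gauss random walk: a step with covariance \<open>B\<close> leads from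
  \<open>x\<close> to \<open>y\<close>, another with covariance \<open>A\<close> from
  \<open>y\<close> to 0. The right hand side is the density of the middle point given both ends. For
  the bridge, \<open>A\<close> is the covariance still to come and \<open>B\<close> the one
  collected between the two times.\<close>

lemma gauss_density_bayes:
  fixes A B :: "real^'n^'n"
  assumes A: "pos_def A" and B: "pos_def B"
  shows "gauss_density (A *v (matrix_inv (A + B) *v x)) (A ** matrix_inv (A + B) ** B) y =
    gauss_density x B y * gauss_density y A 0 / gauss_density x (A + B) 0"
proof -
  define C where "C = A + B"
  have C: "pos_def C"
    unfolding C_def by (rule pos_def_add[OF A B])
  have det: "0 < det D" if D: "pos_def D" for D :: "real^'n^'n"
  proof -
    obtain L :: "real^'n^'n" where "invertible L" "D = L ** transpose L"
      using D by (rule pos_def_factorization)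
    then show ?thesis
      using not_square_less_zero[of "det L"] by (simp add: det_mul invertible_det_nz less_le)
  qed
  let ?A = "matrix_inv A" and ?B = "matrix_inv B" and ?C = "matrix_inv C"
  let ?S = "A ** ?C ** B"
  note inv = pos_def_invertible[OF A] pos_def_invertible[OF B] pos_def_invertible[OF C]
  note sym = pos_def_symmetric[OF pos_def_matrix_inv[OF A]] pos_def_symmetric[OF pos_def_matrix_inv[OF B]]
    pos_def_symmetric[OF pos_def_matrix_inv[OF C]] 
  \<comment> \<open>The parallel sum: the inverse of \<open>?S\<close> is \<open>?A + ?B\<close>.
    Writing \<open>B\<close> as \<open>C - A\<close> makes the middle factor cancel.\<close>
  have "?S ** (?A + ?B) = A ** (?C ** (B ** ?A)) + A ** ?C"
    by (simp add: matrix_add_ldistrib matrix_mul_assoc_rev matrix_inv_right inv)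
  also have "B ** ?A = C ** ?A - mat 1"
    by (simp add: C_def matrix_add_rdistrib matrix_inv_right inv)
  also have "A ** (?C ** (C ** ?A - mat 1)) + A ** ?C = mat 1"
    by (simp add: matrix_diff_ldistrib matrix_mul_cancel matrix_inv_left matrix_inv_right inv)
  finally have invS: "matrix_inv ?S = ?A + ?B"
    by (rule matrix_inv_unique)
  define m where "m = A *v (?C *v x)"
  have Am: "?A *v m = ?C *v x"
    by (simp add: m_def matrix_vector_mul_cancel matrix_inv_left inv)
  have "m = x - B *v (?C *v x)"
    using matrix_vector_mul_cancel[OF matrix_inv_right[OF inv(3)], of x]
    by (simp add: m_def C_def matrix_vector_mult_add_rdistrib algebra_simps)
  then have Bm: "?B *v m = ?B *v x - ?C *v x"
    by (simp add: matrix_vector_mult_diff_distrib matrix_vector_mul_cancel matrix_inv_left inv)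
  have SmI: "(?A + ?B) *v m = ?B *v x"
    by (simp add: matrix_vector_mult_add_rdistrib Am Bm)
  \<comment> \<open>Completing the square around \<open>m\<close>: this constant term supplies
    exactly the form of \<open>?C\<close> that comes from the denominator.\<close>
  have "m \<bullet> (?B *v x) = (?B *v m) \<bullet> x"
    by (simp add: inner_matrix_symmetric[OF sym(2)])
  then have mBx: "m \<bullet> (?B *v x) = x \<bullet> (?B *v x) - x \<bullet> (?C *v x)"
    by (simp add: Bm inner_diff_left inner_diff_right inner_commute)
  have symAB: "((?A + ?B) *v y) \<bullet> m = y \<bullet> (?B *v x)"
    using inner_matrix_symmetric[of "?A + ?B" y m] by (simp add: transpose_add sym SmI)
  have quad: "((?A + ?B) *v (y - m)) \<bullet> (y - m) =
      (?B *v (y - x)) \<bullet> (y - x) + (?A *v (0 - y)) \<bullet> (0 - y) - (?C *v (0 - x)) \<bullet> (0 - x)"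
  proof -
    have "((?A + ?B) *v (y - m)) \<bullet> (y - m) =
        ((?A + ?B) *v y) \<bullet> y - 2 * (y \<bullet> (?B *v x)) + m \<bullet> (?B *v x)"
      using symAB by (simp add: matrix_vector_mult_diff_distrib SmI inner_diff_left inner_diff_right inner_commute)
    moreover have "M *v (- z) = - (M *v z)" for M :: "real^'n^'n" and z
      using matrix_vector_mult_diff_distrib[of M 0 z] by simp
    moreover have "(?B *v y) \<bullet> x = y \<bullet> (?B *v x)"
      by (rule inner_matrix_symmetric[OF sym(2)])
    ultimately show ?thesis
      unfolding mBx
      by (simp add: matrix_vector_mult_diff_distrib matrix_vector_mult_add_rdistrib
          inner_diff_left inner_diff_right inner_add_left inner_commute[of x] inner_commute[of y])
  qed
  have "det ?S = det A * det B / det C"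
    by (simp add: det_mul det_matrix_inv inv field_simps)
  then have e1: "sqrt ((2 * pi) ^ CARD('n) * det ?S) =
      sqrt ((2 * pi) ^ CARD('n) * det B) * sqrt ((2 * pi) ^ CARD('n) * det A) / sqrt ((2 * pi) ^ CARD('n) * det C)"
    by (simp add: real_sqrt_mult real_sqrt_divide)
  have e2: "exp (- (1/2) * (((?A + ?B) *v (y - m)) \<bullet> (y - m))) =
      exp (- (1/2) * ((?B *v (y - x)) \<bullet> (y - x))) * exp (- (1/2) * ((?A *v (0 - y)) \<bullet> (0 - y))) /
      exp (- (1/2) * ((?C *v (0 - x)) \<bullet> (0 - x)))"
    unfolding quad exp_add[symmetric] exp_diff[symmetric] by (simp add: algebra_simps)
  have "1 / (x * y / z) * (u * v / w) = 1 / x * u * (1 / y * v) / (1 / z * w)" for x y z u v w :: real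
    by simp
  then show ?thesis
    unfolding C_def[symmetric] m_def[symmetric] gauss_density_def invS e1 e2 .
qed

section \<open>Normal random variables and Gauss vectors\<close>

text \<open>The affine image makes sense for \<sigma> = 0 as well, where \<open>normal_law\<close>
  is a point mass by definition; afterwards degenerate and proper normal laws are treated
  alike.\<close>

lemma normal_law_eq_distr:
  assumes "0 \<le> \<sigma>"
  shows "normal_law \<mu> \<sigma> = distr std_normal_distribution borel (\<lambda>x. \<mu> + \<sigma> * x)"
proof (cases "\<sigma> = 0")
  case True
  interpret prob_space std_normal_distribution
    by (rule prob_space_normal_density) simp
  from True show ?thesis
    by (simp add: normal_law_def prob_space.distr_const[OF prob_space_axioms])
next
  case False
  interpret prob_space std_normal_distribution
    by (rule prob_space_normal_density) simp
  have "distributed std_normal_distribution lborel (\<lambda>x. x) std_normal_density"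
    by (auto simp: distributed_def intro!: distr_id2)
  then have "distributed std_normal_distribution lborel (\<lambda>x. \<mu> + \<sigma> * x)
      (normal_density (\<mu> + \<sigma> * 0) (\<bar>\<sigma>\<bar> * 1))"
    by (rule normal_density_affine) (use False in auto)
  then show ?thesis
    using False assms by (simp add: normal_law_def distributed_def cong: distr_cong)
qed

lemma real_distribution_normal_law: "0 \<le> \<sigma> \<Longrightarrow> real_distribution (normal_law \<mu> \<sigma>)"
  using prob_space.real_distribution_distr[OF prob_space_normal_density[of 1 0]]
  by (simp add: normal_law_eq_distr)

lemma char_normal_law:
  assumes "0 \<le> \<sigma>"
  shows "char (normal_law \<mu> \<sigma>) t = iexp (t * \<mu>) * exp (- (\<sigma>\<^sup>2 * t\<^sup>2) / 2)"
proof -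
  have "char (normal_law \<mu> \<sigma>) t = (\<integral>x. iexp (t * \<mu>) * iexp ((t * \<sigma>) * x) \<partial>std_normal_distribution)"
    unfolding char_def normal_law_eq_distr[OF assms]
    by (subst integral_distr) (simp_all add: exp_add[symmetric] algebra_simps)
  also have "\<dots> = iexp (t * \<mu>) * char std_normal_distribution (t * \<sigma>)"
    unfolding char_def by (rule integral_mult_right_zero)
  finally show ?thesis
    by (simp add: char_std_normal_distribution power_mult_distrib mult.commute)
qed

text \<open>The last argument is the variance, not the standard deviation: variances add for
  independent summands, and quadratic forms c.(C c) can be inserted without taking roots.\<close>

definition normal_char :: "'a measure \<Rightarrow> ('a \<Rightarrow> real) \<Rightarrow> real \<Rightarrow> real \<Rightarrow> bool" where
  "normal_char M Y \<mu> v \<longleftrightarrow> Y \<in> borel_measurable M \<and> 0 \<le> v \<and>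
     (\<forall>t. (\<integral>\<omega>. iexp (t * Y \<omega>) \<partial>M) = iexp (t * \<mu>) * exp (- (v * t\<^sup>2) / 2))"

lemma normal_charD:
  assumes "normal_char M Y \<mu> v"
  shows "Y \<in> borel_measurable M" "0 \<le> v"
    "(\<integral>\<omega>. iexp (t * Y \<omega>) \<partial>M) = iexp (t * \<mu>) * exp (- (v * t\<^sup>2) / 2)"
  using assms by (auto simp: normal_char_def)

text \<open>Levy's uniqueness theorem links the two descriptions of a normal variable: the law, on
  which \<open>gauss_vector\<close> rests, and the characteristic function, which the calculations
  produce.\<close>

lemma (in prob_space) normal_char_iff:
  assumes "0 \<le> \<sigma>" and Y [measurable]: "Y \<in> borel_measurable M"
  shows "normal_char M Y \<mu> (\<sigma>\<^sup>2) \<longleftrightarrow> distr M borel Y = normal_law \<mu> \<sigma>"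
proof -
  have "char (distr M borel Y) t = (\<integral>\<omega>. iexp (t * Y \<omega>) \<partial>M)" for t
    unfolding char_def by (subst integral_distr) simp_all
  then have "normal_char M Y \<mu> (\<sigma>\<^sup>2) \<longleftrightarrow> char (distr M borel Y) = char (normal_law \<mu> \<sigma>)"
    by (simp add: normal_char_def fun_eq_iff char_normal_law assms)
  then show ?thesis
    using Levy_uniqueness[of "distr M borel Y" "normal_law \<mu> \<sigma>"] real_distribution_normal_law[OF assms(1)]
    by auto
qed

lemma (in prob_space) normal_char_distr:
  assumes "normal_char M Y \<mu> v"
  shows "distr M borel Y = normal_law \<mu> (sqrt v)"
  using assms normal_char_iff[of "sqrt v" Y \<mu>] by (simp add: normal_char_def)

lemma (in prob_space) normal_char_moment:
  assumes Y: "normal_char M Y \<mu> v"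
  shows "integrable M (\<lambda>\<omega>. (Y \<omega> - \<mu>) ^ k)"
    and "expectation (\<lambda>\<omega>. (Y \<omega> - \<mu>) ^ k) = sqrt v ^ k * (\<integral>x. x ^ k \<partial>std_normal_distribution)"
proof -
  note [measurable] = normal_charD(1)[OF Y]
  have 0: "0 \<le> sqrt v"
    using normal_charD(2)[OF Y] by simp
  let ?D = "distr std_normal_distribution borel (\<lambda>x. \<mu> + sqrt v * x)"
  have D: "distr M borel Y = ?D"
    using normal_char_distr[OF Y] normal_law_eq_distr[OF 0] by simp
  have "integrable std_normal_distribution (\<lambda>x. sqrt v ^ k * x ^ k)"
    by (intro integrable_mult_right integrable_std_normal_distribution_moment)
  then have "integrable ?D (\<lambda>x. (x - \<mu>) ^ k)"
    by (subst integrable_distr_eq) (simp_all add: power_mult_distrib)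
  then show "integrable M (\<lambda>\<omega>. (Y \<omega> - \<mu>) ^ k)"
    unfolding D[symmetric] by (subst (asm) integrable_distr_eq) simp_all
  have "expectation (\<lambda>\<omega>. (Y \<omega> - \<mu>) ^ k) = (\<integral>x. (x - \<mu>) ^ k \<partial>distr M borel Y)"
    by (subst integral_distr) simp_all
  also have "\<dots> = (\<integral>x. sqrt v ^ k * x ^ k \<partial>std_normal_distribution)"
    unfolding D by (subst integral_distr) (simp_all add: power_mult_distrib)
  finally show "expectation (\<lambda>\<omega>. (Y \<omega> - \<mu>) ^ k) = sqrt v ^ k * (\<integral>x. x ^ k \<partial>std_normal_distribution)"
    by simp
qed

lemma (in prob_space) normal_char_moments:
  assumes Y: "normal_char M Y \<mu> v"
  shows "integrable M Y" "expectation Y = \<mu>"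
    "expectation (\<lambda>\<omega>. (Y \<omega> - \<mu>)\<^sup>2) = v" "expectation (\<lambda>\<omega>. (Y \<omega> - \<mu>) ^ 4) = 3 * v\<^sup>2"
proof -
  have v: "0 \<le> v"
    using normal_charD(2)[OF Y] .
  have 1: "integrable M (\<lambda>\<omega>. Y \<omega> - \<mu>)"
    using normal_char_moment(1)[OF Y, of 1] by simp
  then have "integrable M (\<lambda>\<omega>. (Y \<omega> - \<mu>) + \<mu>)"
    by (intro Bochner_Integration.integrable_add) simp_all
  then show int: "integrable M Y"
    by simp
  have "expectation (\<lambda>\<omega>. Y \<omega> - \<mu>) = 0"
    using normal_char_moment(2)[OF Y, of 1] integral_std_normal_distribution_moment_odd[of 1] by simp
  then show "expectation Y = \<mu>"
    using int by (simp add: prob_space)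
  show "expectation (\<lambda>\<omega>. (Y \<omega> - \<mu>)\<^sup>2) = v"
    using normal_char_moment(2)[OF Y, of 2] std_normal_distribution_even_moments(1)[of 1] v
    by (simp add: fact_numeral)
  have "sqrt v ^ 4 = v\<^sup>2"
    using v by (simp add: power4_eq_xxxx power2_eq_square)
  then show "expectation (\<lambda>\<omega>. (Y \<omega> - \<mu>) ^ 4) = 3 * v\<^sup>2"
    using normal_char_moment(2)[OF Y, of 4] std_normal_distribution_even_moments(1)[of 2]
    by (simp add: fact_numeral)
qed

text \<open>\<open>C\<close> enters only through its quadratic form and may be singular. Identifying
  \<open>C\<close> with the covariance matrix therefore takes symmetry, see
  \<open>gauss_with_if_gauss_char\<close>.\<close>

definition gauss_char :: "'a measure \<Rightarrow> ('a \<Rightarrow> real^'n) \<Rightarrow> real^'n \<Rightarrow> real^'n^'n \<Rightarrow> bool" where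
  "gauss_char M X m C \<longleftrightarrow> X \<in> borel_measurable M \<and>
     (\<forall>c. normal_char M (\<lambda>\<omega>. c \<bullet> X \<omega>) (c \<bullet> m) (c \<bullet> (C *v c)))"

text \<open>Polarisation: expanding the form at x + y recovers the bilinear form.\<close>

lemma quadratic_form_eq:
  fixes A B :: "real^'n^'n"
  assumes sym: "transpose A = A" "transpose B = B" and eq: "\<And>c. c \<bullet> (A *v c) = c \<bullet> (B *v c)"
  shows "A = B"
proof -
  have "x \<bullet> (A *v y) = x \<bullet> (B *v y)" for x y
    using eq[of "x + y"] eq[of x] eq[of y] inner_matrix_symmetric[OF sym(1), of x y]
      inner_matrix_symmetric[OF sym(2), of x y]
    by (simp add: matrix_vector_right_distrib inner_add_left inner_add_right inner_commute)
  then have "A *v y = B *v y" for y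
    by (metis vector_eq_ldot)
  then show ?thesis
    by (simp add: matrix_eq)
qed

lemma inner_axis_left [simp]: "axis i (1::real) \<bullet> x = x $ i" "x \<bullet> axis i 1 = x $ i"
  by (simp_all add: inner_axis inner_axis')

text \<open>The variances are an arbitrary function \<open>q\<close> because a vector known only to
  be Gauss comes without a matrix; \<open>q\<close> turns out to be the quadratic form of
  \<open>cov_matrix\<close>. Mixed products are integrable as combinations of squares of normal
  variables.\<close>

lemma (in prob_space) gauss_covariance:
  fixes X :: "'a \<Rightarrow> real^'n"
  assumes X: "X \<in> borel_measurable M" and normal: "\<And>c. normal_char M (\<lambda>\<omega>. c \<bullet> X \<omega>) (c \<bullet> m) (q c)"
  shows "integral\<^sup>L M X = m" and "transpose (cov_matrix M X) = cov_matrix M X"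
    and "q c = c \<bullet> (cov_matrix M X *v c)"
    and "\<And>i j. integrable M (\<lambda>\<omega>. (X \<omega> $ i - m $ i) * (X \<omega> $ j - m $ j))"
proof -
  have comp: "normal_char M (\<lambda>\<omega>. X \<omega> $ i) (m $ i) (q (axis i 1))" for i
    using normal[of "axis i 1"] by simp
  have "integrable M (\<lambda>\<omega>. \<Sum>i\<in>UNIV. X \<omega> $ i *\<^sub>R axis i (1::real))"
    by (intro Bochner_Integration.integrable_sum integrable_scaleR_left normal_char_moments(1)[OF comp])
  then have intX: "integrable M X"
    by (simp add: basis_expansion scalar_mult_eq_scaleR[symmetric])
  have "integral\<^sup>L M X $ i = m $ i" for i
    using integral_inner_left[OF intX, of "axis i 1"] normal_char_moments(2)[OF comp, of i] by simp
  then show mean: "integral\<^sup>L M X = m"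
    by (simp add: vec_eq_iff)
  have int: "integrable M (\<lambda>\<omega>. (X \<omega> $ i - m $ i) * (X \<omega> $ j - m $ j))" for i j
  proof -
    have "integrable M (\<lambda>\<omega>. ((axis i 1 + axis j 1) \<bullet> X \<omega> - (axis i 1 + axis j 1) \<bullet> m) ^ 2
        - (X \<omega> $ i - m $ i) ^ 2 - (X \<omega> $ j - m $ j) ^ 2)"
      by (intro Bochner_Integration.integrable_diff normal_char_moment(1)[OF normal] normal_char_moment(1)[OF comp])
    then have "integrable M (\<lambda>\<omega>. 2 * ((X \<omega> $ i - m $ i) * (X \<omega> $ j - m $ j)))"
      by (simp add: inner_add_left power2_eq_square algebra_simps)
    then show ?thesis
      by simp
  qed
  then show "\<And>i j. integrable M (\<lambda>\<omega>. (X \<omega> $ i - m $ i) * (X \<omega> $ j - m $ j))" .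
  have cov: "cov_matrix M X $ i $ j = (\<integral>\<omega>. (X \<omega> $ i - m $ i) * (X \<omega> $ j - m $ j) \<partial>M)" for i j
    by (simp add: cov_matrix_def normal_char_moments(2)[OF comp])
  then show "transpose (cov_matrix M X) = cov_matrix M X"
    by (simp add: transpose_def vec_eq_iff mult.commute)
  have "q c = expectation (\<lambda>\<omega>. (c \<bullet> X \<omega> - c \<bullet> m)\<^sup>2)"
    using normal_char_moments(3)[OF normal] by simp
  also have "\<dots> = expectation (\<lambda>\<omega>. \<Sum>i\<in>UNIV. \<Sum>j\<in>UNIV. c $ i * (c $ j * ((X \<omega> $ i - m $ i) * (X \<omega> $ j - m $ j))))"
    by (simp add: inner_vec_def power2_eq_square sum_product right_diff_distrib[symmetric]
        sum_subtractf[symmetric] ac_simps)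
  also have "\<dots> = (\<Sum>i\<in>UNIV. \<Sum>j\<in>UNIV. c $ i * (c $ j * cov_matrix M X $ i $ j))"
    by (simp add: int cov)
  also have "\<dots> = c \<bullet> (cov_matrix M X *v c)"
    by (simp add: inner_vec_def matrix_vector_mult_def sum_distrib_left ac_simps)
  finally show "q c = c \<bullet> (cov_matrix M X *v c)" .
qed

lemma (in prob_space) gauss_with_if_gauss_char:
  fixes X :: "'a \<Rightarrow> real^'n"
  assumes X: "gauss_char M X m C" and sym: "transpose C = C"
  shows "gauss_with M X m C"
proof -
  have meas: "X \<in> borel_measurable M"
    and normal: "\<And>c. normal_char M (\<lambda>\<omega>. c \<bullet> X \<omega>) (c \<bullet> m) (c \<bullet> (C *v c))"
    using X by (auto simp: gauss_char_def)
  note cov = gauss_covariance[OF meas normal]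
  have "cov_matrix M X = C"
    using cov(2) sym by (rule quadratic_form_eq) (simp add: cov(3))
  moreover have "gauss_vector M X"
    unfolding gauss_vector_def using normal_char_distr[OF normal] normal_charD(2)[OF normal] meas
    by (metis real_sqrt_ge_zero)
  ultimately show ?thesis
    by (simp add: gauss_with_def cov(1))
qed

lemma (in prob_space) gauss_char_if_gauss_with:
  fixes X :: "'a \<Rightarrow> real^'n"
  assumes "gauss_with M X m C"
  shows "gauss_char M X m C"
proof -
  have X: "gauss_vector M X" "integral\<^sup>L M X = m" "cov_matrix M X = C"
    using assms by (auto simp: gauss_with_def)
  then have meas [measurable]: "X \<in> borel_measurable M"
    by (simp add: gauss_vector_def)
  have ex: "\<exists>\<mu> v. normal_char M (\<lambda>\<omega>. c \<bullet> X \<omega>) \<mu> v" for c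
  proof -
    obtain \<mu> \<sigma> where "0 \<le> \<sigma>" "distr M borel (\<lambda>\<omega>. c \<bullet> X \<omega>) = normal_law \<mu> \<sigma>"
      using X(1) unfolding gauss_vector_def by blast
    then show ?thesis
      using normal_char_iff[of \<sigma> "\<lambda>\<omega>. c \<bullet> X \<omega>" \<mu>] by auto
  qed
  then have "integrable M (\<lambda>\<omega>. X \<omega> $ i)" for i
    using ex[of "axis i 1"] normal_char_moments(1) by fastforce
  then have "integrable M (\<lambda>\<omega>. \<Sum>i\<in>UNIV. X \<omega> $ i *\<^sub>R axis i (1::real))"
    by (intro Bochner_Integration.integrable_sum integrable_scaleR_left)
  then have intX: "integrable M X"
    by (simp add: basis_expansion scalar_mult_eq_scaleR[symmetric])
  have "\<exists>v. normal_char M (\<lambda>\<omega>. c \<bullet> X \<omega>) (c \<bullet> m) v" for c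
  proof -
    obtain \<mu> v where \<mu>: "normal_char M (\<lambda>\<omega>. c \<bullet> X \<omega>) \<mu> v"
      using ex by blast
    then have "\<mu> = c \<bullet> m"
      using normal_char_moments(2)[OF \<mu>] integral_inner_right[OF intX, of c] X(2) by simp
    with \<mu> show ?thesis by blast
  qed
  then obtain q where q: "\<And>c. normal_char M (\<lambda>\<omega>. c \<bullet> X \<omega>) (c \<bullet> m) (q c)"
    by metis
  then show ?thesis
    using gauss_covariance(3)[OF meas q] X(3) by (simp add: gauss_char_def)
qed

lemma gauss_char_trace_nonneg:
  assumes "gauss_char M Y m (D :: real^'n^'n)"
  shows "0 \<le> trace D"
  unfolding trace_def
proof (rule sum_nonneg)
  fix i
  have "0 \<le> axis i 1 \<bullet> (D *v axis i 1)"
    using assms normal_charD(2) by (fastforce simp: gauss_char_def)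
  then show "0 \<le> D $ i $ i"
    by (simp add: matrix_vector_mult_basis column_def)
qed

lemma (in prob_space) gauss_char_norm2:
  fixes X :: "'a \<Rightarrow> real^'n"
  assumes X: "gauss_char M X m C"
  shows "(\<integral>\<^sup>+\<omega>. ennreal ((norm (X \<omega> - m))\<^sup>2) \<partial>M) = ennreal (trace C)"
proof -
  have comp: "normal_char M (\<lambda>\<omega>. X \<omega> $ i) (m $ i) (C $ i $ i)" for i
    using X unfolding gauss_char_def
    by (auto dest!: spec[of _ "axis i 1"] simp: matrix_vector_mult_basis column_def)
  have "(\<integral>\<^sup>+\<omega>. ennreal ((norm (X \<omega> - m))\<^sup>2) \<partial>M) = (\<integral>\<^sup>+\<omega>. ennreal (\<Sum>i\<in>UNIV. (X \<omega> $ i - m $ i)\<^sup>2) \<partial>M)"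
    by (simp add: norm_vec_def L2_set_def sum_nonneg)
  also have "\<dots> = ennreal (expectation (\<lambda>\<omega>. \<Sum>i\<in>UNIV. (X \<omega> $ i - m $ i)\<^sup>2))"
    by (rule nn_integral_eq_integral)
      (auto intro!: sum_nonneg Bochner_Integration.integrable_sum normal_char_moment(1)[OF comp])
  also have "expectation (\<lambda>\<omega>. \<Sum>i\<in>UNIV. (X \<omega> $ i - m $ i)\<^sup>2) = trace C"
    by (simp add: normal_char_moment(1)[OF comp] normal_char_moments(3)[OF comp] trace_def)
  finally show ?thesis .
qed

text \<open>A coordinate has three times its squared variance as fourth moment;
  \<open>CARD('n)\<close> is the price of moving the square inside the sum. Being quadratic in the
  trace, the bound lets the trace act as the clock of the maximal inequality.\<close>

lemma (in prob_space) gauss_char_norm4: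
  fixes X :: "'a \<Rightarrow> real^'n"
  assumes X: "gauss_char M X 0 C"
  shows "(\<integral>\<^sup>+\<omega>. ennreal (norm (X \<omega>) ^ 4) \<partial>M) \<le> ennreal (3 * CARD('n) * (trace C)\<^sup>2)"
proof -
  have comp: "normal_char M (\<lambda>\<omega>. X \<omega> $ i) 0 (C $ i $ i)" for i
    using X unfolding gauss_char_def
    by (auto dest!: spec[of _ "axis i 1"] simp: matrix_vector_mult_basis column_def)
  have le: "norm x ^ 4 \<le> CARD('n) * (\<Sum>i\<in>UNIV. (x $ i) ^ 4)" for x :: "real^'n"
  proof -
    have "(norm x)\<^sup>2 = (\<Sum>i\<in>UNIV. (x $ i)\<^sup>2)"
      by (simp add: norm_vec_def L2_set_def sum_nonneg)
    then have "norm x ^ 4 = (\<Sum>i\<in>UNIV. (x $ i)\<^sup>2)\<^sup>2"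
      using power_mult[of "norm x" 2 2] by simp
    also have "\<dots> \<le> (\<Sum>i\<in>UNIV. ((x $ i)\<^sup>2)\<^sup>2) * CARD('n)"
      by (rule sum_squared_le_sum_of_squares)
    finally show ?thesis
      by (simp add: mult.commute flip: power_mult)
  qed
  have "(\<integral>\<^sup>+\<omega>. ennreal (norm (X \<omega>) ^ 4) \<partial>M) \<le> (\<integral>\<^sup>+\<omega>. ennreal (CARD('n) * (\<Sum>i\<in>UNIV. (X \<omega> $ i) ^ 4)) \<partial>M)"
    by (intro nn_integral_mono ennreal_leI le)
  also have "\<dots> = ennreal (expectation (\<lambda>\<omega>. CARD('n) * (\<Sum>i\<in>UNIV. (X \<omega> $ i) ^ 4)))"
    using normal_char_moment(1)[OF comp]
    by (intro nn_integral_eq_integral) (auto intro!: sum_nonneg mult_nonneg_nonneg AE_I2)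
  also have "expectation (\<lambda>\<omega>. CARD('n) * (\<Sum>i\<in>UNIV. (X \<omega> $ i) ^ 4)) = CARD('n) * (\<Sum>i\<in>UNIV. 3 * (C $ i $ i)\<^sup>2)"
    using normal_char_moment(1)[OF comp] normal_char_moments(4)[OF comp] by simp
  also have "\<dots> \<le> CARD('n) * (3 * (trace C)\<^sup>2)"
  proof -
    have "(\<Sum>i\<in>UNIV. (C $ i $ i)\<^sup>2) \<le> (\<Sum>i\<in>UNIV. C $ i $ i)\<^sup>2"
    proof -
      have "L2_set (\<lambda>i. C $ i $ i) UNIV \<le> (\<Sum>i\<in>UNIV. C $ i $ i)"
        by (rule L2_set_le_sum) (simp add: normal_charD(2)[OF comp])
      then have "(L2_set (\<lambda>i. C $ i $ i) UNIV)\<^sup>2 \<le> (\<Sum>i\<in>UNIV. C $ i $ i)\<^sup>2"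
        by (rule power_mono) (rule L2_set_nonneg)
      then show ?thesis
        by (simp add: L2_set_def sum_nonneg)
    qed
    then show ?thesis
      by (simp add: trace_def flip: sum_distrib_left)
  qed
  finally show ?thesis
    by (simp add: ac_simps ennreal_leI)
qed

section \<open>Evolution matrices\<close>

text \<open>Gronwall's argument for f = |X|^2: since |f'| \<le> k f, the function exp(-k u) f(u)
  decreases and exp(k u) f(u) increases. The first settles times after \<open>s\<close>, the second
  times before \<open>s\<close>.\<close>

lemma linear_ode_zero:
  fixes X :: "real \<Rightarrow> real^'n^'m" and Q :: "real \<Rightarrow> real^'m^'m"
  assumes Q: "continuous_on {0..} Q"
    and X: "\<And>t. 0 \<le> t \<Longrightarrow> (X has_vector_derivative Q t ** X t) (at t within {0..})"
    and s: "0 \<le> s" "X s = 0" and t: "0 \<le> t"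
  shows "X t = 0"
proof -
  let ?I = "{min s t..max s t}"
  have I: "?I \<subseteq> {0..}"
    using s t by auto
  have "compact (Q ` ?I)"
    by (intro compact_continuous_image continuous_on_subset[OF Q I] compact_Icc)
  then obtain q where q: "\<And>u. u \<in> ?I \<Longrightarrow> norm (Q u) \<le> q"
    using compact_imp_bounded bounded_iff by (metis image_eqI)
  obtain B where B: "0 < B" "\<And>(A :: real^'m^'m) (Y :: real^'n^'m). norm (A ** Y) \<le> norm A * norm Y * B"
    using bounded_bilinear.pos_bounded[OF bounded_bilinear_matrix_matrix_mult] by metis
  \<comment> \<open>\<open>q\<close> bounds \<open>Q\<close> between the two times, \<open>B\<close>
    is the boundedness constant of the matrix product in the norm used here, and 2 comes from
    differentiating a square.\<close>
  define k where "k = 2 * (q * B)"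
  define f where "f u = X u \<bullet> X u" for u
  define f' where "f' u = 2 * (X u \<bullet> (Q u ** X u))" for u
  have f': "\<bar>f' u\<bar> \<le> k * f u" if "u \<in> ?I" for u
  proof -
    have "\<bar>X u \<bullet> (Q u ** X u)\<bar> \<le> norm (X u) * norm (Q u ** X u)"
      by (rule Cauchy_Schwarz_ineq2)
    also have "\<dots> \<le> norm (X u) * (q * norm (X u) * B)"
      using B(1) q[OF that]
      by (intro mult_left_mono order_trans[OF B(2)] mult_right_mono) auto
    finally show ?thesis
      by (simp add: f'_def f_def k_def power2_norm_eq_inner[symmetric] power2_eq_square abs_mult ac_simps)
  qed
  have deriv: "((\<lambda>u. exp (c * u) * f u) has_derivative (\<lambda>h. h * (exp (c * u) * (c * f u + f' u)))) (at u within ?I)"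
    if "u \<in> ?I" for c u
  proof -
    have Xu: "(X has_vector_derivative Q u ** X u) (at u within ?I)"
      using I that by (intro has_vector_derivative_within_subset[OF X]) auto
    have "(f has_vector_derivative f' u) (at u within ?I)"
      unfolding f_def f'_def
      using bounded_bilinear.has_vector_derivative[OF bounded_bilinear_inner Xu Xu]
      by (simp add: inner_commute)
    then have "(f has_real_derivative f' u) (at u within ?I)"
      by (simp add: has_real_derivative_iff_has_vector_derivative)
    then have "((\<lambda>u. exp (c * u) * f u) has_real_derivative (exp (c * u) * (c * f u + f' u))) (at u within ?I)"
      by (auto intro!: derivative_eq_intros simp: algebra_simps)
    then show ?thesis
      unfolding has_field_derivative_def by (rule has_derivative_eq_rhs) (simp add: fun_eq_iff)
  qed
  have fs: "f s = 0"
    by (simp add: f_def s)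
  have "f t \<le> 0"
  proof (cases "s \<le> t")
    case True
    then have I': "?I = {s..t}"
      by simp
    have "\<exists>u\<in>{s..t}. exp (- k * t) * f t - exp (- k * s) * f s =
        (t - s) * (exp (- k * u) * (- k * f u + f' u))"
      by (rule mvt_very_simple[OF True]) (rule deriv[unfolded I'], simp)
    then obtain u where u: "u \<in> {s..t}" "exp (- k * t) * f t - exp (- k * s) * f s =
        (t - s) * (exp (- k * u) * (- k * f u + f' u))"
      by blast
    have "- k * f u + f' u \<le> 0"
      using f'[of u] u(1) unfolding I' by linarith
    then have "exp (- k * t) * f t \<le> 0"
      using u(2) True fs mult_nonneg_nonpos[of "t - s" "exp (- k * u) * (- k * f u + f' u)"]
      by (simp add: mult_nonneg_nonpos)
    then show ?thesis
      by (simp add: mult_le_0_iff)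
  next
    case False
    then have le: "t \<le> s" by simp
    then have I': "?I = {t..s}"
      by simp
    have "\<exists>u\<in>{t..s}. exp (k * s) * f s - exp (k * t) * f t =
        (s - t) * (exp (k * u) * (k * f u + f' u))"
      by (rule mvt_very_simple[OF le]) (rule deriv[unfolded I'], simp)
    then obtain u where u: "u \<in> {t..s}" "exp (k * s) * f s - exp (k * t) * f t =
        (s - t) * (exp (k * u) * (k * f u + f' u))"
      by blast
    have "0 \<le> k * f u + f' u"
      using f'[of u] u(1) unfolding I' by linarith
    then have "0 \<le> (s - t) * (exp (k * u) * (k * f u + f' u))"
      using le by (intro mult_nonneg_nonneg) auto
    then have "exp (k * t) * f t \<le> 0"
      using u(2) fs by simp
    then show ?thesis
      by (simp add: mult_le_0_iff)
  qed
  then show ?thesis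
    using antisym[OF _ inner_ge_zero[of "X t"]] by (simp add: f_def)
qed

context
  fixes Q :: "real \<Rightarrow> real^'d^'d" and E :: "real \<Rightarrow> real \<Rightarrow> real^'d^'d"
  assumes Q: "continuous_on {0..} Q" and E: "evolution_matrices Q E"
begin

lemma evolution_same: "0 \<le> s \<Longrightarrow> E s s = mat 1"
  using E by (simp add: evolution_matrices_def)

lemma evolution_derivative:
  "0 \<le> s \<Longrightarrow> 0 \<le> t \<Longrightarrow> ((\<lambda>t. E t s) has_vector_derivative Q t ** E t s) (at t within {0..})"
  using E by (simp add: evolution_matrices_def)

text \<open>Uniqueness for the linear equation: as functions of the first argument both sides solve
  it, and they agree at time \<open>s\<close>.\<close>

lemma evolution_mult:
  assumes "0 \<le> s" "0 \<le> r" "0 \<le> t"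
  shows "E t s ** E s r = E t r"
proof -
  have "E t s ** E s r - E t r = 0"
  proof (rule linear_ode_zero[OF Q, where X="\<lambda>u. E u s ** E s r - E u r" and s=s])
    fix u :: real assume u: "0 \<le> u"
    have "((\<lambda>u. E u s ** E s r) has_vector_derivative Q u ** E u s ** E s r) (at u within {0..})"
      by (rule bounded_linear.has_vector_derivative[OF
            bounded_bilinear.bounded_linear_left[OF bounded_bilinear_matrix_matrix_mult]])
        (rule evolution_derivative[OF assms(1) u])
    from has_vector_derivative_diff[OF this evolution_derivative[OF assms(2) u]]
    show "((\<lambda>u. E u s ** E s r - E u r) has_vector_derivative Q u ** (E u s ** E s r - E u r)) (at u within {0..})"
      by (simp add: matrix_diff_ldistrib matrix_mul_assoc)
  next
    show "E s s ** E s r - E s r = 0"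
      using assms by (simp add: evolution_same)
  qed (use assms in auto)
  then show ?thesis
    by simp
qed

lemma evolution_inverse: "0 \<le> s \<Longrightarrow> 0 \<le> t \<Longrightarrow> E t s ** E s t = mat 1"
  by (simp add: evolution_mult evolution_same)

lemma evolution_continuous: "0 \<le> s \<Longrightarrow> continuous_on {0..} (\<lambda>t. E t s)"
  using evolution_derivative by (intro continuous_on_vector_derivative) auto

text \<open>The equation speaks only about the first argument; continuity in the second comes from
  \<open>E s t\<close> being the inverse of \<open>E t s\<close>.\<close>

lemma evolution_continuous_right:
  assumes "0 \<le> s"
  shows "continuous_on {0..} (\<lambda>t. E s t)"
proof -
  have "matrix_inv (E t s) = E s t" if "t \<in> {0..}" for t
    using that assms by (intro matrix_inv_unique evolution_inverse) auto
  moreover have "continuous_on {0..} (\<lambda>t. matrix_inv (E t s))"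
    using evolution_inverse assms
    by (intro continuous_on_matrix_inv evolution_continuous) (auto simp: invertible_right_inverse)
  ultimately show ?thesis
    by (rule continuous_on_eq[rotated])
qed

end

section \<open>The deterministic data of the bridge\<close>

text \<open>In the moving frame \<open>x \<mapsto> \<Psi> t x\<close>, where \<open>\<Psi> t = E(0,t) = \<Phi> t\<^sup>-\<^sup>1\<close>, the drift \<open>Q\<close> disappears and all
  matrices of the bridge are expressed through \<open>R t = \<integral>\<^sub>t\<^sup>T \<Psi> \<Sigma> \<Sigma>\<^sup>T \<Psi>\<^sup>T\<close> and \<open>\<Lambda> t = R t\<^sup>-\<^sup>1\<close>.\<close>

locale bridge_data =
  fixes Q :: "real \<Rightarrow> real^'d^'d" and Sg :: "real \<Rightarrow> real^'p^'d" and r :: "real \<Rightarrow> real^'d"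
    and E :: "real \<Rightarrow> real \<Rightarrow> real^'d^'d" and T :: real
  assumes cont_Q: "continuous_on {0..} Q" and cont_Sg: "continuous_on {0..} Sg"
    and cont_r: "continuous_on {0..} r" and evol: "evolution_matrices Q E"
    and kappa_pos_def: "\<And>s t. 0 \<le> s \<Longrightarrow> s < t \<Longrightarrow> pos_def (kappa E Sg s t)"
    and T_pos: "0 < T"
begin

definition \<Phi> :: "real \<Rightarrow> real^'d^'d" where "\<Phi> t = E t 0"
definition \<Psi> :: "real \<Rightarrow> real^'d^'d" where "\<Psi> t = E 0 t"
definition K :: "real \<Rightarrow> real^'d^'d" where "K u = \<Psi> u ** Sg u ** transpose (\<Psi> u ** Sg u)"
definition R :: "real \<Rightarrow> real^'d^'d" where "R t = integral {t..T} K"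
definition \<Lambda> :: "real \<Rightarrow> real^'d^'d" where "\<Lambda> t = matrix_inv (R t)"
definition \<rho> :: "real \<Rightarrow> real^'d" where "\<rho> t = integral {0..t} (\<lambda>u. \<Psi> u *v r u)"
text \<open>The target \<open>b\<close> in the moving frame with the drift part removed: relative to
  \<rho> t + \<beta> b the target is the origin.\<close>

definition \<beta> :: "real^'d \<Rightarrow> real^'d" where "\<beta> b = \<Psi> T *v b - \<rho> T"
text \<open>The covariance of the bridge from \<open>s\<close> to \<open>t\<close>, seen in the
  moving frame; \<open>S_eq\<close> gives a symmetric form of it.\<close>

definition S :: "real \<Rightarrow> real \<Rightarrow> real^'d^'d" where "S s t = R t ** \<Lambda> s ** (R s - R t)"

lemma \<Phi>\<Psi>: "0 \<le> t \<Longrightarrow> \<Phi> t ** \<Psi> t = mat 1"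
  and \<Psi>\<Phi>: "0 \<le> t \<Longrightarrow> \<Psi> t ** \<Phi> t = mat 1"
  by (simp_all add: \<Phi>_def \<Psi>_def evolution_inverse[OF cont_Q evol])

lemma E_eq: "0 \<le> s \<Longrightarrow> 0 \<le> t \<Longrightarrow> E t s = \<Phi> t ** \<Psi> s"
  by (simp add: \<Phi>_def \<Psi>_def evolution_mult[OF cont_Q evol])

lemma invertible_\<Phi>: "0 \<le> t \<Longrightarrow> invertible (\<Phi> t)"
  and invertible_\<Psi>: "0 \<le> t \<Longrightarrow> invertible (\<Psi> t)"
  using \<Phi>\<Psi> \<Psi>\<Phi> invertible_right_inverse by blast+

lemma cancel_\<Phi>\<Psi>:
  assumes "0 \<le> t"
  shows "\<Phi> t ** (\<Psi> t ** A) = (A :: real^'n^'d)" "\<Psi> t ** (\<Phi> t ** A) = A"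
    "transpose (\<Phi> t) ** (transpose (\<Psi> t) ** A) = A" "transpose (\<Psi> t) ** (transpose (\<Phi> t) ** A) = A"
    "transpose (\<Phi> t) ** transpose (\<Psi> t) = mat 1" "transpose (\<Psi> t) ** transpose (\<Phi> t) = mat 1"
    "\<Phi> t *v (\<Psi> t *v x) = x" "\<Psi> t *v (\<Phi> t *v x) = x"
proof -
  show t: "transpose (\<Phi> t) ** transpose (\<Psi> t) = mat 1" "transpose (\<Psi> t) ** transpose (\<Phi> t) = mat 1"
    by (simp_all add: matrix_transpose_mul[symmetric] \<Phi>\<Psi> \<Psi>\<Phi> assms)
  show "\<Phi> t ** (\<Psi> t ** A) = A" "\<Psi> t ** (\<Phi> t ** A) = A"
    "transpose (\<Phi> t) ** (transpose (\<Psi> t) ** A) = A" "transpose (\<Psi> t) ** (transpose (\<Phi> t) ** A) = A"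
    by (simp_all only: matrix_mul_assoc \<Phi>\<Psi> \<Psi>\<Phi> assms t matrix_mul_lid)
  show "\<Phi> t *v (\<Psi> t *v x) = x" "\<Psi> t *v (\<Phi> t *v x) = x"
    by (simp_all only: matrix_vector_mul_assoc \<Phi>\<Psi> \<Psi>\<Phi> assms matrix_vector_mul_lid)
qed

lemma cont_\<Phi>: "continuous_on {0..} \<Phi>"
  using evolution_continuous[OF cont_Q evol, of 0] by (simp add: \<Phi>_def[abs_def])

lemma cont_\<Psi>: "continuous_on {0..} \<Psi>"
  using evolution_continuous_right[OF cont_Q evol, of 0] by (simp add: \<Psi>_def[abs_def])

lemma cont_K: "continuous_on {0..} K"
  unfolding K_def by (intro continuous_intros cont_\<Psi> cont_Sg)

lemma K_integrable: "0 \<le> s \<Longrightarrow> K integrable_on {s..t}"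
  by (intro integrable_continuous_interval continuous_on_subset[OF cont_K]) auto

lemma integral_K:
  assumes "0 \<le> s" "s \<le> t" "t \<le> T"
  shows "integral {s..t} K = R s - R t"
proof -
  have "integral {s..t} K + integral {t..T} K = integral {s..T} K"
    using assms by (intro Henstock_Kurzweil_Integration.integral_combine K_integrable) auto
  then show ?thesis
    by (simp add: R_def algebra_simps)
qed

lemma R_T: "R T = 0"
  by (simp add: R_def)

text \<open>Since \<open>E t u\<close> factors as \<open>\<Phi> t ** \<Psi> u\<close>, the factor at
  \<open>t\<close> leaves the integral, and what remains is additive over intervals.\<close>

lemma kappa_eq:
  assumes "0 \<le> s" "s \<le> t" "t \<le> T"
  shows "kappa E Sg s t = \<Phi> t ** (R s - R t) ** transpose (\<Phi> t)"
proof -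
  have lin: "bounded_linear (\<lambda>A. \<Phi> t ** A ** transpose (\<Phi> t))"
    by (intro bounded_linear_compose[OF
          bounded_bilinear.bounded_linear_left[OF bounded_bilinear_matrix_matrix_mult]
          bounded_bilinear.bounded_linear_right[OF bounded_bilinear_matrix_matrix_mult]])
  have "kappa E Sg s t = integral {s..t} (\<lambda>u. \<Phi> t ** K u ** transpose (\<Phi> t))"
    unfolding kappa_def
  proof (rule Henstock_Kurzweil_Integration.integral_cong)
    fix u assume "u \<in> {s..t}"
    then show "E t u ** Sg u ** transpose (Sg u) ** transpose (E t u) = \<Phi> t ** K u ** transpose (\<Phi> t)"
      using assms by (simp add: E_eq K_def matrix_transpose_mul matrix_mul_assoc)
  qed
  also have "\<dots> = \<Phi> t ** integral {s..t} K ** transpose (\<Phi> t)"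
    using integral_linear[OF K_integrable lin, of s t] assms by (simp add: o_def)
  finally show ?thesis
    by (simp add: integral_K assms)
qed

lemma R_diff_pos_def:
  assumes "0 \<le> s" "s < t" "t \<le> T"
  shows "pos_def (R s - R t)"
proof -
  have "pos_def (\<Psi> t ** kappa E Sg s t ** transpose (\<Psi> t))"
    using assms by (intro pos_def_congruence kappa_pos_def invertible_\<Psi>) auto
  then show ?thesis
    using assms by (simp add: kappa_eq matrix_mul_assoc_rev cancel_\<Phi>\<Psi>)
qed

lemma R_pos_def: "0 \<le> t \<Longrightarrow> t < T \<Longrightarrow> pos_def (R t)"
  using R_diff_pos_def[of t T] by (simp add: R_T)

lemma R_sym: "0 \<le> t \<Longrightarrow> t \<le> T \<Longrightarrow> transpose (R t) = R t"
  using R_pos_def[of t, THEN pos_def_symmetric] R_T by (cases "t = T") (auto simp: transpose_def zero_vec_def)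

lemma R\<Lambda>:
  assumes "0 \<le> t" "t < T"
  shows "R t ** \<Lambda> t = mat 1" "\<Lambda> t ** R t = mat 1"
    "R t ** (\<Lambda> t ** A) = (A :: real^'n^'d)" "\<Lambda> t ** (R t ** A) = A"
    "R t *v (\<Lambda> t *v x) = x" "\<Lambda> t *v (R t *v x) = x"
proof -
  show 1: "R t ** \<Lambda> t = mat 1" "\<Lambda> t ** R t = mat 1"
    using assms by (simp_all add: \<Lambda>_def matrix_inv_right matrix_inv_left pos_def_invertible R_pos_def)
  show "R t ** (\<Lambda> t ** A) = A" "\<Lambda> t ** (R t ** A) = A"
    by (simp_all add: matrix_mul_cancel 1)
  show "R t *v (\<Lambda> t *v x) = x" "\<Lambda> t *v (R t *v x) = x"
    by (simp_all add: matrix_vector_mul_cancel 1)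
qed

lemma \<Lambda>_pos_def: "0 \<le> t \<Longrightarrow> t < T \<Longrightarrow> pos_def (\<Lambda> t)"
  by (simp add: \<Lambda>_def R_pos_def pos_def_matrix_inv)

lemma \<Lambda>_sym: "0 \<le> t \<Longrightarrow> t < T \<Longrightarrow> transpose (\<Lambda> t) = \<Lambda> t"
  by (rule pos_def_symmetric) (rule \<Lambda>_pos_def)

lemma Gam_eq:
  assumes "0 \<le> s" "s \<le> t" "t \<le> T"
  shows "Gam E Sg s t = \<Phi> s ** (R s - R t) ** transpose (\<Phi> t)"
  using assms by (simp add: Gam_def kappa_eq E_eq matrix_mul_assoc_rev cancel_\<Phi>\<Psi>)

lemma Gam_T_eq: "0 \<le> s \<Longrightarrow> s \<le> T \<Longrightarrow> Gam E Sg s T = \<Phi> s ** R s ** transpose (\<Phi> T)"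
  by (simp add: Gam_eq R_T)

lemma matrix_inv_Gam_T:
  assumes "0 \<le> s" "s < T"
  shows "matrix_inv (Gam E Sg s T) = transpose (\<Psi> T) ** \<Lambda> s ** \<Psi> s"
  by (rule matrix_inv_unique)
    (use assms in \<open>simp add: Gam_T_eq matrix_mul_assoc_rev cancel_\<Phi>\<Psi> R\<Lambda> \<Phi>\<Psi>\<close>)

lemma invertible_Gam_T: "0 \<le> s \<Longrightarrow> s < T \<Longrightarrow> invertible (Gam E Sg s T)"
  by (simp add: Gam_T_eq invertible_mult invertible_\<Phi> transpose_invertible pos_def_invertible
      R_pos_def)

lemma bridge_cov_eq:
  assumes "0 \<le> s" "s \<le> t" "t < T"
  shows "bridge_cov E Sg T s t = \<Phi> t ** S s t ** transpose (\<Phi> t)"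
  using assms by (simp add: bridge_cov_def matrix_inv_Gam_T)
    (simp add: Gam_T_eq Gam_eq[of s t] S_def matrix_mul_assoc_rev cancel_\<Phi>\<Psi>)

text \<open>\<open>R s - R t\<close> equals
  \<open>R s ** (\<Lambda> t - \<Lambda> s) ** R t\<close>, and \<open>\<Lambda> s\<close> cancels
  \<open>R s\<close>. The result is the covariance of \<open>R t\<close> applied to a Gauss vector
  with covariance \<open>\<Lambda> t - \<Lambda> s\<close>.\<close>

lemma S_eq:
  assumes "0 \<le> s" "s \<le> t" "t < T"
  shows "S s t = R t ** (\<Lambda> t - \<Lambda> s) ** R t"
  using assms by (simp add: S_def matrix_diff_ldistrib matrix_diff_rdistrib matrix_mul_assoc_rev R\<Lambda>)

lemma S_sym: "0 \<le> s \<Longrightarrow> s \<le> t \<Longrightarrow> t < T \<Longrightarrow> transpose (S s t) = S s t"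
  by (simp add: S_eq matrix_transpose_mul transpose_diff R_sym \<Lambda>_sym matrix_mul_assoc)

text \<open>The parallel sum rule for \<open>R t\<close> and \<open>R s - R t\<close>. It exhibits
  \<open>S s t\<close> as the inverse of a sum of positive definite matrices.\<close>

lemma S_inverse:
  assumes "0 \<le> s" "s < t" "t < T"
  shows "S s t ** (\<Lambda> t + matrix_inv (R s - R t)) = mat 1"
proof -
  have 1: "(R s - R t) ** matrix_inv (R s - R t) = mat 1"
    using assms by (intro matrix_inv_right pos_def_invertible R_diff_pos_def) auto
  have "S s t ** (\<Lambda> t + matrix_inv (R s - R t)) =
      R t ** (\<Lambda> s ** ((R s - R t) ** \<Lambda> t)) + R t ** \<Lambda> s"
    unfolding S_def matrix_add_ldistrib matrix_mul_assoc_rev 1 by simp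
  also have "(R s - R t) ** \<Lambda> t = R s ** \<Lambda> t - R t ** \<Lambda> t"
    by (rule matrix_diff_rdistrib)
  finally show ?thesis
    using assms by (simp add: matrix_diff_ldistrib R\<Lambda>)
qed

lemma S_pos_def:
  assumes "0 \<le> s" "s < t" "t < T"
  shows "pos_def (S s t)"
proof -
  have "pos_def (\<Lambda> t + matrix_inv (R s - R t))"
    using assms by (intro pos_def_add \<Lambda>_pos_def pos_def_matrix_inv R_diff_pos_def) auto
  moreover have "matrix_inv (\<Lambda> t + matrix_inv (R s - R t)) = S s t"
    using S_inverse[OF assms] by (intro matrix_inv_unique) (simp add: matrix_left_right_inverse)
  ultimately show ?thesis
    using pos_def_matrix_inv by metis
qed

lemma bridge_cov_pos_def:
  "0 \<le> s \<Longrightarrow> s < t \<Longrightarrow> t < T \<Longrightarrow> pos_def (bridge_cov E Sg T s t)"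
  by (simp add: bridge_cov_eq pos_def_congruence S_pos_def invertible_\<Phi>)

lemma bridge_cov_sym:
  "0 \<le> s \<Longrightarrow> s \<le> t \<Longrightarrow> t < T \<Longrightarrow> transpose (bridge_cov E Sg T s t) = bridge_cov E Sg T s t"
  by (simp add: bridge_cov_eq matrix_transpose_mul S_sym matrix_mul_assoc)

lemma integral_r:
  assumes "0 \<le> s" "s \<le> t" "0 \<le> w"
  shows "integral {s..t} (\<lambda>u. E w u *v r u) = \<Phi> w *v (\<rho> t - \<rho> s)"
proof -
  have int: "(\<lambda>u. \<Psi> u *v r u) integrable_on {x..y}" if "0 \<le> x" for x y
    using that by (intro integrable_continuous_interval continuous_intros
        continuous_on_subset[OF cont_\<Psi>] continuous_on_subset[OF cont_r]) auto
  have lin: "bounded_linear (\<lambda>x. \<Phi> w *v x)"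
    by (rule bounded_bilinear.bounded_linear_right[OF bounded_bilinear_matrix_vector_mult])
  have "integral {s..t} (\<lambda>u. E w u *v r u) = integral {s..t} (\<lambda>u. \<Phi> w *v (\<Psi> u *v r u))"
    using assms by (intro Henstock_Kurzweil_Integration.integral_cong)
      (simp add: E_eq matrix_vector_mul_assoc)
  also have "\<dots> = \<Phi> w *v integral {s..t} (\<lambda>u. \<Psi> u *v r u)"
    using integral_linear[OF int lin, of s t] assms by (simp add: o_def)
  also have "integral {s..t} (\<lambda>u. \<Psi> u *v r u) = \<rho> t - \<rho> s"
  proof -
    have "integral {0..s} (\<lambda>u. \<Psi> u *v r u) + integral {s..t} (\<lambda>u. \<Psi> u *v r u) = integral {0..t} (\<lambda>u. \<Psi> u *v r u)"
      using assms by (intro Henstock_Kurzweil_Integration.integral_combine int) auto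
    then show ?thesis
      by (simp add: \<rho>_def algebra_simps)
  qed
  finally show ?thesis .
qed

text \<open>Relative to drift and target, conditioning on the end point multiplies the deviation at
  \<open>s\<close> by \<open>R t ** \<Lambda> s\<close>, the matrix version of the factor (T - t)/(T
  - s) of the Brownian bridge.\<close>

lemma bridge_mean_eq:
  assumes "0 \<le> s" "s \<le> t" "t < T"
  shows "bridge_mean E Sg r T x b s t =
    \<Phi> t *v (\<rho> t + \<beta> b + R t *v (\<Lambda> s *v (\<Psi> s *v x - \<rho> s - \<beta> b)))"
proof -
  have 1: "transpose (Gam E Sg s t) ** matrix_inv (transpose (Gam E Sg s T)) =
      \<Phi> t ** (R s - R t) ** \<Lambda> s ** \<Psi> T"
    using assms by (simp add: matrix_inv_transpose invertible_Gam_T matrix_inv_Gam_T)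
      (simp add: Gam_eq matrix_transpose_mul transpose_diff R_sym \<Lambda>_sym matrix_mul_assoc_rev cancel_\<Phi>\<Psi>)
  have 2: "Gam E Sg t T ** matrix_inv (Gam E Sg s T) = \<Phi> t ** R t ** \<Lambda> s ** \<Psi> s"
    using assms by (simp add: matrix_inv_Gam_T)
      (simp add: Gam_T_eq matrix_mul_assoc_rev cancel_\<Phi>\<Psi>)
  have 3: "(\<Phi> t ** (R s - R t) ** \<Lambda> s ** \<Psi> T) *v mminus E r b t T =
      \<Phi> t *v (\<beta> b + \<rho> t - R t *v (\<Lambda> s *v (\<beta> b + \<rho> t)))"
    using assms by (simp add: mminus_def integral_r \<beta>_def matrix_vector_mul_assoc[symmetric]
        matrix_vector_mult_diff_distrib matrix_vector_mult_diff_rdistrib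
        matrix_vector_right_distrib cancel_\<Phi>\<Psi> R\<Lambda> algebra_simps)
  have 4: "(\<Phi> t ** R t ** \<Lambda> s ** \<Psi> s) *v mplus E r x s t =
      \<Phi> t *v (R t *v (\<Lambda> s *v (\<Psi> s *v x + \<rho> t - \<rho> s)))"
    using assms by (simp add: mplus_def integral_r matrix_vector_mul_assoc[symmetric]
        matrix_vector_mult_diff_distrib matrix_vector_right_distrib cancel_\<Phi>\<Psi> algebra_simps)
  show ?thesis
    unfolding bridge_mean_def 1 2 3 4
    by (simp add: matrix_vector_mult_diff_distrib matrix_vector_right_distrib algebra_simps)
qed

lemma bridge_mean_affine:
  assumes "0 \<le> s" "s \<le> t" "t < T"
  shows "bridge_mean E Sg r T (x + y) b s t =
    bridge_mean E Sg r T x b s t + (\<Phi> t ** R t ** \<Lambda> s ** \<Psi> s) *v y"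
  using assms by (simp add: bridge_mean_eq matrix_vector_mult_diff_distrib
      matrix_vector_right_distrib matrix_vector_mul_assoc[symmetric] algebra_simps)

lemma bridge_mean_compose:
  assumes "0 \<le> s" "s \<le> u" "u \<le> t" "t < T"
  shows "bridge_mean E Sg r T (bridge_mean E Sg r T x b s u) b u t = bridge_mean E Sg r T x b s t"
  using assms by (simp add: bridge_mean_eq[of s u] bridge_mean_eq[of u t] bridge_mean_eq[of s t]
      cancel_\<Phi>\<Psi> R\<Lambda>)

text \<open>\<open>\<Lambda> t - \<Lambda> s\<close> telescopes through \<open>\<Lambda> u\<close>,
  and the propagation matrix carries the part up to \<open>u\<close> on to \<open>t\<close>.
  Together with \<open>bridge_mean_compose\<close> this is the Chapman-Kolmogorov equation on the
  level of parameters.\<close>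

lemma bridge_cov_compose:
  assumes "0 \<le> s" "s \<le> u" "u \<le> t" "t < T"
  shows "bridge_cov E Sg T s t = bridge_cov E Sg T u t +
    (\<Phi> t ** R t ** \<Lambda> u ** \<Psi> u) ** bridge_cov E Sg T s u ** transpose (\<Phi> t ** R t ** \<Lambda> u ** \<Psi> u)"
  using assms by (simp add: bridge_cov_eq S_eq matrix_transpose_mul R_sym \<Lambda>_sym matrix_mul_assoc_rev
      cancel_\<Phi>\<Psi> R\<Lambda> matrix_diff_ldistrib matrix_diff_rdistrib matrix_add_ldistrib matrix_add_rdistrib)

lemma gauss_density_congruence:
  assumes "pos_def A" "0 \<le> t"
  shows "gauss_density (\<Phi> t *v m) (\<Phi> t ** A ** transpose (\<Phi> t)) (\<Phi> t *v y) =
    gauss_density m A y / \<bar>det (\<Phi> t)\<bar>"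
proof -
  have "sqrt ((2 * pi) ^ CARD('d) * det (\<Phi> t ** A ** transpose (\<Phi> t))) =
      sqrt ((2 * pi) ^ CARD('d) * det A) * \<bar>det (\<Phi> t)\<bar>"
    by (simp add: det_mul real_sqrt_mult)
  moreover have "(matrix_inv (\<Phi> t ** A ** transpose (\<Phi> t)) *v (\<Phi> t *v y - \<Phi> t *v m)) \<bullet> (\<Phi> t *v y - \<Phi> t *v m) =
      (matrix_inv A *v (y - m)) \<bullet> (y - m)"
    using matrix_inv_congruence[OF pos_def_invertible[OF assms(1)] invertible_\<Phi>[OF assms(2)], of "y - m"]
    by (simp add: matrix_vector_mult_diff_distrib)
  ultimately show ?thesis
    by (simp add: gauss_density_def)
qed

text \<open>In the moving frame, relative to the target, this is \<open>gauss_density_bayes\<close>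
  with covariances \<open>R t\<close> and \<open>R s - R t\<close>. The Jacobian of
  \<open>\<Phi> t\<close> occurs on both sides, that of \<open>\<Phi> T\<close> cancels in the
  quotient.\<close>

lemma bridge_density_eq:
  assumes "0 \<le> s" "s < t" "t < T"
  shows "gauss_density (bridge_mean E Sg r T x b s t) (bridge_cov E Sg T s t) y =
    pZ E Sg r s t x y * pZ E Sg r t T y b / pZ E Sg r s T x b"
proof -
  define x' where "x' = \<Psi> s *v x - \<rho> s - \<beta> b"
  define y' where "y' = \<Psi> t *v y - \<rho> t - \<beta> b"
  have y: "y = \<Phi> t *v (\<rho> t + \<beta> b + y')"
    using assms by (simp add: y'_def cancel_\<Phi>\<Psi>)
  have b: "b = \<Phi> T *v (\<rho> T + \<beta> b + 0)"
    using T_pos by (simp add: \<beta>_def cancel_\<Phi>\<Psi>)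
  have mlin: "mlin E r z u w = \<Phi> w *v (\<rho> w + \<beta> b + (\<Psi> u *v z - \<rho> u - \<beta> b))"
    if "0 \<le> u" "u \<le> w" for z u w
    using that by (simp add: mlin_def mplus_def integral_r E_eq matrix_vector_mul_assoc[symmetric]
        matrix_vector_right_distrib matrix_vector_mult_diff_distrib cancel_\<Phi>\<Psi>)
  have mean: "bridge_mean E Sg r T x b s t = \<Phi> t *v (\<rho> t + \<beta> b + R t *v (\<Lambda> s *v x'))"
    using assms by (simp add: bridge_mean_eq x'_def)
  have "gauss_density (bridge_mean E Sg r T x b s t) (bridge_cov E Sg T s t) y =
      gauss_density (\<Phi> t *v (\<rho> t + \<beta> b + R t *v (\<Lambda> s *v x'))) (\<Phi> t ** S s t ** transpose (\<Phi> t))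
        (\<Phi> t *v (\<rho> t + \<beta> b + y'))"
    using assms by (simp only: mean bridge_cov_eq less_imp_le y[symmetric])
  then have 1: "gauss_density (bridge_mean E Sg r T x b s t) (bridge_cov E Sg T s t) y =
      gauss_density (R t *v (\<Lambda> s *v x')) (S s t) y' / \<bar>det (\<Phi> t)\<bar>"
    using assms by (simp only: gauss_density_congruence[OF S_pos_def] gauss_density_translate)
  have "mlin E r x s t = \<Phi> t *v (\<rho> t + \<beta> b + x')"
    using assms unfolding x'_def by (intro mlin) auto
  then have "pZ E Sg r s t x y = gauss_density (\<Phi> t *v (\<rho> t + \<beta> b + x'))
      (\<Phi> t ** (R s - R t) ** transpose (\<Phi> t)) (\<Phi> t *v (\<rho> t + \<beta> b + y'))"
    using assms by (simp only: pZ_def kappa_eq less_imp_le y[symmetric])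
  also have "\<dots> = gauss_density x' (R s - R t) y' / \<bar>det (\<Phi> t)\<bar>"
    using assms by (subst gauss_density_congruence) (simp_all add: R_diff_pos_def gauss_density_translate)
  finally have 2: "pZ E Sg r s t x y = gauss_density x' (R s - R t) y' / \<bar>det (\<Phi> t)\<bar>" .
  have pZ_T: "pZ E Sg r u T z b = gauss_density z' (R u) 0 / \<bar>det (\<Phi> T)\<bar>"
    if "0 \<le> u" "u < T" "z' = \<Psi> u *v z - \<rho> u - \<beta> b" for u z z'
  proof -
    have "mlin E r z u T = \<Phi> T *v (\<rho> T + \<beta> b + z')"
      using that unfolding that(3) by (intro mlin) auto
    then have "pZ E Sg r u T z b = gauss_density (\<Phi> T *v (\<rho> T + \<beta> b + z'))
        (\<Phi> T ** (R u - R T) ** transpose (\<Phi> T)) (\<Phi> T *v (\<rho> T + \<beta> b + 0))"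
      using that by (simp only: pZ_def kappa_eq less_imp_le order_refl b[symmetric])
    also have "\<dots> = gauss_density z' (R u - R T) 0 / \<bar>det (\<Phi> T)\<bar>"
      using that T_pos R_diff_pos_def[of u T]
      by (subst gauss_density_congruence) (simp_all only: gauss_density_translate less_imp_le order_refl)
    finally show ?thesis
      by (simp add: R_T)
  qed
  have 3: "pZ E Sg r t T y b = gauss_density y' (R t) 0 / \<bar>det (\<Phi> T)\<bar>"
    using assms by (intro pZ_T) (auto simp: y'_def)
  have 4: "pZ E Sg r s T x b = gauss_density x' (R s) 0 / \<bar>det (\<Phi> T)\<bar>"
    using assms by (intro pZ_T) (auto simp: x'_def)
  have "det (\<Phi> T) \<noteq> 0"
    using invertible_\<Phi>[of T] T_pos by (simp add: invertible_det_nz)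
  then show ?thesis
    unfolding 1 2 3 4
    using gauss_density_bayes[of "R t" "R s - R t" x' y'] assms
    by (simp add: R_pos_def R_diff_pos_def S_def \<Lambda>_def)
qed

end

section \<open>Continuity and derivatives of the deterministic data, and their limits at
  \<open>T\<close>\<close>

lemma continuous_on_trace [continuous_intros]:
  "continuous_on S A \<Longrightarrow> continuous_on S (\<lambda>x. trace (A x :: real^'n^'n))"
  unfolding trace_def by (intro continuous_intros)

lemma trace_diff: "trace (A - B) = trace A - trace (B :: real^'n^'n)"
  by (simp add: trace_def sum_subtractf)

context bridge_data
begin

definition H :: "real \<Rightarrow> real^'p^'d" where "H u = matrix_inv (Gam E Sg u T) ** Sg u"
text \<open>The covariance of \<open>J t - J s\<close>, that is, the integral of H H^T over [s,t] in
  closed form; the identification is \<open>C_has_integral\<close>.\<close>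

definition C :: "real \<Rightarrow> real \<Rightarrow> real^'d^'d" where "C s t = transpose (\<Psi> T) ** (\<Lambda> t - \<Lambda> s) ** \<Psi> T"

text \<open>\<open>N t\<close> is the inverse of the covariance matrix \<open>\<Lambda> t - \<Lambda> 0\<close> of the martingale \<open>\<Phi>(T)\<^sup>T J\<close>.\<close>

definition N :: "real \<Rightarrow> real^'d^'d" where "N t = R 0 ** matrix_inv (R 0 - R t) ** R t"

lemma R_eq: "t \<in> {0..T} \<Longrightarrow> R t = R 0 - integral {0..t} K"
  using integral_K[of 0 t] by simp

lemma cont_R: "continuous_on {0..T} R"
proof (rule continuous_on_eq[OF _ R_eq[symmetric]])
  show "continuous_on {0..T} (\<lambda>t. R 0 - integral {0..t} K)"
    by (intro continuous_intros indefinite_integral_continuous_1 K_integrable) simp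
qed

lemma R_derivative:
  assumes "t \<in> {0..T}"
  shows "(R has_vector_derivative - K t) (at t within {0..T})"
proof -
  have "((\<lambda>t. integral {0..t} K) has_vector_derivative K t) (at t within {0..T})"
    by (rule integral_has_vector_derivative[OF continuous_on_subset[OF cont_K] assms]) auto
  from has_vector_derivative_diff[OF has_vector_derivative_const[of "R 0"] this]
  have "((\<lambda>t. R 0 - integral {0..t} K) has_vector_derivative - K t) (at t within {0..T})"
    by simp
  then show ?thesis
    by (rule has_vector_derivative_transform_within[OF _ zero_less_one assms R_eq[symmetric]])
qed

lemma cont_\<Lambda>: "continuous_on {0..<T} \<Lambda>"
  unfolding \<Lambda>_def
  by (intro continuous_on_matrix_inv continuous_on_subset[OF cont_R] pos_def_invertible R_pos_def) auto

lemma cont_Gam_T: "continuous_on {0..T} (\<lambda>t. Gam E Sg t T)"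
proof (rule continuous_on_eq[OF _ Gam_T_eq[symmetric]])
  show "continuous_on {0..T} (\<lambda>t. \<Phi> t ** R t ** transpose (\<Phi> T))"
    by (intro continuous_intros continuous_on_subset[OF cont_\<Phi>] cont_R) auto
qed auto

lemma cont_H: "continuous_on {0..<T} H"
  unfolding H_def
  by (intro continuous_intros continuous_on_matrix_inv continuous_on_subset[OF cont_Gam_T]
      continuous_on_subset[OF cont_Sg] invertible_Gam_T) auto

text \<open>\<open>H u\<close> is the product of transpose (\<Psi> T), \<Lambda> u, \<Psi> u and
  \<open>Sg u\<close>, so H H^T is \<open>\<Lambda> u ** K u ** \<Lambda> u\<close> up to the outer
  factors \<open>\<Psi> T\<close>.\<close>

lemma norm_H:
  assumes "0 \<le> u" "u < T"
  shows "(norm (transpose (H u) *v c))\<^sup>2 = (\<Lambda> u *v (\<Psi> T *v c)) \<bullet> (K u *v (\<Lambda> u *v (\<Psi> T *v c)))"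
proof -
  have "transpose (H u) *v c = transpose (\<Psi> u ** Sg u) *v (\<Lambda> u *v (\<Psi> T *v c))"
    using assms unfolding H_def
    by (simp only: matrix_inv_Gam_T matrix_transpose_mul transpose_transpose \<Lambda>_sym
        matrix_vector_mul_assoc matrix_mul_assoc)
  then have "(norm (transpose (H u) *v c))\<^sup>2 = (\<Lambda> u *v (\<Psi> T *v c)) \<bullet>
      ((\<Psi> u ** Sg u) *v (transpose (\<Psi> u ** Sg u) *v (\<Lambda> u *v (\<Psi> T *v c))))"
    by (simp only: power2_norm_eq_inner inner_transpose_left)
  then show ?thesis
    by (simp only: K_def matrix_vector_mul_assoc matrix_mul_assoc)
qed

text \<open>The derivative of an inverse, \<Lambda>' = \<Lambda> K \<Lambda>, in quadratic form. It
  follows from the resolvent identity \<Lambda> y - \<Lambda> x = - \<Lambda> y (R y - R x)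
  \<Lambda> x, the derivative of \<open>R\<close> and mere continuity of
  \<open>\<Lambda>\<close>.\<close>

lemma \<Lambda>_quadratic_derivative:
  assumes "0 \<le> s" "s \<le> x" "x \<le> t" "t < T"
  shows "((\<lambda>y. w \<bullet> (\<Lambda> y *v w)) has_real_derivative (\<Lambda> x *v w) \<bullet> (K x *v (\<Lambda> x *v w))) (at x within {s..t})"
proof -
  let ?z = "\<Lambda> x *v w"
  have sub: "{s..t} \<subseteq> {0..<T}" "{s..t} \<subseteq> {0..T}"
    using assms by auto
  have R: "((\<lambda>y. (R y *v ?z) $ i) has_real_derivative - (K x *v ?z) $ i) (at x within {s..t})" for i
  proof -
    have "(R has_vector_derivative - K x) (at x within {s..t})"
      using assms sub by (intro has_vector_derivative_within_subset[OF R_derivative]) auto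
    then have "((\<lambda>y. axis i 1 \<bullet> (R y *v ?z)) has_vector_derivative axis i 1 \<bullet> (- K x *v ?z)) (at x within {s..t})"
      by (intro bounded_linear.has_vector_derivative[OF bounded_linear_inner_right]
          bounded_linear.has_vector_derivative[OF bounded_bilinear.bounded_linear_left[OF bounded_bilinear_matrix_vector_mult]])
    then show ?thesis
      using matrix_vector_mult_diff_rdistrib[of 0 "K x" ?z]
      by (simp add: has_real_derivative_iff_has_vector_derivative)
  qed
  have "((\<lambda>y. \<Lambda> y *v w) \<longlongrightarrow> ?z) (at x within {s..t})"
    using continuous_on_subset[OF cont_\<Lambda> sub(1)] assms
    by (intro tendsto_intros) (auto simp: continuous_on_def)
  then have lim: "((\<lambda>y. - (\<Sum>i\<in>UNIV. (\<Lambda> y *v w) $ i * (((R y *v ?z) $ i - (R x *v ?z) $ i) / (y - x))))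
      \<longlongrightarrow> - (\<Sum>i\<in>UNIV. ?z $ i * - (K x *v ?z) $ i)) (at x within {s..t})"
    using R unfolding has_field_derivative_iff
    by (intro tendsto_minus tendsto_sum tendsto_mult tendsto_vec_nth)
  \<comment> \<open>The resolvent identity tested with \<open>w\<close> on both sides and divided by
    y - x; at y = x both sides are 0, since division by 0 gives 0.\<close>
  have eq: "- (\<Sum>i\<in>UNIV. (\<Lambda> y *v w) $ i * (((R y *v ?z) $ i - (R x *v ?z) $ i) / (y - x))) =
      (w \<bullet> (\<Lambda> y *v w) - w \<bullet> (\<Lambda> x *v w)) / (y - x)" if "y \<in> {s..t}" for y
  proof -
    have y: "0 \<le> y" "y < T" "0 \<le> x" "x < T"
      using that assms by auto
    have "(\<Sum>i\<in>UNIV. (\<Lambda> y *v w) $ i * ((R y *v ?z) $ i - (R x *v ?z) $ i)) =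
        (\<Lambda> y *v w) \<bullet> (R y *v ?z) - (\<Lambda> y *v w) \<bullet> (R x *v ?z)"
      by (simp add: inner_vec_def right_diff_distrib sum_subtractf)
    also have "(\<Lambda> y *v w) \<bullet> (R y *v ?z) = w \<bullet> ?z"
      using y inner_matrix_symmetric[OF R_sym, of y "\<Lambda> y *v w" ?z] by (simp add: R\<Lambda>)
    also have "(\<Lambda> y *v w) \<bullet> (R x *v ?z) = w \<bullet> (\<Lambda> y *v w)"
      using y by (simp add: R\<Lambda> inner_commute)
    finally show ?thesis
      by (simp add: sum_divide_distrib[symmetric] minus_divide_left)
  qed
  have "- (\<Sum>i\<in>UNIV. ?z $ i * - (K x *v ?z) $ i) = ?z \<bullet> (K x *v ?z)"
    by (simp add: inner_vec_def sum_negf)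
  then show ?thesis
    using Lim_transform_within[OF lim zero_less_one eq] by (simp only: has_field_derivative_iff)
qed

lemma C_quadratic_form: "c \<bullet> (C s t *v c) = (\<Psi> T *v c) \<bullet> ((\<Lambda> t - \<Lambda> s) *v (\<Psi> T *v c))"
  unfolding C_def matrix_mul_assoc_rev matrix_vector_mul_assoc[symmetric]
  using inner_transpose_left[of "\<Psi> T" "(\<Lambda> t - \<Lambda> s) *v (\<Psi> T *v c)" c] by (simp add: inner_commute)

text \<open>The fundamental theorem of calculus: by \<open>norm_H\<close> the integrand is the
  derivative found in \<open>\<Lambda>_quadratic_derivative\<close> for the vector \<Psi> T
  c.\<close>

lemma C_has_integral:
  assumes "0 \<le> s" "s \<le> t" "t < T"
  shows "((\<lambda>u. (norm (transpose (H u) *v c))\<^sup>2) has_integral c \<bullet> (C s t *v c)) {s..t}"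
proof -
  let ?w = "\<Psi> T *v c"
  have "((\<lambda>x. (\<Lambda> x *v ?w) \<bullet> (K x *v (\<Lambda> x *v ?w))) has_integral ?w \<bullet> (\<Lambda> t *v ?w) - ?w \<bullet> (\<Lambda> s *v ?w)) {s..t}"
    using assms \<Lambda>_quadratic_derivative
    by (intro fundamental_theorem_of_calculus)
      (auto simp: has_real_derivative_iff_has_vector_derivative[symmetric])
  then have "((\<lambda>u. (norm (transpose (H u) *v c))\<^sup>2) has_integral ?w \<bullet> (\<Lambda> t *v ?w) - ?w \<bullet> (\<Lambda> s *v ?w)) {s..t}"
    by (rule has_integral_eq[rotated]) (use assms in \<open>auto simp: norm_H simp del: transpose_matrix_vector\<close>)
  then show ?thesis
    by (simp add: C_quadratic_form matrix_vector_mult_diff_rdistrib inner_diff_right)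
qed

lemma C_same: "C t t = 0"
  by (simp add: C_def)

lemma Gam_C_Gam:
  assumes "0 \<le> s" "s \<le> t" "t < T"
  shows "Gam E Sg t T ** C s t ** transpose (Gam E Sg t T) = bridge_cov E Sg T s t"
  using assms T_pos by (simp add: Gam_T_eq bridge_cov_eq S_eq C_def matrix_transpose_mul R_sym
      matrix_mul_assoc_rev cancel_\<Phi>\<Psi>)

lemma cont_C: "continuous_on {0..<T} (\<lambda>t. C s t)"
  unfolding C_def by (intro continuous_intros cont_\<Lambda>)

lemma cont_\<rho>_T: "continuous_on {0..T} \<rho>"
  unfolding \<rho>_def
  by (intro indefinite_integral_continuous_1 integrable_continuous_interval continuous_intros
      continuous_on_subset[OF cont_\<Psi>] continuous_on_subset[OF cont_r]) auto

lemma at_left_T_eq: "at_left T = at T within {0..<T}"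
proof (rule at_within_nhd[of T "{0<..}"])
  show "{..<T} \<inter> {0<..} - {T} = {0..<T} \<inter> {0<..} - {T}"
    by auto
qed (use T_pos in auto)

lemma tendsto_at_left_T:
  assumes "continuous_on {0..T} f"
  shows "(f \<longlongrightarrow> f T) (at_left T)"
proof -
  have "(f \<longlongrightarrow> f T) (at T within {0..T})"
    using assms T_pos by (auto simp: continuous_on_def)
  then show ?thesis
    unfolding at_left_T_eq by (rule tendsto_within_subset) auto
qed

text \<open>The formula of \<open>bridge_mean_eq\<close> for s = 0, read on the closed interval:
  \<open>\<Lambda>\<close> occurs only at time 0, so nothing is singular at
  \<open>T\<close>.\<close>

definition mean_ext :: "real^'d \<Rightarrow> real^'d \<Rightarrow> real \<Rightarrow> real^'d" where
  "mean_ext a b t = \<Phi> t *v (\<rho> t + \<beta> b + R t *v (\<Lambda> 0 *v (\<Psi> 0 *v a - \<rho> 0 - \<beta> b)))"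

lemma bridge_mean_0_eq: "0 \<le> t \<Longrightarrow> t < T \<Longrightarrow> bridge_mean E Sg r T a b 0 t = mean_ext a b t"
  by (simp add: bridge_mean_eq mean_ext_def)

lemma cont_mean_ext: "continuous_on {0..T} (mean_ext a b)"
  unfolding mean_ext_def
  by (intro continuous_intros cont_\<rho>_T cont_R continuous_on_subset[OF cont_\<Phi>]) auto

lemma mean_ext_T: "mean_ext a b T = b"
  using T_pos by (simp add: mean_ext_def R_T \<beta>_def cancel_\<Phi>\<Psi>)

lemma mean_ext_0: "mean_ext a b 0 = a"
  using T_pos by (simp add: mean_ext_def R\<Lambda> cancel_\<Phi>\<Psi>)

text \<open>\<open>R t ** (\<Lambda> t - \<Lambda> 0)\<close> equals
  \<open>(R 0 - R t) ** \<Lambda> 0\<close>, which the remaining two factors of \<open>N t\<close>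
  undo. Positivity of \<open>t\<close> makes \<open>R 0 - R t\<close> invertible.\<close>

lemma N_inverse:
  assumes "0 < t" "t < T"
  shows "N t ** (\<Lambda> t - \<Lambda> 0) = mat 1" "(\<Lambda> t - \<Lambda> 0) ** N t = mat 1"
proof -
  have inv: "matrix_inv (R 0 - R t) ** (R 0 - R t) = mat 1"
    using assms by (intro matrix_inv_left pos_def_invertible R_diff_pos_def) auto
  have "R t ** (\<Lambda> t - \<Lambda> 0) = (R 0 - R t) ** \<Lambda> 0"
    using assms T_pos by (simp add: matrix_diff_ldistrib matrix_diff_rdistrib R\<Lambda>)
  then have "N t ** (\<Lambda> t - \<Lambda> 0) = R 0 ** (matrix_inv (R 0 - R t) ** ((R 0 - R t) ** \<Lambda> 0))"
    by (simp add: N_def matrix_mul_assoc_rev)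
  also have "\<dots> = mat 1"
    using T_pos by (simp only: matrix_mul_cancel[OF inv]) (simp add: R\<Lambda>)
  finally show "N t ** (\<Lambda> t - \<Lambda> 0) = mat 1" .
  then show "(\<Lambda> t - \<Lambda> 0) ** N t = mat 1"
    using matrix_left_right_inverse by blast
qed

lemma N_sym:
  assumes "0 < t" "t < T"
  shows "transpose (N t) = N t"
proof -
  have "matrix_inv (\<Lambda> t - \<Lambda> 0) = N t"
    by (rule matrix_inv_unique) (rule N_inverse(2)[OF assms])
  moreover have "invertible (\<Lambda> t - \<Lambda> 0)"
    using N_inverse(2)[OF assms] invertible_right_inverse by blast
  moreover have "transpose (\<Lambda> t - \<Lambda> 0) = \<Lambda> t - \<Lambda> 0"
    using assms by (simp add: transpose_diff \<Lambda>_sym)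
  ultimately show ?thesis
    using matrix_inv_transpose by metis
qed

text \<open>\<open>N\<close> is defined by a formula in \<open>R\<close> alone, free of
  \<open>\<Lambda> t\<close>; this is why it stays continuous up to \<open>T\<close>, with value 0
  there.\<close>

lemma cont_N: "continuous_on {0<..T} N"
  unfolding N_def
  by (intro continuous_intros continuous_on_matrix_inv continuous_on_subset[OF cont_R]
      pos_def_invertible R_diff_pos_def) auto

lemma N_T: "N T = 0"
  by (simp add: N_def R_T)

end

section \<open>Riemann sums\<close>

text \<open>\<open>Suc n\<close> cells, so that the mesh is meaningful for every
  \<open>n\<close>.\<close>

definition grid :: "real \<Rightarrow> nat \<Rightarrow> nat \<Rightarrow> real" where
  "grid t n j = t * real j / real (Suc n)"

lemma grid_0 [simp]: "grid t n 0 = 0"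
  and grid_end [simp]: "grid t n (Suc n) = t"
  by (simp_all add: grid_def)

lemma grid_mono: "0 \<le> t \<Longrightarrow> i \<le> j \<Longrightarrow> grid t n i \<le> grid t n j"
  unfolding grid_def by (intro divide_right_mono mult_left_mono) auto

lemma grid_bounds:
  assumes "0 \<le> t" "j \<le> Suc n"
  shows "0 \<le> grid t n j" "grid t n j \<le> t"
  using grid_mono[OF assms(1), of 0 j n] grid_mono[OF assms, of n] by auto

lemma grid_cell:
  assumes "0 < u" "u \<le> t"
  obtains j where "j < Suc n" "grid t n j < u" "u \<le> grid t n (Suc j)"
proof -
  define j where "j = (LEAST j. u \<le> grid t n j)"
  have ex: "u \<le> grid t n (Suc n)"
    using assms by simp
  have u: "u \<le> grid t n j"
    unfolding j_def using ex by (rule LeastI)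
  have le: "j \<le> Suc n"
    unfolding j_def using ex by (rule Least_le)
  have "j \<noteq> 0"
    using u assms by (metis grid_0 not_le)
  then obtain k where k: "j = Suc k"
    using not0_implies_Suc by blast
  then have "\<not> u \<le> grid t n k"
    unfolding j_def using not_less_Least[of k "\<lambda>j. u \<le> grid t n j"] by (metis lessI)
  with that[of k] u le k show ?thesis
    by auto
qed

lemma grid_uniform:
  fixes g :: "real \<Rightarrow> 'b::metric_space"
  assumes t: "0 \<le> t" and g: "continuous_on {0..t} g" and e: "0 < e"
  shows "\<forall>\<^sub>F n in sequentially. \<forall>j<Suc n. \<forall>u\<in>{grid t n j..grid t n (Suc j)}. dist (g u) (g (grid t n j)) \<le> e"
proof -
  have "uniformly_continuous_on {0..t} g"
    by (intro compact_uniformly_continuous g compact_Icc)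
  then obtain d where d: "0 < d"
    "\<And>u v. u \<in> {0..t} \<Longrightarrow> v \<in> {0..t} \<Longrightarrow> dist v u < d \<Longrightarrow> dist (g v) (g u) < e"
    unfolding uniformly_continuous_on_def using e by metis
  have "(\<lambda>n. t * inverse (real (Suc n))) \<longlonglongrightarrow> t * 0"
    by (intro tendsto_intros LIMSEQ_inverse_real_of_nat)
  then have "\<forall>\<^sub>F n in sequentially. t * inverse (real (Suc n)) < d"
    using d(1) by (intro order_tendstoD(2)) auto
  then show ?thesis
  proof eventually_elim
    case (elim n)
    show ?case
    proof (intro allI impI ballI)
      fix j u assume j: "j < Suc n" and u: "u \<in> {grid t n j..grid t n (Suc j)}"
      have "grid t n (Suc j) - grid t n j = t * inverse (real (Suc n))"
        unfolding grid_def diff_divide_distrib[symmetric] right_diff_distrib[symmetric]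
        by (simp add: divide_inverse)
      then have "dist u (grid t n j) < d"
        using u elim by (auto simp: dist_real_def)
      then have "dist (g u) (g (grid t n j)) < e"
        using u j grid_bounds[OF t, of j n] grid_bounds[OF t, of "Suc j" n] by (intro d(2)) auto
      then show "dist (g u) (g (grid t n j)) \<le> e"
        by simp
    qed
  qed
qed

text \<open>The shape is dictated by \<open>simple_integral_grid\<close>: the grid divides [0,t],
  the integrand is sampled at left grid points, and cells are cut at \<open>s\<close> by
  \<open>max s\<close>. Partial sums are compared, by induction, with integrals up to the cut grid
  points.\<close>

lemma riemann_sum_tendsto:
  fixes g :: "real \<Rightarrow> real"
  assumes s: "0 \<le> s" "s \<le> t" and g: "continuous_on {0..t} g"
  shows "(\<lambda>n. \<Sum>j<Suc n. g (grid t n j) * (max s (grid t n (Suc j)) - max s (grid t n j))) \<longlonglongrightarrow> integral {s..t} g"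
proof (rule tendstoI)
  fix e :: real assume "0 < e"
  \<comment> \<open>Adding 1 covers t = 0, and the factor 2 makes the final estimate strict.\<close>
  define e' where "e' = e / (2 * (t + 1))"
  have e': "0 < e'" "e' * (t - s) < e"
  proof -
    show "0 < e'"
      using \<open>0 < e\<close> s by (simp add: e'_def)
    have "e' * (t - s) \<le> e' * (t + 1)"
      using \<open>0 < e'\<close> s by (intro mult_left_mono) auto
    also have "\<dots> < e"
      using \<open>0 < e\<close> s by (simp add: e'_def field_simps add_pos_nonneg)
    finally show "e' * (t - s) < e" .
  qed
  have t: "0 \<le> t"
    using s by simp
  show "\<forall>\<^sub>F n in sequentially. dist (\<Sum>j<Suc n. g (grid t n j) * (max s (grid t n (Suc j)) - max s (grid t n j))) (integral {s..t} g) < e"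
    using grid_uniform[OF t g e'(1)]
  proof eventually_elim
    case (elim n)
    let ?\<sigma> = "\<lambda>j. max s (grid t n j)"
    have "\<bar>(\<Sum>j<k. g (grid t n j) * (?\<sigma> (Suc j) - ?\<sigma> j)) - integral {s..?\<sigma> k} g\<bar> \<le> e' * (?\<sigma> k - s)"
      if "k \<le> Suc n" for k
      using that
    proof (induction k)
      case 0
      then show ?case using s by simp
    next
      case (Suc k)
      have b: "grid t n (Suc k) \<le> t" "0 \<le> grid t n k"
        using grid_bounds[OF t] Suc.prems by auto
      have mono: "?\<sigma> k \<le> ?\<sigma> (Suc k)"
        using grid_mono[OF t, of k "Suc k" n] by auto
      have cont: "continuous_on {?\<sigma> k..?\<sigma> (Suc k)} g"
        using s b by (intro continuous_on_subset[OF g]) auto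
      have "g integrable_on {s..?\<sigma> (Suc k)}"
        using s b by (intro integrable_continuous_interval continuous_on_subset[OF g]) auto
      then have comb: "integral {s..?\<sigma> k} g + integral {?\<sigma> k..?\<sigma> (Suc k)} g = integral {s..?\<sigma> (Suc k)} g"
        using mono by (intro Henstock_Kurzweil_Integration.integral_combine) auto
      have "\<bar>integral {?\<sigma> k..?\<sigma> (Suc k)} (\<lambda>u. g (grid t n k) - g u)\<bar> \<le> e' * (?\<sigma> (Suc k) - ?\<sigma> k)"
      \<comment> \<open>A cell before \<open>s\<close> has no width after cutting and contributes
        nothing; in the other case the cut cell lies inside the original one, where the uniform
        estimate holds.\<close>
      proof (cases "?\<sigma> k = ?\<sigma> (Suc k)")
        case False
        have "\<bar>g (grid t n k) - g u\<bar> \<le> e'" if "u \<in> {?\<sigma> k..?\<sigma> (Suc k)}" for u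
        proof -
          have "u \<in> {grid t n k..grid t n (Suc k)}"
            using that False by (auto simp: max_def split: if_splits)
          then show ?thesis
            using elim Suc.prems by (auto simp: dist_real_def abs_minus_commute)
        qed
        then have "norm (integral {?\<sigma> k..?\<sigma> (Suc k)} (\<lambda>u. g (grid t n k) - g u)) \<le> e' * (?\<sigma> (Suc k) - ?\<sigma> k)"
          by (intro integral_bound mono continuous_intros cont) (simp only: real_norm_def)
        then show ?thesis
          by (simp only: real_norm_def)
      qed simp
      moreover have "integral {?\<sigma> k..?\<sigma> (Suc k)} (\<lambda>u. g (grid t n k) - g u) =
          g (grid t n k) * (?\<sigma> (Suc k) - ?\<sigma> k) - integral {?\<sigma> k..?\<sigma> (Suc k)} g"
        using mono integrable_continuous_interval[OF cont]
        by (subst Henstock_Kurzweil_Integration.integral_diff) auto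
      moreover have "\<bar>(\<Sum>j<k. g (grid t n j) * (?\<sigma> (Suc j) - ?\<sigma> j)) - integral {s..?\<sigma> k} g\<bar> \<le> e' * (?\<sigma> k - s)"
        using Suc by simp
      ultimately show ?case
        unfolding comb[symmetric] sum.lessThan_Suc right_diff_distrib by linarith
    qed
    from this[of "Suc n"] have "\<bar>(\<Sum>j<Suc n. g (grid t n j) * (?\<sigma> (Suc j) - ?\<sigma> j)) - integral {s..t} g\<bar> \<le> e' * (t - s)"
      using s by (simp add: max_absorb2)
    with e'(2) show ?case
      by (simp add: dist_real_def)
  qed
qed

lemma ennreal_tendsto_0I:
  fixes f :: "'b \<Rightarrow> ennreal"
  assumes "\<And>e. 0 < e \<Longrightarrow> \<forall>\<^sub>F x in G. f x \<le> ennreal e"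
  shows "(f \<longlongrightarrow> 0) G"
proof (rule order_tendstoI)
  fix a :: ennreal assume "0 < a"
  then obtain x where x: "0 < x" "x < a"
    using dense by blast
  then have top: "x < top"
    by (meson less_le_trans top_greatest)
  then have "x = ennreal (enn2real x)"
    by simp
  moreover have "0 < enn2real x"
    using x top by (simp add: enn2real_positive_iff)
  ultimately have "\<forall>\<^sub>F y in G. f y \<le> x"
    using assms[of "enn2real x"] by simp
  then show "\<forall>\<^sub>F y in G. f y < a"
    by eventually_elim (use x in auto)
qed auto

section \<open>Wiener integrals of continuous functions\<close>

text \<open>Independence passes to the smaller sigma-algebras generated by \<open>Z\<close> and by
  \<open>g\<close> of \<open>Y\<close>; boundedness by 1 supplies the integrability for the product
  rule.\<close>

lemma (in prob_space) indep_set_expectation: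
  fixes Z :: "'a \<Rightarrow> complex" and Y :: "'a \<Rightarrow> 'b::{second_countable_topology, t2_space}"
  assumes G: "subalgebra M G"
    and indep: "indep_set (sets G) (sets (vimage_algebra (space M) Y borel))"
    and Z: "Z \<in> borel_measurable G" "\<And>\<omega>. \<omega> \<in> space M \<Longrightarrow> norm (Z \<omega>) \<le> 1"
    and Y: "Y \<in> borel_measurable M"
    and g: "g \<in> borel_measurable borel" "\<And>y. norm (g y :: complex) \<le> 1"
  shows "expectation (\<lambda>\<omega>. Z \<omega> * g (Y \<omega>)) = expectation Z * expectation (\<lambda>\<omega>. g (Y \<omega>))"
proof -
  have ZM [measurable]: "Z \<in> borel_measurable M"
    using measurable_from_subalg[OF G] Z(1) by blast
  note [measurable] = Y g(1)
  have spG: "space G = space M"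
    using G by (simp add: subalgebra_def)
  have 1: "sigma_sets (space M) {Z -` A \<inter> space M |A. A \<in> sets borel} \<subseteq> sets G"
    using Z(1) by (subst spG[symmetric], intro sets.sigma_sets_subset)
      (auto simp: spG intro: measurable_sets[of Z G borel, unfolded spG])
  have "(\<lambda>\<omega>. g (Y \<omega>)) -` A \<inter> space M \<in> sets (vimage_algebra (space M) Y borel)" if "A \<in> sets borel" for A
  proof -
    have "g -` A \<in> sets borel"
      using measurable_sets[OF g(1) that] by simp
    then have "Y -` (g -` A) \<inter> space M \<in> sets (vimage_algebra (space M) Y borel)"
      by (rule in_vimage_algebra)
    then show ?thesis
      by (simp add: vimage_comp comp_def)
  qed
  then have 2: "sigma_sets (space M) {(\<lambda>\<omega>. g (Y \<omega>)) -` A \<inter> space M |A. A \<in> sets borel}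
      \<subseteq> sets (vimage_algebra (space M) Y borel)"
    using sets.sigma_sets_subset[of "{(\<lambda>\<omega>. g (Y \<omega>)) -` A \<inter> space M |A. A \<in> sets borel}" "vimage_algebra (space M) Y borel"]
    by auto
  have "indep_set (sigma_sets (space M) {Z -` A \<inter> space M |A. A \<in> sets borel})
      (sigma_sets (space M) {(\<lambda>\<omega>. g (Y \<omega>)) -` A \<inter> space M |A. A \<in> sets borel})"
    using indep unfolding indep_set_def
    by (rule indep_sets_mono_sets) (use 1 2 in \<open>auto split: bool.split\<close>)
  then have "indep_var borel Z borel (\<lambda>\<omega>. g (Y \<omega>))"
    unfolding indep_var_eq by simp
  moreover have "integrable M Z" "integrable M (\<lambda>\<omega>. g (Y \<omega>))"
    using Z(2) g(2) by (auto intro!: integrable_const_bound[where B=1])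
  ultimately show ?thesis
    by (rule indep_var_lebesgue_integral)
qed

locale wiener_space =
  fixes M :: "'a measure" and F :: "real \<Rightarrow> 'a measure" and B :: "real \<Rightarrow> 'a \<Rightarrow> real^'p"
  assumes filtered: "usual_filtered_space M F" and wiener: "wiener_process M F B"
begin

sublocale prob_space M
  using filtered unfolding usual_filtered_space_def by (elim conjE)

lemma subalgebra_F: "0 \<le> t \<Longrightarrow> subalgebra M (F t)"
  using filtered[unfolded usual_filtered_space_def, THEN conjunct2, THEN conjunct2, THEN conjunct1]
  by blast

lemma space_F: "0 \<le> t \<Longrightarrow> space (F t) = space M"
  using subalgebra_F by (simp add: subalgebra_def)

lemma sets_F_mono: "0 \<le> s \<Longrightarrow> s \<le> t \<Longrightarrow> sets (F s) \<subseteq> sets (F t)"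
  using filtered[unfolded usual_filtered_space_def, THEN conjunct2, THEN conjunct2, THEN conjunct2, THEN conjunct1]
  by blast

lemma measurable_F_mono:
  assumes "f \<in> measurable (F s) N" "0 \<le> s" "s \<le> t"
  shows "f \<in> measurable (F t) N"
proof -
  have "subalgebra (F t) (F s)"
    using assms(2,3) space_F[of s] space_F[of t] sets_F_mono[of s t] by (simp add: subalgebra_def)
  then show ?thesis
    by (rule measurable_from_subalg) (rule assms(1))
qed

lemma measurable_F: "f \<in> measurable (F s) N \<Longrightarrow> 0 \<le> s \<Longrightarrow> f \<in> measurable M N"
  by (rule measurable_from_subalg[OF subalgebra_F])

lemma B_measurable: "0 \<le> s \<Longrightarrow> s \<le> t \<Longrightarrow> B s \<in> borel_measurable (F t)"
  by (rule measurable_F_mono[of _ s]) (use wiener in \<open>unfold wiener_process_def, blast\<close>, simp_all)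

text \<open>The conditional characteristic function of a Wiener increment, expressed without
  conditional expectations: \<open>Z\<close> ranges over bounded test variables known at time
  \<open>x\<close>.\<close>

lemma char_increment:
  assumes "0 \<le> x" "x \<le> y" and Z: "Z \<in> borel_measurable (F x)" "\<And>\<omega>. \<omega> \<in> space M \<Longrightarrow> norm (Z \<omega> :: complex) \<le> 1"
  shows "expectation (\<lambda>\<omega>. Z \<omega> * iexp (v \<bullet> (B y \<omega> - B x \<omega>))) =
    expectation Z * exp (- ((norm v)\<^sup>2 * (y - x)) / 2)"
proof -
  have w: "indep_set (sets (F x)) (sets (vimage_algebra (space M) (\<lambda>\<omega>. B y \<omega> - B x \<omega>) borel))"
    "gauss_with M (\<lambda>\<omega>. B y \<omega> - B x \<omega>) 0 ((y - x) *\<^sub>R mat 1)"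
    using wiener assms(1,2) unfolding wiener_process_def by blast+
  have "normal_char M (\<lambda>\<omega>. v \<bullet> (B y \<omega> - B x \<omega>)) (v \<bullet> 0) (v \<bullet> (((y - x) *\<^sub>R mat 1) *v v))"
    using gauss_char_if_gauss_with[OF w(2)] by (simp add: gauss_char_def)
  from normal_charD(3)[OF this, of 1]
  have "expectation (\<lambda>\<omega>. iexp (v \<bullet> (B y \<omega> - B x \<omega>))) = exp (- ((norm v)\<^sup>2 * (y - x)) / 2)"
    by (simp add: scaleR_matrix_vector_assoc[symmetric] power2_norm_eq_inner mult.commute)
  moreover have "expectation (\<lambda>\<omega>. Z \<omega> * iexp (v \<bullet> (B y \<omega> - B x \<omega>))) =
      expectation Z * expectation (\<lambda>\<omega>. iexp (v \<bullet> (B y \<omega> - B x \<omega>)))"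
    using assms B_measurable
    by (intro indep_set_expectation[OF subalgebra_F w(1), where g="\<lambda>y. iexp (v \<bullet> y)"])
      (auto intro!: borel_measurable_diff measurable_F[of _ y])
  ultimately show ?thesis
    by simp
qed

text \<open>Induction peels off the last increment; the exponentials of the earlier ones are
  absorbed into the test variable, which stays bounded by 1 and is known at the last grid
  time.\<close>

lemma char_simple_increments:
  assumes \<sigma>: "0 \<le> \<sigma> 0" "\<And>j. j < n \<Longrightarrow> \<sigma> j \<le> \<sigma> (Suc j)"
    and Z: "Z \<in> borel_measurable (F (\<sigma> 0))" "\<And>\<omega>. \<omega> \<in> space M \<Longrightarrow> norm (Z \<omega> :: complex) \<le> 1"
  shows "expectation (\<lambda>\<omega>. Z \<omega> * iexp (\<Sum>j<n. v j \<bullet> (B (\<sigma> (Suc j)) \<omega> - B (\<sigma> j) \<omega>))) =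
    expectation Z * exp (- (\<Sum>j<n. (norm (v j))\<^sup>2 * (\<sigma> (Suc j) - \<sigma> j)) / 2)"
  using \<sigma>(2)
proof (induction n)
  case (Suc n)
  have mono: "\<sigma> i \<le> \<sigma> j" if "i \<le> j" "j \<le> n" for i j
    using that
  proof (induction j rule: dec_induct)
    case (step k)
    then show ?case
      using Suc.prems[of k] by auto
  qed simp
  have pos: "0 \<le> \<sigma> j" if "j \<le> n" for j
    using mono[of 0 j] \<sigma>(1) that by simp
  let ?Z = "\<lambda>\<omega>. Z \<omega> * iexp (\<Sum>j<n. v j \<bullet> (B (\<sigma> (Suc j)) \<omega> - B (\<sigma> j) \<omega>))"
  have [measurable]: "B (\<sigma> j) \<in> borel_measurable (F (\<sigma> n))" if "j \<le> n" for j
    using that by (intro B_measurable pos mono) auto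
  have "Z \<in> borel_measurable (F (\<sigma> n))"
    using \<sigma>(1) mono[of 0 n] by (intro measurable_F_mono[OF Z(1)]) auto
  then have meas: "?Z \<in> borel_measurable (F (\<sigma> n))"
    by simp
  have "expectation (\<lambda>\<omega>. Z \<omega> * iexp (\<Sum>j<Suc n. v j \<bullet> (B (\<sigma> (Suc j)) \<omega> - B (\<sigma> j) \<omega>))) =
      expectation (\<lambda>\<omega>. ?Z \<omega> * iexp (v n \<bullet> (B (\<sigma> (Suc n)) \<omega> - B (\<sigma> n) \<omega>)))"
    by (simp add: exp_add distrib_left mult.assoc)
  also have "\<dots> = expectation ?Z * exp (- ((norm (v n))\<^sup>2 * (\<sigma> (Suc n) - \<sigma> n)) / 2)"
    using Z(2) by (intro char_increment pos meas) (auto simp: norm_mult Suc.prems)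
  also have "expectation ?Z = expectation Z * exp (- (\<Sum>j<n. (norm (v j))\<^sup>2 * (\<sigma> (Suc j) - \<sigma> j)) / 2)"
    using Suc by simp
  finally show ?case
    by (simp add: mult_exp_exp add_divide_distrib diff_divide_distrib flip: of_real_mult of_real_add)
qed simp


text \<open>All grid points are at most \<open>t\<close>, so the part of a Wiener increment that is
  seen at \<open>t\<close> but not yet at \<open>s\<close> is the increment between the end points
  raised to \<open>s\<close>.\<close>

lemma simple_integral_grid:
  assumes "0 \<le> s" "s \<le> t"
  shows "c \<bullet> (simple_integral B (Suc n) (grid t n) (\<lambda>j _. H (grid t n j)) t \<omega> -
      simple_integral B (Suc n) (grid t n) (\<lambda>j _. H (grid t n j)) s \<omega>) =
    (\<Sum>j<Suc n. (transpose (H (grid t n j)) *v c) \<bullet>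
      (B (max s (grid t n (Suc j))) \<omega> - B (max s (grid t n j)) \<omega>))"
proof -
  have "B (min t x) \<omega> - B (min t y) \<omega> - (B (min s x) \<omega> - B (min s y) \<omega>) = B (max s x) \<omega> - B (max s y) \<omega>"
    if "x \<le> t" "y \<le> t" for x y
    using that by (auto simp: min_def max_def)
  moreover have "grid t n j \<le> t" if "j \<le> Suc n" for j
    using grid_bounds that assms by auto
  ultimately show ?thesis
    unfolding simple_integral_def sum_subtractf[symmetric] matrix_vector_mult_diff_distrib[symmetric]
      inner_sum_right inner_transpose_left
    by (intro sum.cong) auto
qed

text \<open>The half-open cells cover every point except 0 exactly once, so the sum defining the
  step function has a single nonzero term.\<close>

lemma simple_value_grid:
  assumes u: "0 < u" "u \<le> t" and
    close: "\<And>j u. j < Suc n \<Longrightarrow> u \<in> {grid t n j..grid t n (Suc j)} \<Longrightarrow> dist (H u) (H (grid t n j)) \<le> e"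
  shows "norm (H u - simple_value (Suc n) (grid t n) (\<lambda>j _. H (grid t n j)) u \<omega>) \<le> e"
proof -
  obtain j where j: "j < Suc n" "grid t n j < u" "u \<le> grid t n (Suc j)"
    using u by (rule grid_cell)
  have "indicator {grid t n i<..grid t n (Suc i)} u = (of_bool (i = j) :: real)" for i
  proof -
    have "i = j" if i: "grid t n i < u" "u \<le> grid t n (Suc i)"
    proof (rule ccontr)
      assume "i \<noteq> j"
      then consider "Suc i \<le> j" | "Suc j \<le> i"
        by linarith
      then show False
        using grid_mono[of t "Suc i" j n] grid_mono[of t "Suc j" i n] i j u by cases auto
    qed
    then have "u \<in> {grid t n i<..grid t n (Suc i)} \<longleftrightarrow> i = j"
      using j(2,3) by (metis greaterThanAtMost_iff)
    then show ?thesis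
      by (simp only: indicator_def)
  qed
  then have "simple_value (Suc n) (grid t n) (\<lambda>j _. H (grid t n j)) u \<omega> =
      (\<Sum>i<Suc n. of_bool (i = j) *\<^sub>R H (grid t n i))"
    unfolding simple_value_def by (simp only:)
  also have "\<dots> = (\<Sum>i<Suc n. if j = i then H (grid t n i) else 0)"
    by (intro sum.cong) auto
  also have "\<dots> = H (grid t n j)"
    using j(1) by simp
  finally have "simple_value (Suc n) (grid t n) (\<lambda>j _. H (grid t n j)) u \<omega> = H (grid t n j)" .
  then show ?thesis
    using close[OF j(1), of u] j by (simp add: dist_norm)
qed

text \<open>Uniform continuity bounds the error on (0,t]; the point 0 lies in no cell but is a null
  set. The grid may reach beyond the time \<open>t'\<close>, so that one grid serves two
  times.\<close>

lemma simple_approximation: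
  fixes H :: "real \<Rightarrow> real^'p^'d"
  assumes t: "0 \<le> t" "t' \<le> t" and H: "continuous_on {0..t} H"
  shows "(\<lambda>n. \<integral>\<^sup>+\<omega>. (\<integral>\<^sup>+u\<in>{0..t'}. ennreal ((norm (H u -
      simple_value (Suc n) (grid t n) (\<lambda>j _. H (grid t n j)) u \<omega>))\<^sup>2) \<partial>lborel) \<partial>M) \<longlonglongrightarrow> 0"
proof (rule ennreal_tendsto_0I)
  fix e :: real assume "0 < e"
  define d where "d = sqrt (e / (t + 1))"
  have d: "0 < d" "d\<^sup>2 * t \<le> e"
  proof -
    show "0 < d"
      using \<open>0 < e\<close> t by (simp add: d_def)
    have "d\<^sup>2 * t = e * (t / (t + 1))"
      using \<open>0 < e\<close> t by (simp add: d_def)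
    also have "\<dots> \<le> e * 1"
      using \<open>0 < e\<close> t by (intro mult_left_mono) auto
    finally show "d\<^sup>2 * t \<le> e" by simp
  qed
  show "\<forall>\<^sub>F n in sequentially. (\<integral>\<^sup>+\<omega>. (\<integral>\<^sup>+u\<in>{0..t'}. ennreal ((norm (H u -
      simple_value (Suc n) (grid t n) (\<lambda>j _. H (grid t n j)) u \<omega>))\<^sup>2) \<partial>lborel) \<partial>M) \<le> ennreal e"
    using grid_uniform[OF t(1) H d(1)]
  proof eventually_elim
    case (elim n)
    let ?v = "\<lambda>u \<omega>. simple_value (Suc n) (grid t n) (\<lambda>j _. H (grid t n j)) u \<omega>"
    have "(\<integral>\<^sup>+u\<in>{0..t'}. ennreal ((norm (H u - ?v u \<omega>))\<^sup>2) \<partial>lborel) \<le> ennreal e" for \<omega>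
    proof -
      have "(\<integral>\<^sup>+u\<in>{0..t'}. ennreal ((norm (H u - ?v u \<omega>))\<^sup>2) \<partial>lborel) \<le>
          (\<integral>\<^sup>+u. ennreal (d\<^sup>2) * indicator {0..t} u \<partial>lborel)"
      proof (rule nn_integral_mono_AE)
        show "AE u in lborel. ennreal ((norm (H u - ?v u \<omega>))\<^sup>2) * indicator {0..t'} u \<le> ennreal (d\<^sup>2) * indicator {0..t} u"
          using AE_lborel_singleton[of 0]
        proof eventually_elim
          case (elim u)
          show ?case
          proof (cases "u \<in> {0..t'}")
            case True
            then have "norm (H u - ?v u \<omega>) \<le> d"
              using elim t \<open>\<forall>j<Suc n. _\<close> by (intro simple_value_grid[of u t]) auto
            then have "(norm (H u - ?v u \<omega>))\<^sup>2 \<le> d\<^sup>2"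
              by (intro power_mono) auto
            then show ?thesis
              using True t by (auto intro!: ennreal_leI)
          qed simp
        qed
      qed
      also have "\<dots> = ennreal (d\<^sup>2 * t)"
        using t by (simp add: nn_integral_cmult ennreal_mult)
      also have "\<dots> \<le> ennreal e"
        using d(2) by (rule ennreal_leI)
      finally show ?thesis .
    qed
    then have "(\<integral>\<^sup>+\<omega>. (\<integral>\<^sup>+u\<in>{0..t'}. ennreal ((norm (H u - ?v u \<omega>))\<^sup>2) \<partial>lborel) \<partial>M) \<le> (\<integral>\<^sup>+\<omega>. ennreal e \<partial>M)"
      by (intro nn_integral_mono)
    then show ?case
      by (simp add: emeasure_space_1)
  qed
qed

text \<open>The grid of [0,t] is used at the earlier time \<open>s\<close> too: \<open>J s\<close>
  and \<open>J t\<close> become limits along the same simple integrands, and so does their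
  difference.\<close>

lemma ito_integral_approximation:
  fixes H :: "real \<Rightarrow> real^'p^'d"
  assumes ito: "ito_integral M F B T (\<lambda>u _. H u) J"
    and t: "0 \<le> s" "s \<le> t" "t < T" and H: "continuous_on {0..t} H"
  shows "(\<lambda>n. \<integral>\<^sup>+\<omega>. ennreal ((norm (J s \<omega> -
      simple_integral B (Suc n) (grid t n) (\<lambda>j _. H (grid t n j)) s \<omega>))\<^sup>2) \<partial>M) \<longlonglongrightarrow> 0"
proof -
  have 1: "\<forall>k. simple_integrand M F (Suc k) (grid t k) (\<lambda>j _. H (grid t k j))"
    using t grid_mono[of t] by (auto simp: simple_integrand_def image_constant_conv)
  have 2: "s \<in> {0..<T}"
    using t by simp
  have 3: "(\<lambda>n. \<integral>\<^sup>+\<omega>. (\<integral>\<^sup>+u\<in>{0..s}. ennreal ((norm (H u -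
      simple_value (Suc n) (grid t n) (\<lambda>j _. H (grid t n j)) u \<omega>))\<^sup>2) \<partial>lborel) \<partial>M) \<longlonglongrightarrow> 0"
    using t H by (intro simple_approximation) auto
  show ?thesis
    using ito[unfolded ito_integral_def, THEN conjunct2, THEN conjunct2, THEN conjunct2,
        THEN bspec, OF 2, THEN spec, THEN spec, THEN spec, THEN mp, OF 1, THEN mp, OF 3] .
qed

lemma norm_iexp_diff_le: "norm (iexp x - iexp y) \<le> \<bar>x - y\<bar>"
proof -
  have "iexp x - iexp y = iexp y * (iexp (x - y) - 1)"
    by (simp add: algebra_simps flip: exp_add)
  then have "norm (iexp x - iexp y) = norm (iexp (x - y) - 1)"
    by (simp add: norm_mult)
  also have "\<dots> \<le> \<bar>x - y\<bar>"
    using iexp_approx1[of "x - y" 0] by simp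
  finally show ?thesis .
qed

text \<open>For the grid integrands the formula is exact. The left side passes to the limit because
  the Lipschitz bound \<open>norm_iexp_diff_le\<close> turns mean square convergence into
  convergence of expectations, with \<open>Z\<close> fixed throughout; the exponents on the right
  are the Riemann sums.\<close>

theorem char_wiener_integral_increment:
  fixes H :: "real \<Rightarrow> real^'p^'d"
  assumes ito: "ito_integral M F B T (\<lambda>u _. H u) J"
    and t: "0 \<le> s" "s \<le> t" "t < T" and H: "continuous_on {0..<T} H"
    and Z: "Z \<in> borel_measurable (F s)" "\<And>\<omega>. \<omega> \<in> space M \<Longrightarrow> norm (Z \<omega> :: complex) \<le> 1"
  shows "expectation (\<lambda>\<omega>. Z \<omega> * iexp (c \<bullet> (J t \<omega> - J s \<omega>))) =
    expectation Z * exp (- (integral {s..t} (\<lambda>u. (norm (transpose (H u) *v c))\<^sup>2)) / 2)"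
proof -
  have Ht: "continuous_on {0..t} H"
    using t by (intro continuous_on_subset[OF H]) auto
  define I where "I n x = simple_integral B (Suc n) (grid t n) (\<lambda>j _. H (grid t n j)) x" for n x
  have J: "J x \<in> borel_measurable M" if "0 \<le> x" "x < T" for x
    using ito that measurable_F[of "J x" x] by (auto simp: ito_integral_def)
  have I: "I n x \<in> borel_measurable M" if "0 \<le> x" for n x
  proof -
    have [measurable]: "B y \<in> borel_measurable M" if "0 \<le> y" for y
      using B_measurable[of y y] that by (intro measurable_F[of _ y]) auto
    show ?thesis
      unfolding I_def simple_integral_def
      using that t grid_mono[of t 0] 
      by (intro borel_measurable_sum measurable_compose[OF borel_measurable_diff measurable_matrix_vector_mult])
        (auto intro!: \<open>\<And>y. 0 \<le> y \<Longrightarrow> B y \<in> borel_measurable M\<close>)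
  qed
  note [measurable] = J[OF t(1) le_less_trans[OF t(2,3)]] J[OF order_trans[OF t(1,2)] t(3)]
    I[OF t(1)] I[OF order_trans[OF t(1,2)]] measurable_F[OF Z(1) t(1)]
  have lim: "(\<lambda>n. \<integral>\<^sup>+\<omega>. ennreal ((norm (J x \<omega> - I n x \<omega>))\<^sup>2) \<partial>M) \<longlonglongrightarrow> 0" if "x = s \<or> x = t" for x
    unfolding I_def using that t by (intro ito_integral_approximation[OF ito _ _ t(3) Ht]) auto
  let ?q = "\<lambda>u. (norm (transpose (H u) *v c))\<^sup>2"
  let ?L = "\<lambda>n. expectation (\<lambda>\<omega>. Z \<omega> * iexp (c \<bullet> (I n t \<omega> - I n s \<omega>)))"
  let ?E = "expectation (\<lambda>\<omega>. Z \<omega> * iexp (c \<bullet> (J t \<omega> - J s \<omega>)))"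
  have int: "integrable M (\<lambda>\<omega>. Z \<omega> * iexp (f \<omega>))" if [measurable]: "f \<in> borel_measurable M" for f
    using Z(2) by (intro integrable_const_bound[where B=1]) (auto simp: norm_mult)
  have mono: "max s (grid t n j) \<le> max s (grid t n (Suc j))" for j n
    using grid_mono[of t j "Suc j" n] t by auto
  have L_eq: "?L n = expectation Z * exp (- (\<Sum>j<Suc n. ?q (grid t n j) *
      (max s (grid t n (Suc j)) - max s (grid t n j))) / 2)" for n
    unfolding I_def simple_integral_grid[OF t(1,2)]
    using t Z mono by (intro char_simple_increments[where \<sigma>="\<lambda>j. max s (grid t n j)"]) (simp_all add: max_absorb1)
  have riemann: "(\<lambda>n. \<Sum>j<Suc n. ?q (grid t n j) *
      (max s (grid t n (Suc j)) - max s (grid t n j))) \<longlonglongrightarrow> integral {s..t} ?q"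
    using t by (intro riemann_sum_tendsto continuous_intros Ht) auto
  have "?L \<longlonglongrightarrow> expectation Z * exp (- integral {s..t} ?q / 2)"
    unfolding L_eq by (intro tendsto_intros tendsto_of_real riemann) simp
  moreover have "?L \<longlonglongrightarrow> ?E"
  proof -
    have "(\<lambda>n. ennreal (norm (?L n - ?E))) \<longlonglongrightarrow> 0"
    proof (rule ennreal_tendsto_0I)
      fix e :: real assume e: "0 < e"
      \<comment> \<open>Four equal shares: \<open>2 * d\<close> from the constants in Young's
        inequality and \<open>d\<close> from each of the two second moments. Adding 1 to the norm
        avoids division by 0.\<close>
      define x where "x = e / (norm c + 1)"
      define d where "d = x / 4"
      have d: "0 < d" "norm c * (2 * d + (d + d)) \<le> e"
      proof -
        show "0 < d"
          unfolding d_def x_def using e norm_ge_zero[of c] by (intro divide_pos_pos) linarith+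
        have "2 * d + (d + d) = x"
          by (simp add: d_def)
        then have "norm c * (2 * d + (d + d)) = e * (norm c / (norm c + 1))"
          by (simp add: x_def mult.commute)
        also have "\<dots> \<le> e * 1"
          using e by (intro mult_left_mono) (simp_all add: divide_le_eq_1 add_nonneg_pos)
        finally show "norm c * (2 * d + (d + d)) \<le> e" by simp
      qed
      have ev: "\<forall>\<^sub>F n in sequentially. (\<integral>\<^sup>+\<omega>. ennreal ((norm (J x \<omega> - I n x \<omega>))\<^sup>2) \<partial>M) < ennreal (d\<^sup>2)"
        if "x = s \<or> x = t" for x
        using d(1) by (intro order_tendstoD(2)[OF lim[OF that]]) simp
      from ev[of s, simplified] ev[of t, simplified]
      show "\<forall>\<^sub>F n in sequentially. ennreal (norm (?L n - ?E)) \<le> ennreal e"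
      proof eventually_elim
        case (elim n)
        have ptw: "norm (Z \<omega> * iexp (c \<bullet> (I n t \<omega> - I n s \<omega>)) - Z \<omega> * iexp (c \<bullet> (J t \<omega> - J s \<omega>))) \<le>
            norm c * (2 * d + (inverse d * (norm (J t \<omega> - I n t \<omega>))\<^sup>2 + inverse d * (norm (J s \<omega> - I n s \<omega>))\<^sup>2))"
          if "\<omega> \<in> space M" for \<omega>
        proof -
          \<comment> \<open>Young's inequality replaces Cauchy-Schwarz: it bounds a distance by its
            square pointwise, before integration.\<close>
          have young: "a \<le> d + inverse d * a\<^sup>2" if "0 \<le> a" for a
          proof (cases "a \<le> d")
            case False
            then have "a * d \<le> a * a"
              using d(1) by (intro mult_left_mono) auto
            then have "a * d \<le> a * a + d * d"
              using mult_pos_pos[OF d(1) d(1)] by linarith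
            then show ?thesis
              using d(1) by (simp add: field_simps power2_eq_square)
          qed (use d(1) in \<open>simp add: add_increasing2\<close>)
          have "norm (Z \<omega> * iexp (c \<bullet> (I n t \<omega> - I n s \<omega>)) - Z \<omega> * iexp (c \<bullet> (J t \<omega> - J s \<omega>))) \<le>
              1 * norm (iexp (c \<bullet> (I n t \<omega> - I n s \<omega>)) - iexp (c \<bullet> (J t \<omega> - J s \<omega>)))"
            unfolding right_diff_distrib[symmetric] norm_mult
            by (rule mult_right_mono[OF Z(2)[OF that]]) simp
          also have "\<dots> \<le> \<bar>c \<bullet> (I n t \<omega> - I n s \<omega>) - c \<bullet> (J t \<omega> - J s \<omega>)\<bar>"
            using norm_iexp_diff_le by simp
          also have "\<dots> = \<bar>c \<bullet> ((J s \<omega> - I n s \<omega>) - (J t \<omega> - I n t \<omega>))\<bar>"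
            by (simp add: inner_diff_right)
          also have "\<dots> \<le> norm c * norm ((J s \<omega> - I n s \<omega>) - (J t \<omega> - I n t \<omega>))"
            by (rule Cauchy_Schwarz_ineq2)
          also have "\<dots> \<le> norm c * (norm (J s \<omega> - I n s \<omega>) + norm (J t \<omega> - I n t \<omega>))"
            by (intro mult_left_mono norm_triangle_ineq4) simp
          also have "\<dots> \<le> norm c * ((d + inverse d * (norm (J s \<omega> - I n s \<omega>))\<^sup>2) + (d + inverse d * (norm (J t \<omega> - I n t \<omega>))\<^sup>2))"
            by (intro mult_left_mono add_mono young) auto
          finally show ?thesis
            by (simp add: algebra_simps)
        qed
        have "ennreal (norm (?L n - ?E)) = ennreal (norm (expectation (\<lambda>\<omega>.
            Z \<omega> * iexp (c \<bullet> (I n t \<omega> - I n s \<omega>)) - Z \<omega> * iexp (c \<bullet> (J t \<omega> - J s \<omega>)))))"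
          by (subst Bochner_Integration.integral_diff) (auto intro!: int)
        also have "\<dots> \<le> (\<integral>\<^sup>+\<omega>. norm (Z \<omega> * iexp (c \<bullet> (I n t \<omega> - I n s \<omega>)) - Z \<omega> * iexp (c \<bullet> (J t \<omega> - J s \<omega>))) \<partial>M)"
          by (intro integral_norm_bound_ennreal Bochner_Integration.integrable_diff int) measurable
        also have "\<dots> \<le> (\<integral>\<^sup>+\<omega>. ennreal (norm c * (2 * d + (inverse d * (norm (J t \<omega> - I n t \<omega>))\<^sup>2 +
            inverse d * (norm (J s \<omega> - I n s \<omega>))\<^sup>2))) \<partial>M)"
          by (intro nn_integral_mono ennreal_leI ptw)
        also have "\<dots> = (\<integral>\<^sup>+\<omega>. ennreal (norm c) * (ennreal (2 * d) +
            (ennreal (inverse d) * ennreal ((norm (J t \<omega> - I n t \<omega>))\<^sup>2) +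
             ennreal (inverse d) * ennreal ((norm (J s \<omega> - I n s \<omega>))\<^sup>2))) \<partial>M)"
          using d(1) by (intro nn_integral_cong) (simp add: ennreal_mult[symmetric] ennreal_plus[symmetric] del: ennreal_plus)
        also have "\<dots> = ennreal (norm c) * (ennreal (2 * d) +
            (ennreal (inverse d) * (\<integral>\<^sup>+\<omega>. ennreal ((norm (J t \<omega> - I n t \<omega>))\<^sup>2) \<partial>M) +
             ennreal (inverse d) * (\<integral>\<^sup>+\<omega>. ennreal ((norm (J s \<omega> - I n s \<omega>))\<^sup>2) \<partial>M)))"
          by (simp add: nn_integral_cmult nn_integral_add emeasure_space_1)
        also have "\<dots> \<le> ennreal (norm c) * (ennreal (2 * d) +
            (ennreal (inverse d) * ennreal (d\<^sup>2) + ennreal (inverse d) * ennreal (d\<^sup>2)))"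
          using elim by (intro mult_left_mono add_mono) auto
        also have "\<dots> = ennreal (norm c * (2 * d + (inverse d * d\<^sup>2 + inverse d * d\<^sup>2)))"
          using d(1) by (simp add: ennreal_mult[symmetric] ennreal_plus[symmetric] del: ennreal_plus)
        also have "inverse d * d\<^sup>2 = d"
          using d(1) by (simp add: power2_eq_square)
        also have "ennreal (norm c * (2 * d + (d + d))) \<le> ennreal e"
          by (rule ennreal_leI[OF d(2)])
        finally show ?case .
      qed
    qed
    then have "(\<lambda>n. norm (?L n - ?E)) \<longlonglongrightarrow> 0"
      unfolding ennreal_0[symmetric] by (subst (asm) tendsto_ennreal_iff) simp_all
    then show ?thesis
      by (simp add: LIM_zero_iff tendsto_norm_zero_iff)
  qed
  ultimately show ?thesis
    using LIMSEQ_unique by blast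
qed

end

section \<open>A maximal inequality and almost sure convergence\<close>

text \<open>Convexity with weights 1/5 and 4/5, by using convexity of the square twice. The unequal
  weights keep the second constant below 2: in the bisection each half is bounded by a quarter and
  there are two halves, so this constant is halved and the recursion contracts.\<close>

lemma fourth_power_add_le: "(x + y) ^ 4 \<le> 125 * x ^ 4 + 125 / 64 * y ^ 4" for x y :: real
proof -
  have sq: "((u + 4 * v) / 5)\<^sup>2 \<le> (u\<^sup>2 + 4 * v\<^sup>2) / 5" for u v :: real
    using zero_le_power2[of "u - v"] by (simp add: power2_eq_square field_simps)
  have "(5 * x + 4 * (5 / 4 * y)) / 5 = x + y"
    by simp
  then have "(x + y) ^ 4 = (((5 * x + 4 * (5 / 4 * y)) / 5)\<^sup>2)\<^sup>2"
    by (simp only: power_mult[symmetric]) simp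
  also have "\<dots> \<le> (((5 * x)\<^sup>2 + 4 * (5 / 4 * y)\<^sup>2) / 5)\<^sup>2"
    by (intro power_mono sq) simp
  also have "\<dots> \<le> (((5 * x)\<^sup>2)\<^sup>2 + 4 * ((5 / 4 * y)\<^sup>2)\<^sup>2) / 5"
    by (rule sq)
  also have "\<dots> = 125 * x ^ 4 + 125 / 64 * y ^ 4"
    by (simp add: power_mult_distrib power_divide)
  finally show ?thesis .
qed

lemma norm_fourth_power_le:
  fixes u v w :: "'b::real_normed_vector"
  shows "ennreal (norm (u - w) ^ 4) \<le> 125 * ennreal (norm (v - w) ^ 4) + ennreal (125 / 64) * ennreal (norm (u - v) ^ 4)"
proof -
  have "norm (u - w) ^ 4 \<le> (norm (v - w) + norm (u - v)) ^ 4"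
    using norm_triangle_ineq[of "v - w" "u - v"] by (intro power_mono) auto
  also have "\<dots> \<le> 125 * norm (v - w) ^ 4 + 125 / 64 * norm (u - v) ^ 4"
    by (rule fourth_power_add_le)
  finally have "ennreal (norm (u - w) ^ 4) \<le> ennreal (125 * norm (v - w) ^ 4 + 125 / 64 * norm (u - v) ^ 4)"
    by (rule ennreal_leI)
  then show ?thesis
    by (simp only: ennreal_plus ennreal_mult zero_le_power norm_ge_zero mult_nonneg_nonneg
        zero_le_numeral divide_nonneg_nonneg ennreal_numeral)
qed

text \<open>Bisection with respect to \<open>g\<close>: the constant closes up because \<open>125 + 125/64 * 8000/2 \<le> 8000\<close>.\<close>

lemma maximal_fourth_moment:
  fixes X :: "nat \<Rightarrow> 'a \<Rightarrow> 'b::euclidean_space" and g :: "nat \<Rightarrow> real"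
  assumes [measurable]: "\<And>i. X i \<in> borel_measurable M" and c: "0 \<le> c" and "m \<le> n"
    and mono: "\<And>i j. m \<le> i \<Longrightarrow> i \<le> j \<Longrightarrow> j \<le> n \<Longrightarrow> g i \<le> g j"
    and bound: "\<And>i j. m \<le> i \<Longrightarrow> i \<le> j \<Longrightarrow> j \<le> n \<Longrightarrow>
      (\<integral>\<^sup>+\<omega>. ennreal (norm (X j \<omega> - X i \<omega>) ^ 4) \<partial>M) \<le> ennreal (c * (g j - g i)\<^sup>2)"
  shows "(\<integral>\<^sup>+\<omega>. (SUP i\<in>{m..n}. ennreal (norm (X i \<omega> - X m \<omega>) ^ 4)) \<partial>M) \<le> ennreal (8000 * (c * (g n - g m)\<^sup>2))"
  using \<open>m \<le> n\<close> mono bound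
proof (induction "n - m" arbitrary: m n rule: less_induct)
  case less
  show ?case
  proof (cases "m = n")
    case True
    then show ?thesis by simp
  next
    case False
    define G where "G = g n - g m"
    have G: "0 \<le> G"
      using less.prems(2)[of m n] less.prems(1) by (simp add: G_def)
    \<comment> \<open>The first index at which \<open>g\<close> has made half of its way. The blocks
      from \<open>m\<close> to k - 1 and from \<open>k\<close> to \<open>n\<close> each carry at
      most half of the increase; a possibly large jump into \<open>k\<close> belongs to neither and
      is paid for by the term with X k - X m.\<close>
    define k where "k = (LEAST j. m < j \<and> G / 2 \<le> g j - g m)"
    have ex: "m < n \<and> G / 2 \<le> g n - g m"
      using False less.prems(1) G by (simp add: G_def)
    have k: "m < k" "G / 2 \<le> g k - g m"
      using LeastI[of "\<lambda>j. m < j \<and> G / 2 \<le> g j - g m", OF ex] by (simp_all add: k_def)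
    have kn: "k \<le> n"
      unfolding k_def using ex by (rule Least_le)
    have k1: "g (k - 1) - g m \<le> G / 2"
    proof (cases "k - 1 = m")
      case False
      then have "\<not> (m < k - 1 \<and> G / 2 \<le> g (k - 1) - g m)"
        unfolding k_def using not_less_Least[of "k - 1" "\<lambda>j. m < j \<and> G / 2 \<le> g j - g m"] k(1)
        by (metis diff_less k_def less_nat_zero_code neq0_conv zero_less_one)
      then show ?thesis
        using False k(1) by linarith
    qed (use G in simp)
    have k2: "g n - g k \<le> G / 2"
      using k(2) by (simp add: G_def field_simps)
    let ?L = "\<lambda>\<omega>. SUP i\<in>{m..k - 1}. ennreal (norm (X i \<omega> - X m \<omega>) ^ 4)"
    let ?R = "\<lambda>\<omega>. SUP i\<in>{k..n}. ennreal (norm (X i \<omega> - X k \<omega>) ^ 4)"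
    have half: "c * (g j - g i)\<^sup>2 \<le> c * (G / 2)\<^sup>2" if "g j - g i \<le> G / 2" "g i \<le> g j" for i j
      using that c by (intro mult_left_mono power_mono) auto
    have L: "(\<integral>\<^sup>+\<omega>. ?L \<omega> \<partial>M) \<le> ennreal (8000 * (c * (G / 2)\<^sup>2))"
    proof -
      have "(\<integral>\<^sup>+\<omega>. ?L \<omega> \<partial>M) \<le> ennreal (8000 * (c * (g (k - 1) - g m)\<^sup>2))"
        using k(1) kn less.prems by (intro less.hyps) auto
      also have "\<dots> \<le> ennreal (8000 * (c * (G / 2)\<^sup>2))"
        using k(1) kn by (intro ennreal_leI mult_left_mono half k1 less.prems(2)) auto
      finally show ?thesis .
    qed
    have R: "(\<integral>\<^sup>+\<omega>. ?R \<omega> \<partial>M) \<le> ennreal (8000 * (c * (G / 2)\<^sup>2))"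
    proof -
      have "(\<integral>\<^sup>+\<omega>. ?R \<omega> \<partial>M) \<le> ennreal (8000 * (c * (g n - g k)\<^sup>2))"
        using k(1) kn less.prems by (intro less.hyps) auto
      also have "\<dots> \<le> ennreal (8000 * (c * (G / 2)\<^sup>2))"
        using k(1) kn by (intro ennreal_leI mult_left_mono half k2 less.prems(2)) auto
      finally show ?thesis .
    qed
    \<comment> \<open>Before \<open>k\<close> the left block alone is enough; from \<open>k\<close>
      on the path is split at \<open>k\<close>, with the large constant on the single increment to
      \<open>k\<close> and the small one on the supremum.\<close>
    have ptw: "(SUP i\<in>{m..n}. ennreal (norm (X i \<omega> - X m \<omega>) ^ 4)) \<le>
        125 * ennreal (norm (X k \<omega> - X m \<omega>) ^ 4) + ennreal (125 / 64) * (?L \<omega> + ?R \<omega>)" for \<omega>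
    proof (rule SUP_least)
      fix i assume i: "i \<in> {m..n}"
      show "ennreal (norm (X i \<omega> - X m \<omega>) ^ 4) \<le>
          125 * ennreal (norm (X k \<omega> - X m \<omega>) ^ 4) + ennreal (125 / 64) * (?L \<omega> + ?R \<omega>)"
      proof (cases "i < k")
        case True
        have "ennreal (norm (X i \<omega> - X m \<omega>) ^ 4) \<le> ?L \<omega>"
          using True i by (intro SUP_upper) auto
        also have "\<dots> \<le> ?L \<omega> + ?R \<omega>"
          by simp
        also have "\<dots> = ennreal 1 * (?L \<omega> + ?R \<omega>)"
          by simp
        also have "\<dots> \<le> ennreal (125 / 64) * (?L \<omega> + ?R \<omega>)"
          by (intro mult_right_mono ennreal_leI) auto
        finally show ?thesis
          by (rule order_trans) simp
      next
        case False
        then have "ennreal (norm (X i \<omega> - X k \<omega>) ^ 4) \<le> ?R \<omega>"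
          using i by (intro SUP_upper) auto
        then have le: "ennreal (norm (X i \<omega> - X k \<omega>) ^ 4) \<le> ?L \<omega> + ?R \<omega>"
          by (rule order_trans) simp
        have "ennreal (norm (X i \<omega> - X m \<omega>) ^ 4) \<le> 125 * ennreal (norm (X k \<omega> - X m \<omega>) ^ 4) +
            ennreal (125 / 64) * ennreal (norm (X i \<omega> - X k \<omega>) ^ 4)"
          by (rule norm_fourth_power_le)
        also have "\<dots> \<le> 125 * ennreal (norm (X k \<omega> - X m \<omega>) ^ 4) + ennreal (125 / 64) * (?L \<omega> + ?R \<omega>)"
          by (rule add_left_mono[OF mult_left_mono[OF le]]) simp
        finally show ?thesis .
      qed
    qed
    have "(\<integral>\<^sup>+\<omega>. (SUP i\<in>{m..n}. ennreal (norm (X i \<omega> - X m \<omega>) ^ 4)) \<partial>M) \<le>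
        (\<integral>\<^sup>+\<omega>. 125 * ennreal (norm (X k \<omega> - X m \<omega>) ^ 4) + ennreal (125 / 64) * (?L \<omega> + ?R \<omega>) \<partial>M)"
      by (intro nn_integral_mono ptw)
    also have "\<dots> = 125 * (\<integral>\<^sup>+\<omega>. ennreal (norm (X k \<omega> - X m \<omega>) ^ 4) \<partial>M) +
        ennreal (125 / 64) * ((\<integral>\<^sup>+\<omega>. ?L \<omega> \<partial>M) + (\<integral>\<^sup>+\<omega>. ?R \<omega> \<partial>M))"
      by (simp add: nn_integral_add nn_integral_cmult)
    also have "\<dots> \<le> 125 * ennreal (c * G\<^sup>2) + ennreal (125 / 64) *
        (ennreal (8000 * (c * (G / 2)\<^sup>2)) + ennreal (8000 * (c * (G / 2)\<^sup>2)))"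
    proof -
      have "(\<integral>\<^sup>+\<omega>. ennreal (norm (X k \<omega> - X m \<omega>) ^ 4) \<partial>M) \<le> ennreal (c * (g k - g m)\<^sup>2)"
        using k kn by (intro less.prems(3)) auto
      also have "\<dots> \<le> ennreal (c * G\<^sup>2)"
        using less.prems(2)[of k n] less.prems(2)[of m k] k kn c
        by (intro ennreal_leI mult_left_mono power_mono) (auto simp: G_def)
      finally show ?thesis
        using L R by (intro add_mono mult_left_mono) auto
    qed
    also have "\<dots> = ennreal (125 * (c * G\<^sup>2) + 125 / 64 * (8000 * (c * (G / 2)\<^sup>2) + 8000 * (c * (G / 2)\<^sup>2)))"
    proof -
      have "0 \<le> c * G\<^sup>2" "0 \<le> 8000 * (c * (G / 2)\<^sup>2)"
        using c by auto
      then show ?thesis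
        by (simp only: ennreal_plus ennreal_mult ennreal_numeral mult_nonneg_nonneg add_nonneg_nonneg
            zero_le_numeral divide_nonneg_nonneg)
    qed
    also have "\<dots> \<le> ennreal (8000 * (c * (g n - g m)\<^sup>2))"
      using c by (intro ennreal_leI) (simp add: G_def[symmetric] power_divide field_simps)
    finally show ?thesis .
  qed
qed

text \<open>The weight \<open>h\<close> plays the role of a clock that runs down to \<open>0\<close> at time \<open>T\<close>.\<close>

lemma AE_tendsto_0_fourth_moment:
  fixes X :: "real \<Rightarrow> 'a \<Rightarrow> 'b::euclidean_space" and h :: "real \<Rightarrow> real"
  assumes "t\<^sub>0 < T" and meas: "\<And>t. t\<^sub>0 \<le> t \<Longrightarrow> t < T \<Longrightarrow> X t \<in> borel_measurable M" and c: "0 \<le> c"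
    and cont: "AE \<omega> in M. continuous_on {t\<^sub>0..<T} (\<lambda>t. X t \<omega>)"
    and h: "(h \<longlongrightarrow> 0) (at_left T)" "\<And>s t. t\<^sub>0 \<le> s \<Longrightarrow> s \<le> t \<Longrightarrow> t < T \<Longrightarrow> h t \<le> h s"
      "\<And>t. t\<^sub>0 \<le> t \<Longrightarrow> t < T \<Longrightarrow> 0 \<le> h t"
    and incr: "\<And>s t. t\<^sub>0 \<le> s \<Longrightarrow> s \<le> t \<Longrightarrow> t < T \<Longrightarrow>
      (\<integral>\<^sup>+\<omega>. ennreal (norm (X t \<omega> - X s \<omega>) ^ 4) \<partial>M) \<le> ennreal (c * (h s - h t)\<^sup>2)"
    and mom: "\<And>t. t\<^sub>0 \<le> t \<Longrightarrow> t < T \<Longrightarrow>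
      (\<integral>\<^sup>+\<omega>. ennreal (norm (X t \<omega>) ^ 4) \<partial>M) \<le> ennreal (c * (h t)\<^sup>2)"
  shows "AE \<omega> in M. ((\<lambda>t. X t \<omega>) \<longlongrightarrow> 0) (at_left T)"
proof -
  \<comment> \<open>Dyadic points of [s,T); stopping at j = 2^n - 1 keeps \<open>T\<close> itself
    out.\<close>
  define p where "p s n j = s + (T - s) * (real j / 2 ^ n)" for s n j
  have p: "s \<le> p s n j" "p s n j < T" if "t\<^sub>0 \<le> s" "s < T" "j \<in> {0..2 ^ n - 1}" for s n j
  proof -
    have "0 < (2 :: nat) ^ n"
      by simp
    then have "j < 2 ^ n"
      using that(3) unfolding atLeastAtMost_iff by linarith
    then have "real j / 2 ^ n < 1"
      by simp
    then have "(T - s) * (real j / 2 ^ n) < (T - s) * 1"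
      using that by (intro mult_strict_left_mono) auto
    then show "s \<le> p s n j" "p s n j < T"
      using that by (auto simp: p_def)
  qed
  have p_mono: "p s n i \<le> p s n j" if "s < T" "i \<le> j" for s n i j
    using that unfolding p_def by (intro add_left_mono mult_left_mono divide_right_mono) auto
  \<comment> \<open>A countable supremum, hence measurable; for continuous paths it dominates the
    fourth power of the norm on all of [s,T), see \<open>Y_bound\<close>.\<close>
  define Y where "Y s \<omega> = (SUP n. SUP j\<in>{0..2 ^ n - 1 :: nat}. ennreal (norm (X (p s n j) \<omega>) ^ 4))" for s \<omega>
  have Y_meas: "Y s \<in> borel_measurable M" if "t\<^sub>0 \<le> s" "s < T" for s
  proof -
    have "X (p s n j) \<in> borel_measurable M" if "j \<in> {0..2 ^ n - 1}" for n j
      using p[OF \<open>t\<^sub>0 \<le> s\<close> \<open>s < T\<close> that] \<open>t\<^sub>0 \<le> s\<close> by (intro meas) auto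
    then show ?thesis
      unfolding Y_def by (intro borel_measurable_SUP measurable_compose[OF _ measurable_ennreal]) auto
  qed
  have Y_int: "(\<integral>\<^sup>+\<omega>. Y s \<omega> \<partial>M) \<le> ennreal (16125 * (c * (h s)\<^sup>2))" if s: "t\<^sub>0 \<le> s" "s < T" for s
  proof -
    have fin: "(\<integral>\<^sup>+\<omega>. (SUP j\<in>{0..2 ^ n - 1}. ennreal (norm (X (p s n j) \<omega>) ^ 4)) \<partial>M) \<le> ennreal (16125 * (c * (h s)\<^sup>2))" for n
    proof -
      \<comment> \<open>\<open>maximal_fourth_moment\<close> asks for measurability at every index,
        while \<open>X\<close> is known to be measurable only before \<open>T\<close>; hence the
        default 0 off the grid.\<close>
      define X' where "X' j = (if j \<in> {0..2 ^ n - 1} then X (p s n j) else (\<lambda>_. 0))" for j :: nat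
      have X'_meas [measurable]: "X' j \<in> borel_measurable M" for j
        using p[OF s, of j n] s by (auto simp: X'_def intro!: meas)
      have [measurable]: "X s \<in> borel_measurable M"
        using s by (rule meas)
      have p0: "p s n 0 = s"
        by (simp add: p_def)
      have X'0: "X' 0 = X s"
        by (simp add: X'_def p0)
      have "(\<integral>\<^sup>+\<omega>. (SUP j\<in>{0..2 ^ n - 1}. ennreal (norm (X' j \<omega> - X' 0 \<omega>) ^ 4)) \<partial>M) \<le>
          ennreal (8000 * (c * (- h (p s n (2 ^ n - 1)) - - h (p s n 0))\<^sup>2))"
      proof (rule maximal_fourth_moment[where g="\<lambda>j. - h (p s n j)"])
        fix i j :: nat assume ij: "0 \<le> i" "i \<le> j" "j \<le> 2 ^ n - 1"
        then have *: "t\<^sub>0 \<le> p s n i" "p s n i \<le> p s n j" "p s n j < T"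
          using p[OF s, of i n] p[OF s, of j n] p_mono[OF s(2) ij(2)] s by auto
        show "- h (p s n i) \<le> - h (p s n j)"
          using h(2)[OF *] by simp
        show "(\<integral>\<^sup>+\<omega>. ennreal (norm (X' j \<omega> - X' i \<omega>) ^ 4) \<partial>M) \<le> ennreal (c * (- h (p s n j) - - h (p s n i))\<^sup>2)"
          using incr[OF *] ij by (simp add: X'_def)
      qed (use c in auto)
      also have "\<dots> \<le> ennreal (8000 * (c * (h s)\<^sup>2))"
        using p[OF s, of "2 ^ n - 1" n] s h(3)[of "p s n (2 ^ n - 1)"] h(2)[of s "p s n (2 ^ n - 1)"] c
        by (intro ennreal_leI mult_left_mono power_mono) (auto simp: p0)
      finally have max: "(\<integral>\<^sup>+\<omega>. (SUP j\<in>{0..2 ^ n - 1}. ennreal (norm (X' j \<omega> - X' 0 \<omega>) ^ 4)) \<partial>M) \<le> ennreal (8000 * (c * (h s)\<^sup>2))" .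
      \<comment> \<open>From increments back to values by one more splitting at time
        \<open>s\<close>. Rounding 125/64 up to 2 gives 16125 = 125 + 2 * 8000.\<close>
      have "(SUP j\<in>{0..2 ^ n - 1}. ennreal (norm (X (p s n j) \<omega>) ^ 4)) \<le>
          125 * ennreal (norm (X s \<omega>) ^ 4) + 2 * (SUP j\<in>{0..2 ^ n - 1}. ennreal (norm (X' j \<omega> - X' 0 \<omega>) ^ 4))" for \<omega>
      proof (rule SUP_least)
        fix j :: nat assume j: "j \<in> {0..2 ^ n - 1}"
        have "ennreal (norm (X (p s n j) \<omega>) ^ 4) \<le> 125 * ennreal (norm (X s \<omega>) ^ 4) + ennreal (125 / 64) * ennreal (norm (X' j \<omega> - X' 0 \<omega>) ^ 4)"
          using norm_fourth_power_le[of "X (p s n j) \<omega>" 0 "X s \<omega>"] j by (simp add: X'0) (simp add: X'_def)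
        also have "\<dots> \<le> 125 * ennreal (norm (X s \<omega>) ^ 4) + ennreal 2 * (SUP j\<in>{0..2 ^ n - 1}. ennreal (norm (X' j \<omega> - X' 0 \<omega>) ^ 4))"
          using j by (intro add_left_mono mult_mono SUP_upper ennreal_leI) auto
        finally show "ennreal (norm (X (p s n j) \<omega>) ^ 4) \<le>
            125 * ennreal (norm (X s \<omega>) ^ 4) + 2 * (SUP j\<in>{0..2 ^ n - 1}. ennreal (norm (X' j \<omega> - X' 0 \<omega>) ^ 4))"
          by simp
      qed
      then have "(\<integral>\<^sup>+\<omega>. (SUP j\<in>{0..2 ^ n - 1}. ennreal (norm (X (p s n j) \<omega>) ^ 4)) \<partial>M) \<le>
          (\<integral>\<^sup>+\<omega>. 125 * ennreal (norm (X s \<omega>) ^ 4) + 2 * (SUP j\<in>{0..2 ^ n - 1}. ennreal (norm (X' j \<omega> - X' 0 \<omega>) ^ 4)) \<partial>M)"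
        by (intro nn_integral_mono)
      also have "\<dots> = 125 * (\<integral>\<^sup>+\<omega>. ennreal (norm (X s \<omega>) ^ 4) \<partial>M) +
          2 * (\<integral>\<^sup>+\<omega>. (SUP j\<in>{0..2 ^ n - 1}. ennreal (norm (X' j \<omega> - X' 0 \<omega>) ^ 4)) \<partial>M)"
        by (simp add: nn_integral_add nn_integral_cmult)
      also have "\<dots> \<le> 125 * ennreal (c * (h s)\<^sup>2) + 2 * ennreal (8000 * (c * (h s)\<^sup>2))"
        by (intro add_mono mult_left_mono max mom s) auto
      also have "\<dots> = ennreal (125 * (c * (h s)\<^sup>2) + 2 * (8000 * (c * (h s)\<^sup>2)))"
      proof -
        have "0 \<le> c * (h s)\<^sup>2"
          using c by simp
        then show ?thesis
          by (simp only: ennreal_plus ennreal_mult ennreal_numeral mult_nonneg_nonneg zero_le_numeral)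
      qed
      also have "125 * (c * (h s)\<^sup>2) + 2 * (8000 * (c * (h s)\<^sup>2)) = 16125 * (c * (h s)\<^sup>2)"
        by simp
      finally show ?thesis .
    qed
    have "incseq (\<lambda>n \<omega>. SUP j\<in>{0..2 ^ n - 1}. ennreal (norm (X (p s n j) \<omega>) ^ 4))"
    proof (intro incseq_SucI le_funI SUP_mono)
      fix n \<omega> and j :: nat assume "j \<in> {0..2 ^ n - 1}"
      then have "2 * j \<in> {0..2 ^ Suc n - 1}"
        by auto
      moreover have "p s n j = p s (Suc n) (2 * j)"
        by (simp add: p_def)
      ultimately show "\<exists>i\<in>{0..2 ^ Suc n - 1}. ennreal (norm (X (p s n j) \<omega>) ^ 4) \<le> ennreal (norm (X (p s (Suc n) i) \<omega>) ^ 4)"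
        by (metis order_refl)
    qed
    moreover have "(\<lambda>\<omega>. SUP j\<in>{0..2 ^ n - 1}. ennreal (norm (X (p s n j) \<omega>) ^ 4)) \<in> borel_measurable M" for n
    proof -
      have "X (p s n j) \<in> borel_measurable M" if "j \<in> {0..2 ^ n - 1}" for j
        using p[OF s that] s by (intro meas) auto
      then show ?thesis
        by (intro borel_measurable_SUP measurable_compose[OF _ measurable_ennreal]) auto
    qed
    ultimately have "(\<integral>\<^sup>+\<omega>. Y s \<omega> \<partial>M) = (SUP n. \<integral>\<^sup>+\<omega>. (SUP j\<in>{0..2 ^ n - 1}. ennreal (norm (X (p s n j) \<omega>) ^ 4)) \<partial>M)"
      unfolding Y_def by (intro nn_integral_monotone_convergence_SUP)
    also have "\<dots> \<le> ennreal (16125 * (c * (h s)\<^sup>2))"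
      by (intro SUP_least fin)
    finally show ?thesis .
  qed
  have Y_bound: "ennreal (norm (X t \<omega>) ^ 4) \<le> Y s \<omega>"
    if cont: "continuous_on {t\<^sub>0..<T} (\<lambda>t. X t \<omega>)" and st: "t\<^sub>0 \<le> s" "s \<le> t" "t < T" for s t \<omega>
  proof -
    \<comment> \<open>The relative position of \<open>t\<close> in [s,T); truncating its binary
      expansion yields dyadic points that approach \<open>t\<close> from the left.\<close>
    define q where "q = (t - s) / (T - s)"
    have q: "0 \<le> q" "q < 1" "t = s + (T - s) * q"
      using st by (auto simp: q_def)
    define j where "j n = nat \<lfloor>q * 2 ^ n\<rfloor>" for n
    have j: "real (j n) \<le> q * 2 ^ n" "q * 2 ^ n - 1 < real (j n)" for n
      using q(1) by (simp_all add: j_def of_nat_nat zero_le_mult_iff)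
    have jn: "j n \<in> {0..2 ^ n - 1}" for n
    proof -
      have "real (j n) < 1 * 2 ^ n"
        by (rule le_less_trans[OF j(1) mult_strict_right_mono[OF q(2)]]) simp
      then have "real (j n) < real (2 ^ n)"
        by simp
      then have "j n < 2 ^ n"
        by (simp only: of_nat_less_iff)
      then show ?thesis
        by simp
    qed
    have "(\<lambda>n. real (j n) / 2 ^ n) \<longlonglongrightarrow> q"
    proof (rule tendsto_sandwich)
      have "(\<lambda>n. q - (1 / 2) ^ n) \<longlonglongrightarrow> q - 0"
        by (intro tendsto_intros LIMSEQ_power_zero) simp
      then show "(\<lambda>n. q - (1 / 2) ^ n) \<longlonglongrightarrow> q"
        by simp
      show "\<forall>\<^sub>F n in sequentially. q - (1 / 2) ^ n \<le> real (j n) / 2 ^ n"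
      proof (intro always_eventually allI)
        fix n
        have "(q * 2 ^ n - 1) / 2 ^ n \<le> real (j n) / 2 ^ n"
          using less_imp_le[OF j(2)] by (intro divide_right_mono) auto
        then show "q - (1 / 2) ^ n \<le> real (j n) / 2 ^ n"
          by (simp add: diff_divide_distrib power_one_over)
      qed
      show "\<forall>\<^sub>F n in sequentially. real (j n) / 2 ^ n \<le> q"
        using j(1) by (intro always_eventually allI) (simp add: field_simps)
    qed (rule tendsto_const)
    then have "(\<lambda>n. p s n (j n)) \<longlonglongrightarrow> t"
      unfolding p_def q(3) by (intro tendsto_intros)
    moreover have "p s n (j n) \<in> {t\<^sub>0..<T}" for n
      using p[OF st(1) _ jn] st by (auto intro: order_trans)
    ultimately have "(\<lambda>n. X (p s n (j n)) \<omega>) \<longlonglongrightarrow> X t \<omega>"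
      using cont st by (intro continuous_on_tendsto_compose[OF cont]) auto
    then have lim: "(\<lambda>n. ennreal (norm (X (p s n (j n)) \<omega>) ^ 4)) \<longlonglongrightarrow> ennreal (norm (X t \<omega>) ^ 4)"
      by (intro tendsto_ennrealI tendsto_intros)
    have "ennreal (norm (X (p s n (j n)) \<omega>) ^ 4) \<le> Y s \<omega>" for n
      unfolding Y_def by (intro SUP_upper2[of n] SUP_upper jn) simp
    then show ?thesis
      by (intro LIMSEQ_le_const2[OF lim]) blast
  qed
  have "\<exists>s. t\<^sub>0 \<le> s \<and> s < T \<and> 16125 * (c * (h s)\<^sup>2) \<le> 1 / real (Suc k)" for k
  proof -
    have "((\<lambda>s. 16125 * (c * (h s)\<^sup>2)) \<longlongrightarrow> 16125 * (c * 0\<^sup>2)) (at_left T)"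
      by (intro tendsto_intros h(1))
    then have "\<forall>\<^sub>F s in at_left T. 16125 * (c * (h s)\<^sup>2) < 1 / real (Suc k)"
      by (rule order_tendstoD(2)) simp
    moreover have "\<forall>\<^sub>F s in at_left T. s \<in> {t\<^sub>0<..<T}"
      using \<open>t\<^sub>0 < T\<close> by (rule eventually_at_leftI[rotated]) simp
    ultimately have "\<forall>\<^sub>F s in at_left T. t\<^sub>0 \<le> s \<and> s < T \<and> 16125 * (c * (h s)\<^sup>2) \<le> 1 / real (Suc k)"
      by eventually_elim auto
    then show ?thesis
      using eventually_happens trivial_limit_at_left_real by blast
  qed
  then obtain \<sigma> where \<sigma>: "\<And>k. t\<^sub>0 \<le> \<sigma> k" "\<And>k. \<sigma> k < T"
    "\<And>k. 16125 * (c * (h (\<sigma> k))\<^sup>2) \<le> 1 / real (Suc k)"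
    by metis
  \<comment> \<open>The infimum over \<open>k\<close> is the right quantity: a single
    \<open>k\<close> with small \<open>Y (\<sigma> k)\<close> controls \<open>X\<close> on the whole
    of [\<sigma> k, T).\<close>
  have "(\<integral>\<^sup>+\<omega>. (INF k. Y (\<sigma> k) \<omega>) \<partial>M) = 0"
  proof -
    have "(\<integral>\<^sup>+\<omega>. (INF k. Y (\<sigma> k) \<omega>) \<partial>M) \<le> ennreal (1 / real (Suc k))" for k
    proof -
      have "(\<integral>\<^sup>+\<omega>. (INF k. Y (\<sigma> k) \<omega>) \<partial>M) \<le> (\<integral>\<^sup>+\<omega>. Y (\<sigma> k) \<omega> \<partial>M)"
        by (intro nn_integral_mono INF_lower) simp
      also have "\<dots> \<le> ennreal (16125 * (c * (h (\<sigma> k))\<^sup>2))"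
        by (rule Y_int[OF \<sigma>(1,2)])
      also have "\<dots> \<le> ennreal (1 / real (Suc k))"
        by (rule ennreal_leI[OF \<sigma>(3)])
      finally show ?thesis .
    qed
    moreover have "(\<lambda>k. ennreal (1 / real (Suc k))) \<longlonglongrightarrow> ennreal 0"
      by (intro tendsto_ennrealI) (use LIMSEQ_inverse_real_of_nat in \<open>simp add: inverse_eq_divide\<close>)
    ultimately have "(\<integral>\<^sup>+\<omega>. (INF k. Y (\<sigma> k) \<omega>) \<partial>M) \<le> ennreal 0"
      by (intro LIMSEQ_le_const) auto
    then show ?thesis
      by simp
  qed
  moreover have "(\<lambda>\<omega>. INF k. Y (\<sigma> k) \<omega>) \<in> borel_measurable M"
    using Y_meas[OF \<sigma>(1,2)] by (intro borel_measurable_INF) auto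
  ultimately have "AE \<omega> in M. (INF k. Y (\<sigma> k) \<omega>) = 0"
    by (simp add: nn_integral_0_iff_AE)
  with cont show ?thesis
  proof eventually_elim
    case (elim \<omega>)
    show ?case
    proof (rule tendstoI)
      fix e :: real assume "0 < e"
      then have "(INF k. Y (\<sigma> k) \<omega>) < ennreal (e ^ 4)"
        using elim(2) by simp
      then obtain k where k: "Y (\<sigma> k) \<omega> < ennreal (e ^ 4)"
        by (auto simp: INF_less_iff)
      have "\<forall>\<^sub>F t in at_left T. t \<in> {\<sigma> k<..<T}"
        using \<sigma>(2) by (rule eventually_at_leftI[rotated]) simp
      then show "\<forall>\<^sub>F t in at_left T. dist (X t \<omega>) 0 < e"
      proof eventually_elim
        case (elim t)
        then have "ennreal (norm (X t \<omega>) ^ 4) < ennreal (e ^ 4)"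
          using Y_bound[OF \<open>continuous_on _ _\<close> \<sigma>(1)[of k], of t] k by (auto intro: le_less_trans)
        then have "norm (X t \<omega>) ^ 4 < e ^ 4"
          by (simp add: ennreal_less_iff)
        then show ?case
          using \<open>0 < e\<close> by (simp add: power_less_imp_less_base dist_norm)
      qed
    qed
  qed
qed

section \<open>Gauss mixtures\<close>

lemma measurable_gauss_density_pair [measurable]:
  "(\<lambda>(m, y). gauss_density m C y) \<in> borel_measurable (borel \<Otimes>\<^sub>M borel)"
  unfolding gauss_density_def by measurable

text \<open>The mean moves from the measure into the set, so that measurability in the mean follows
  from Fubini for one fixed measure.\<close>

lemma emeasure_gauss_measure_shift:
  assumes C: "pos_def C" and [measurable]: "A \<in> sets borel"
  shows "emeasure (gauss_measure m C) A = (\<integral>\<^sup>+g. indicator A (m + g) \<partial>gauss_measure 0 C)"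
proof -
  obtain L :: "real^'a^'a" where L: "invertible L" "C = L ** transpose L"
    using C by (rule pos_def_factorization)
  have "emeasure (gauss_measure m C) A = (\<integral>\<^sup>+y. indicator A y \<partial>gauss_measure m C)"
    by simp
  also have "\<dots> = (\<integral>\<^sup>+x. indicator A (m + L *v x) \<partial>std_gauss)"
    unfolding L(2) gauss_measure_eq_distr[OF L(1)] by (rule nn_integral_distr) measurable
  also have "\<dots> = (\<integral>\<^sup>+g. indicator A (m + g) \<partial>gauss_measure 0 C)"
    unfolding L(2) gauss_measure_eq_distr[OF L(1)] by (subst nn_integral_distr) simp_all
  finally show ?thesis .
qed

lemma measurable_emeasure_gauss_measure:
  assumes C: "pos_def C" and [measurable]: "A \<in> sets borel"
  shows "(\<lambda>m. emeasure (gauss_measure m C) A) \<in> borel_measurable borel"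
proof -
  interpret G: prob_space "gauss_measure 0 C"
    by (rule prob_space_gauss_measure[OF C])
  show ?thesis
    unfolding emeasure_gauss_measure_shift[OF assms] by measurable
qed

text \<open>The law of \<open>W\<close> plus independent Gauss noise, realised on a product space
  instead of by composing kernels: the characteristic function then factors, while
  \<open>emeasure_gauss_mixture\<close> returns the kernel form.\<close>

definition gauss_mixture :: "'b measure \<Rightarrow> ('b \<Rightarrow> real^'n) \<Rightarrow> real^'n^'n \<Rightarrow> (real^'n) measure" where
  "gauss_mixture P W C = distr (P \<Otimes>\<^sub>M gauss_measure 0 C) borel (\<lambda>(\<omega>, g). W \<omega> + g)"

lemma
  fixes W :: "'b \<Rightarrow> real^'n"
  assumes P: "finite_measure P" and W [measurable]: "W \<in> borel_measurable P" and C: "pos_def C"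
  shows finite_gauss_mixture: "finite_measure (gauss_mixture P W C)"
    and sets_gauss_mixture: "sets (gauss_mixture P W C) = sets borel"
    and char_gauss_mixture: "(\<integral>y. iexp (c \<bullet> y) \<partial>gauss_mixture P W C) =
      (\<integral>\<omega>. iexp (c \<bullet> W \<omega>) \<partial>P) * exp (- (c \<bullet> (C *v c)) / 2)"
    and emeasure_gauss_mixture: "A \<in> sets borel \<Longrightarrow>
      emeasure (gauss_mixture P W C) A = (\<integral>\<^sup>+\<omega>. emeasure (gauss_measure (W \<omega>) C) A \<partial>P)"
proof -
  interpret P: finite_measure P by fact
  interpret G: prob_space "gauss_measure 0 C"
    by (rule prob_space_gauss_measure[OF C])
  interpret PG: pair_sigma_finite P "gauss_measure 0 C" ..
  interpret PF: finite_measure "P \<Otimes>\<^sub>M gauss_measure 0 C"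
    by (rule finite_measure_pair_measure) unfold_locales
  show "finite_measure (gauss_mixture P W C)"
    unfolding gauss_mixture_def by (rule PF.finite_measure_distr) measurable
  show "sets (gauss_mixture P W C) = sets borel"
    by (simp add: gauss_mixture_def)
  have "integrable (P \<Otimes>\<^sub>M gauss_measure 0 C) (\<lambda>(\<omega>, g). iexp (c \<bullet> W \<omega>) * iexp (c \<bullet> g))"
    by (rule PF.integrable_const_bound[where B=1]) (auto simp: norm_mult)
  then have "(\<integral>\<omega>. (\<integral>g. iexp (c \<bullet> W \<omega>) * iexp (c \<bullet> g) \<partial>gauss_measure 0 C) \<partial>P) =
      (\<integral>p. (\<lambda>(\<omega>, g). iexp (c \<bullet> W \<omega>) * iexp (c \<bullet> g)) p \<partial>(P \<Otimes>\<^sub>M gauss_measure 0 C))"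
    by (subst PG.integral_fst'[symmetric]) simp_all
  moreover have "(\<integral>y. iexp (c \<bullet> y) \<partial>gauss_mixture P W C) =
      (\<integral>p. (\<lambda>(\<omega>, g). iexp (c \<bullet> W \<omega>) * iexp (c \<bullet> g)) p \<partial>(P \<Otimes>\<^sub>M gauss_measure 0 C))"
    unfolding gauss_mixture_def
    by (subst integral_distr) (auto simp: inner_add_right distrib_left exp_add intro!: Bochner_Integration.integral_cong)
  ultimately show "(\<integral>y. iexp (c \<bullet> y) \<partial>gauss_mixture P W C) =
      (\<integral>\<omega>. iexp (c \<bullet> W \<omega>) \<partial>P) * exp (- (c \<bullet> (C *v c)) / 2)"
    by (simp add: char_gauss_measure[OF C])
  assume [measurable]: "A \<in> sets borel"
  have "emeasure (gauss_mixture P W C) A = (\<integral>\<^sup>+y. indicator A y \<partial>gauss_mixture P W C)"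
    by (simp add: gauss_mixture_def)
  also have "\<dots> = (\<integral>\<^sup>+p. indicator A (W (fst p) + snd p) \<partial>(P \<Otimes>\<^sub>M gauss_measure 0 C))"
    unfolding gauss_mixture_def by (subst nn_integral_distr) (simp_all add: case_prod_unfold)
  also have "\<dots> = (\<integral>\<^sup>+\<omega>. (\<integral>\<^sup>+g. indicator A (W \<omega> + g) \<partial>gauss_measure 0 C) \<partial>P)"
    by (subst G.nn_integral_fst[symmetric]) simp_all
  finally show "emeasure (gauss_mixture P W C) A = (\<integral>\<^sup>+\<omega>. emeasure (gauss_measure (W \<omega>) C) A \<partial>P)"
    by (simp add: emeasure_gauss_measure_shift[OF C])
qed

text \<open>Characteristic functions identify the Gauss mixture of Gauss laws. Two densities of the
  same measure agree only almost everywhere, which is why the equation holds for almost every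
  \<open>z\<close>.\<close>

lemma gauss_density_convolution:
  fixes A C\<^sub>1 C\<^sub>2 :: "real^'n^'n"
  assumes C: "pos_def C\<^sub>1" "pos_def C\<^sub>2" "pos_def (C\<^sub>2 + A ** C\<^sub>1 ** transpose A)"
    and w: "\<And>y. w y = v + A *v y"
  shows "AE z in lborel. ennreal (gauss_density (w m) (C\<^sub>2 + A ** C\<^sub>1 ** transpose A) z) =
    (\<integral>\<^sup>+y. ennreal (gauss_density m C\<^sub>1 y * gauss_density (w y) C\<^sub>2 z) \<partial>lborel)"
proof -
  let ?C = "C\<^sub>2 + A ** C\<^sub>1 ** transpose A" and ?P = "gauss_measure m C\<^sub>1"
  interpret P: prob_space ?P
    by (rule prob_space_gauss_measure[OF C(1)])
  have [measurable]: "w \<in> borel_measurable borel"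
    unfolding w by measurable
  have [measurable]: "(\<lambda>p. gauss_density (w (fst p)) C\<^sub>2 (snd p)) \<in> borel_measurable (borel \<Otimes>\<^sub>M borel)"
    using measurable_compose[OF _ measurable_gauss_density_pair, of "\<lambda>p. (w (fst p), snd p)"] by simp
  have fin: "finite_measure ?P"
    by unfold_locales
  have wP: "w \<in> borel_measurable ?P"
    by simp
  have mix: "gauss_mixture ?P w C\<^sub>2 = gauss_measure (w m) ?C"
  proof (rule char_uniqueness)
    show "finite_measure (gauss_mixture ?P w C\<^sub>2)" "sets (gauss_mixture ?P w C\<^sub>2) = sets borel"
      by (rule finite_gauss_mixture[OF fin wP C(2)] sets_gauss_mixture[OF fin wP C(2)])+
    show "finite_measure (gauss_measure (w m) ?C)"
      using prob_space_gauss_measure[OF C(3)] by (rule prob_space.finite_measure)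
    fix c
    have "(\<integral>\<omega>. iexp (c \<bullet> w \<omega>) \<partial>?P) = (\<integral>\<omega>. iexp (c \<bullet> v) * iexp ((transpose A *v c) \<bullet> \<omega>) \<partial>?P)"
      unfolding inner_transpose_left by (simp add: w inner_add_right distrib_left exp_add)
    also have "\<dots> = iexp (c \<bullet> v) * (iexp ((transpose A *v c) \<bullet> m) *
        exp (- ((transpose A *v c) \<bullet> (C\<^sub>1 *v (transpose A *v c))) / 2))"
      by (simp only: integral_mult_right_zero char_gauss_measure[OF C(1)])
    also have "\<dots> = iexp (c \<bullet> w m) * exp (- (c \<bullet> (A ** C\<^sub>1 ** transpose A *v c)) / 2)"
      unfolding inner_transpose_left matrix_vector_mul_assoc[symmetric]
      by (simp add: w inner_add_right distrib_left exp_add)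
    finally show "(\<integral>y. iexp (c \<bullet> y) \<partial>gauss_mixture ?P w C\<^sub>2) = (\<integral>y. iexp (c \<bullet> y) \<partial>gauss_measure (w m) ?C)"
      unfolding char_gauss_mixture[OF fin wP C(2)] char_gauss_measure[OF C(3)]
      by (simp add: matrix_vector_mult_add_rdistrib inner_add_right add_divide_distrib diff_divide_distrib
          flip: of_real_mult exp_add)
  qed simp
  let ?q = "\<lambda>z. \<integral>\<^sup>+y. ennreal (gauss_density m C\<^sub>1 y * gauss_density (w y) C\<^sub>2 z) \<partial>lborel"
  have "density lborel (\<lambda>z. ennreal (gauss_density (w m) ?C z)) = density lborel ?q"
  proof (rule measure_eqI)
    fix B assume "B \<in> sets (density lborel (\<lambda>z. ennreal (gauss_density (w m) ?C z)))"
    then have [measurable]: "B \<in> sets borel"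
      by simp
    have "emeasure (density lborel (\<lambda>z. ennreal (gauss_density (w m) ?C z))) B = emeasure (gauss_mixture ?P w C\<^sub>2) B"
      unfolding mix by (simp add: gauss_measure_def)
    also have "\<dots> = (\<integral>\<^sup>+y. emeasure (gauss_measure (w y) C\<^sub>2) B \<partial>?P)"
      by (rule emeasure_gauss_mixture[OF fin wP C(2)]) measurable
    also have "\<dots> = (\<integral>\<^sup>+y. (\<integral>\<^sup>+z. ennreal (gauss_density m C\<^sub>1 y) * (ennreal (gauss_density (w y) C\<^sub>2 z) * indicator B z) \<partial>lborel) \<partial>lborel)"
      using measurable_emeasure_gauss_measure[OF C(2) \<open>B \<in> sets borel\<close>]
      by (subst gauss_measure_def[of m], subst nn_integral_density)
        (auto simp: nn_integral_cmult gauss_measure_def emeasure_density)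
    also have "\<dots> = (\<integral>\<^sup>+z. (\<integral>\<^sup>+y. ennreal (gauss_density m C\<^sub>1 y) * (ennreal (gauss_density (w y) C\<^sub>2 z) * indicator B z) \<partial>lborel) \<partial>lborel)"
      by (rule lborel_pair.Fubini') measurable
    also have "\<dots> = (\<integral>\<^sup>+z. ?q z * indicator B z \<partial>lborel)"
      by (intro nn_integral_cong, subst nn_integral_multc[symmetric])
        (simp_all add: ennreal_mult gauss_density_nonneg C mult.assoc)
    also have "\<dots> = emeasure (density lborel ?q) B"
      by (simp add: emeasure_density)
    finally show "emeasure (density lborel (\<lambda>z. ennreal (gauss_density (w m) ?C z))) B = emeasure (density lborel ?q) B" .
  qed simp
  then show ?thesis
    by (rule sigma_finite_measure.density_unique[OF sigma_finite_lborel, rotated 2]) simp_all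
qed

section \<open>Transformations of Gauss vectors and convergence\<close>

lemma normal_char_cong:
  "(\<And>\<omega>. \<omega> \<in> space M \<Longrightarrow> X \<omega> = Y \<omega>) \<Longrightarrow> normal_char M X \<mu> v \<longleftrightarrow> normal_char M Y \<mu> v"
  unfolding normal_char_def
  by (intro conj_cong measurable_cong refl all_cong1 arg_cong2[where f="(=)"] Bochner_Integration.integral_cong) auto

lemma gauss_char_cong:
  "(\<And>\<omega>. \<omega> \<in> space M \<Longrightarrow> X \<omega> = Y \<omega>) \<Longrightarrow> gauss_char M X m C \<longleftrightarrow> gauss_char M Y m C"
  unfolding gauss_char_def
  by (intro conj_cong measurable_cong refl all_cong1 normal_char_cong) auto

lemma normal_char_affine:
  assumes "normal_char M Y \<mu> v"
  shows "normal_char M (\<lambda>\<omega>. k + d * Y \<omega>) (k + d * \<mu>) (d\<^sup>2 * v)"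
  unfolding normal_char_def
proof (intro conjI allI)
  note [measurable] = normal_charD(1)[OF assms]
  show "(\<lambda>\<omega>. k + d * Y \<omega>) \<in> borel_measurable M"
    by measurable
  show "0 \<le> d\<^sup>2 * v"
    using normal_charD(2)[OF assms] by simp
  fix t
  have "(\<integral>\<omega>. iexp (t * (k + d * Y \<omega>)) \<partial>M) = (\<integral>\<omega>. iexp (t * k) * iexp ((t * d) * Y \<omega>) \<partial>M)"
    by (simp add: distrib_left exp_add ac_simps)
  also have "\<dots> = iexp (t * k) * (iexp ((t * d) * \<mu>) * exp (- (v * (t * d)\<^sup>2) / 2))"
    by (simp only: integral_mult_right_zero normal_charD(3)[OF assms])
  finally show "(\<integral>\<omega>. iexp (t * (k + d * Y \<omega>)) \<partial>M) = iexp (t * (k + d * \<mu>)) * exp (- (d\<^sup>2 * v * t\<^sup>2) / 2)"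
    by (simp add: distrib_left exp_add ac_simps power_mult_distrib)
qed

lemma (in prob_space) gauss_vector_real_if_normal_char:
  assumes Y: "normal_char M (Y :: 'a \<Rightarrow> real) \<mu> v"
  shows "gauss_vector M Y"
  unfolding gauss_vector_def
proof (intro conjI allI)
  show "Y \<in> borel_measurable M"
    by (rule normal_charD(1)[OF Y])
  fix c
  have "normal_char M (\<lambda>\<omega>. c \<bullet> Y \<omega>) (c * \<mu>) (c\<^sup>2 * v)"
    using normal_char_affine[OF Y, of 0 c] by simp
  then show "\<exists>\<mu> \<sigma>. 0 \<le> \<sigma> \<and> distr M borel (\<lambda>\<omega>. c \<bullet> Y \<omega>) = normal_law \<mu> \<sigma>"
    using normal_char_distr normal_charD(2) real_sqrt_ge_zero by blast
qed

lemma gauss_char_affine: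
  fixes A :: "real^'n^'n"
  assumes X: "gauss_char M X m C"
  shows "gauss_char M (\<lambda>\<omega>. v + A *v X \<omega>) (v + A *v m) (A ** C ** transpose A)"
  unfolding gauss_char_def
proof (intro conjI allI)
  have [measurable]: "X \<in> borel_measurable M"
    using X by (simp add: gauss_char_def)
  show "(\<lambda>\<omega>. v + A *v X \<omega>) \<in> borel_measurable M"
    by measurable
  fix c
  have "normal_char M (\<lambda>\<omega>. (transpose A *v c) \<bullet> X \<omega>) ((transpose A *v c) \<bullet> m) ((transpose A *v c) \<bullet> (C *v (transpose A *v c)))"
    using X by (simp only: gauss_char_def)
  from normal_char_affine[OF this, of "c \<bullet> v" 1]
  show "normal_char M (\<lambda>\<omega>. c \<bullet> (v + A *v X \<omega>)) (c \<bullet> (v + A *v m)) (c \<bullet> (A ** C ** transpose A *v c))"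
    unfolding inner_transpose_left matrix_vector_mul_assoc[symmetric] by (simp add: inner_add_right)
qed

text \<open>Replacing \<open>c\<close> by its multiple with \<open>t\<close> recovers the whole
  characteristic function of the functional from its value at 1.\<close>

lemma gauss_charI:
  fixes X :: "'a \<Rightarrow> real^'n"
  assumes "X \<in> borel_measurable M" "\<And>c. 0 \<le> c \<bullet> (C *v c)"
    and char: "\<And>c. (\<integral>\<omega>. iexp (c \<bullet> X \<omega>) \<partial>M) = exp (- (c \<bullet> (C *v c)) / 2)"
  shows "gauss_char M X 0 C"
  unfolding gauss_char_def normal_char_def
proof (intro conjI allI)
  fix c t
  show "(\<integral>\<omega>. iexp (t * (c \<bullet> X \<omega>)) \<partial>M) = iexp (t * (c \<bullet> 0)) * exp (- (c \<bullet> (C *v c) * t\<^sup>2) / 2)"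
    using char[of "t *\<^sub>R c"] by (simp add: matrix_vector_mult_scaleR power2_eq_square ac_simps)
qed (use assms in auto)

lemma norm_add_square_le: "(norm (x + y))\<^sup>2 \<le> 2 * (norm x)\<^sup>2 + 2 * (norm y)\<^sup>2"
proof -
  have "(norm (x + y))\<^sup>2 \<le> (norm x + norm y)\<^sup>2"
    by (intro power_mono norm_triangle_ineq) simp
  also have "\<dots> \<le> 2 * (norm x)\<^sup>2 + 2 * (norm y)\<^sup>2"
    using zero_le_power2[of "norm x - norm y"] by (simp add: power2_sum power2_diff)
  finally show ?thesis .
qed

lemma (in prob_space) gauss_char_square_integrable:
  fixes X :: "'a \<Rightarrow> real^'n"
  assumes X: "gauss_char M X m C"
  shows "square_integrable M X"
proof -
  have [measurable]: "X \<in> borel_measurable M"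
    using X by (simp add: gauss_char_def)
  have "(\<integral>\<^sup>+\<omega>. ennreal ((norm (X \<omega> - m))\<^sup>2) \<partial>M) < \<infinity>"
    by (simp add: gauss_char_norm2[OF X])
  then have "integrable M (\<lambda>\<omega>. (norm (X \<omega> - m))\<^sup>2)"
    by (intro integrableI_nonneg) auto
  then have "integrable M (\<lambda>\<omega>. 2 * (norm (X \<omega> - m))\<^sup>2 + 2 * (norm m)\<^sup>2)"
    by simp
  then have "integrable M (\<lambda>\<omega>. (norm (X \<omega>))\<^sup>2)"
  proof (rule Bochner_Integration.integrable_bound)
    show "AE \<omega> in M. norm ((norm (X \<omega>))\<^sup>2) \<le> norm (2 * (norm (X \<omega> - m))\<^sup>2 + 2 * (norm m)\<^sup>2)"
    proof (rule AE_I2)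
      fix \<omega>
      show "norm ((norm (X \<omega>))\<^sup>2) \<le> norm (2 * (norm (X \<omega> - m))\<^sup>2 + 2 * (norm m)\<^sup>2)"
        using norm_add_square_le[of "X \<omega> - m" m] by simp
    qed
  qed simp
  then show ?thesis
    by (simp add: square_integrable_def)
qed

text \<open>Chebyshev's inequality.\<close>

lemma (in prob_space) tendsto_prob_if_tendsto_L2:
  fixes X :: "'i \<Rightarrow> 'a \<Rightarrow> 'b::euclidean_space"
  assumes L2: "tendsto_L2 M X Y G"
  shows "tendsto_prob M X Y G"
proof -
  have ev: "\<forall>\<^sub>F i in G. X i \<in> borel_measurable M"
    using L2 unfolding tendsto_L2_def square_integrable_def by (auto elim: eventually_mono)
  have Y: "Y \<in> borel_measurable M"
    using L2 by (simp add: tendsto_L2_def square_integrable_def)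
  have lim: "((\<lambda>i. \<integral>\<^sup>+\<omega>. ennreal ((norm (X i \<omega> - Y \<omega>))\<^sup>2) \<partial>M) \<longlongrightarrow> 0) G"
    using L2 by (simp add: tendsto_L2_def)
  have "((\<lambda>i. measure M {\<omega> \<in> space M. \<epsilon> < dist (X i \<omega>) (Y \<omega>)}) \<longlongrightarrow> 0) G" if "0 < \<epsilon>" for \<epsilon>
  proof -
    let ?I = "\<lambda>i. \<integral>\<^sup>+\<omega>. ennreal ((norm (X i \<omega> - Y \<omega>))\<^sup>2) \<partial>M"
    have "((\<lambda>i. ennreal (1 / \<epsilon>\<^sup>2) * ?I i) \<longlongrightarrow> ennreal (1 / \<epsilon>\<^sup>2) * 0) G"
      by (intro ennreal_tendsto_cmult lim) simp
    then have up: "((\<lambda>i. ennreal (1 / \<epsilon>\<^sup>2) * ?I i) \<longlongrightarrow> 0) G"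
      by simp
    have "((\<lambda>i. emeasure M {\<omega> \<in> space M. \<epsilon> < dist (X i \<omega>) (Y \<omega>)}) \<longlongrightarrow> 0) G"
    proof (rule tendsto_sandwich[OF _ _ tendsto_const up])
      show "\<forall>\<^sub>F i in G. emeasure M {\<omega> \<in> space M. \<epsilon> < dist (X i \<omega>) (Y \<omega>)} \<le> ennreal (1 / \<epsilon>\<^sup>2) * ?I i"
        using ev
      proof eventually_elim
        case (elim i)
        note [measurable] = elim Y
        have "emeasure M {\<omega> \<in> space M. \<epsilon> < dist (X i \<omega>) (Y \<omega>)} =
            (\<integral>\<^sup>+\<omega>. indicator {\<omega> \<in> space M. \<epsilon> < dist (X i \<omega>) (Y \<omega>)} \<omega> \<partial>M)"
          by simp
        also have "\<dots> \<le> (\<integral>\<^sup>+\<omega>. ennreal (1 / \<epsilon>\<^sup>2) * ennreal ((norm (X i \<omega> - Y \<omega>))\<^sup>2) \<partial>M)"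
        proof (rule nn_integral_mono)
          fix \<omega>
          show "indicator {\<omega> \<in> space M. \<epsilon> < dist (X i \<omega>) (Y \<omega>)} \<omega> \<le> ennreal (1 / \<epsilon>\<^sup>2) * ennreal ((norm (X i \<omega> - Y \<omega>))\<^sup>2)"
          proof (cases "\<epsilon> < dist (X i \<omega>) (Y \<omega>)")
            case True
            then have "\<epsilon>\<^sup>2 \<le> (norm (X i \<omega> - Y \<omega>))\<^sup>2"
              using that by (intro power_mono) (auto simp: dist_norm)
            then have "1 \<le> 1 / \<epsilon>\<^sup>2 * (norm (X i \<omega> - Y \<omega>))\<^sup>2"
              using that by (simp add: field_simps)
            then show ?thesis
              by (simp add: indicator_def ennreal_mult[symmetric] flip: ennreal_1)
          qed simp
        qed
        also have "\<dots> = ennreal (1 / \<epsilon>\<^sup>2) * ?I i"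
          by (rule nn_integral_cmult) measurable
        finally show ?case .
      qed
    qed simp
    then have "((\<lambda>i. ennreal (measure M {\<omega> \<in> space M. \<epsilon> < dist (X i \<omega>) (Y \<omega>)})) \<longlongrightarrow> ennreal 0) G"
      by (simp add: emeasure_eq_measure)
    then show ?thesis
      by (subst (asm) tendsto_ennreal_iff) simp_all
  qed
  then show ?thesis
    using ev Y by (simp add: tendsto_prob_def)
qed

section \<open>The bridge process\<close>

locale bridge_process = bridge_data Q Sg r E T + wiener_space M F B
  for Q :: "real \<Rightarrow> real^'d^'d" and Sg :: "real \<Rightarrow> real^'p^'d" and r :: "real \<Rightarrow> real^'d"
    and E :: "real \<Rightarrow> real \<Rightarrow> real^'d^'d" and T :: real
    and M :: "'a measure" and F :: "real \<Rightarrow> 'a measure" and B :: "real \<Rightarrow> 'a \<Rightarrow> real^'p" +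
  fixes J U :: "real \<Rightarrow> 'a \<Rightarrow> real^'d" and a b :: "real^'d"
  assumes ito: "ito_integral M F B T (\<lambda>u \<omega>. matrix_inv (Gam E Sg u T) ** Sg u) J"
    and U: "\<And>t \<omega>. 0 \<le> t \<Longrightarrow> t < T \<Longrightarrow> \<omega> \<in> space M \<Longrightarrow>
      U t \<omega> = bridge_mean E Sg r T a b 0 t + Gam E Sg t T *v J t \<omega>"
begin

lemma ito_H: "ito_integral M F B T (\<lambda>u _. H u) J"
  using ito by (simp add: H_def)

lemma J_measurable_F: "0 \<le> s \<Longrightarrow> s \<le> t \<Longrightarrow> s < T \<Longrightarrow> J s \<in> borel_measurable (F t)"
  using ito_H by (auto simp: ito_integral_def intro: measurable_F_mono)

lemma J_measurable [measurable]: "0 \<le> s \<Longrightarrow> s < T \<Longrightarrow> J s \<in> borel_measurable M"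
  by (rule measurable_F[OF J_measurable_F[of s s]]) auto

lemma J_continuous: "AE \<omega> in M. continuous_on {0..<T} (\<lambda>t. J t \<omega>)"
  using ito_H by (simp add: ito_integral_def)

text \<open>On [0,0] all grid points are 0 and every approximating integral vanishes, so the mean
  square limit is 0.\<close>

lemma J_0: "AE \<omega> in M. J 0 \<omega> = 0"
proof -
  have 0: "simple_integral B (Suc n) (grid 0 n) (\<lambda>j _. H (grid 0 n j)) 0 \<omega> = 0" for n \<omega>
    by (simp add: simple_integral_def grid_def)
  have "(\<lambda>n. \<integral>\<^sup>+\<omega>. ennreal ((norm (J 0 \<omega> - simple_integral B (Suc n) (grid 0 n) (\<lambda>j _. H (grid 0 n j)) 0 \<omega>))\<^sup>2) \<partial>M)
      \<longlonglongrightarrow> 0"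
    by (rule ito_integral_approximation[OF ito_H]) (use T_pos in auto)
  then have "(\<integral>\<^sup>+\<omega>. ennreal ((norm (J 0 \<omega>))\<^sup>2) \<partial>M) = 0"
    unfolding 0 by (simp add: LIMSEQ_const_iff)
  then show ?thesis
    using T_pos by (subst (asm) nn_integral_0_iff_AE) auto
qed

lemma C_nonneg:
  assumes "0 \<le> s" "s \<le> t" "t < T"
  shows "0 \<le> c \<bullet> (C s t *v c)"
  by (rule has_integral_nonneg[OF C_has_integral[OF assms]]) simp

lemma char_J_increment:
  assumes t: "0 \<le> s" "s \<le> t" "t < T"
    and Z: "Z \<in> borel_measurable (F s)" "\<And>\<omega>. \<omega> \<in> space M \<Longrightarrow> norm (Z \<omega> :: complex) \<le> 1"
  shows "expectation (\<lambda>\<omega>. Z \<omega> * iexp (c \<bullet> (J t \<omega> - J s \<omega>))) =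
    expectation Z * exp (- (c \<bullet> (C s t *v c)) / 2)"
  using char_wiener_integral_increment[OF ito_H t cont_H Z, of c]
    integral_unique[OF C_has_integral[OF t, of c]] by simp

lemma gauss_char_J_increment:
  assumes t: "0 \<le> s" "s \<le> t" "t < T"
  shows "gauss_char M (\<lambda>\<omega>. J t \<omega> - J s \<omega>) 0 (C s t)"
proof (rule gauss_charI)
  have "J s \<in> borel_measurable M" "J t \<in> borel_measurable M"
    using t by (auto intro!: J_measurable)
  then show "(\<lambda>\<omega>. J t \<omega> - J s \<omega>) \<in> borel_measurable M"
    by (rule borel_measurable_diff[rotated])
  show "0 \<le> c \<bullet> (C s t *v c)" for c
    using t by (rule C_nonneg)
  show "(\<integral>\<omega>. iexp (c \<bullet> (J t \<omega> - J s \<omega>)) \<partial>M) = exp (- (c \<bullet> (C s t *v c)) / 2)" for c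
    using char_J_increment[OF t, of "\<lambda>_. 1" c] by (simp add: prob_space)
qed

lemma gauss_char_J:
  assumes t: "0 \<le> t" "t < T"
  shows "gauss_char M (J t) 0 (C 0 t)"
proof (rule gauss_charI)
  note [measurable] = J_measurable[OF t] J_measurable[OF order_refl T_pos]
  show "J t \<in> borel_measurable M" by measurable
  show "0 \<le> c \<bullet> (C 0 t *v c)" for c
    using t by (intro C_nonneg) auto
  show "(\<integral>\<omega>. iexp (c \<bullet> J t \<omega>) \<partial>M) = exp (- (c \<bullet> (C 0 t *v c)) / 2)" for c
  proof -
    have "(\<integral>\<omega>. iexp (c \<bullet> J t \<omega>) \<partial>M) = (\<integral>\<omega>. 1 * iexp (c \<bullet> (J t \<omega> - J 0 \<omega>)) \<partial>M)"
      by (rule integral_cong_AE) (use J_0 in \<open>auto elim: eventually_mono\<close>)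
    also have "\<dots> = exp (- (c \<bullet> (C 0 t *v c)) / 2)"
      using char_J_increment[of 0 t "\<lambda>_. 1" c] t by (simp add: prob_space)
    finally show ?thesis .
  qed
qed

lemma U_eq: "0 \<le> t \<Longrightarrow> t < T \<Longrightarrow> \<omega> \<in> space M \<Longrightarrow> U t \<omega> = mean_ext a b t + Gam E Sg t T *v J t \<omega>"
  by (simp add: U bridge_mean_0_eq)

lemma gauss_char_U:
  assumes t: "0 \<le> t" "t < T"
  shows "gauss_char M (U t) (mean_ext a b t) (bridge_cov E Sg T 0 t)"
proof -
  have "gauss_char M (\<lambda>\<omega>. mean_ext a b t + Gam E Sg t T *v J t \<omega>) (mean_ext a b t + Gam E Sg t T *v 0)
      (Gam E Sg t T ** C 0 t ** transpose (Gam E Sg t T))"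
    by (rule gauss_char_affine[OF gauss_char_J[OF t]])
  then show ?thesis
    using t gauss_char_cong[of M "U t" "\<lambda>\<omega>. mean_ext a b t + Gam E Sg t T *v J t \<omega>"] U_eq[OF t]
    by (simp add: Gam_C_Gam)
qed

lemma U_measurable: "0 \<le> t \<Longrightarrow> t < T \<Longrightarrow> U t \<in> borel_measurable M"
  using gauss_char_U by (simp add: gauss_char_def)

lemma U_measurable_F:
  assumes "0 \<le> s" "s \<le> t" "s < T"
  shows "U s \<in> borel_measurable (F t)"
proof -
  have [measurable]: "J s \<in> borel_measurable (F t)"
    using assms by (rule J_measurable_F)
  have "(\<lambda>\<omega>. mean_ext a b s + Gam E Sg s T *v J s \<omega>) \<in> borel_measurable (F t)"
    by measurable
  then show ?thesis
    using assms measurable_cong[of "F t" "U s" "\<lambda>\<omega>. mean_ext a b s + Gam E Sg s T *v J s \<omega>" borel]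
    by (simp add: U_eq space_F)
qed

lemma U_0: "AE \<omega> in M. U 0 \<omega> = a"
  using J_0 AE_space
proof eventually_elim
  case (elim \<omega>)
  then show ?case
    using U_eq[of 0 \<omega>] T_pos by (simp add: mean_ext_0)
qed

text \<open>The bridge restarted at \<open>s\<close> from its current value: the propagation matrix
  takes \<open>Gam E Sg s T\<close> to \<open>Gam E Sg t T\<close>, so the past noise is reproduced
  and the only new ingredient is the increment of \<open>J\<close>.\<close>

lemma U_markov_step:
  assumes "0 \<le> s" "s \<le> t" "t < T" "\<omega> \<in> space M"
  shows "U t \<omega> = bridge_mean E Sg r T (U s \<omega>) b s t + Gam E Sg t T *v (J t \<omega> - J s \<omega>)"
proof -
  have "bridge_mean E Sg r T (U s \<omega>) b s t = bridge_mean E Sg r T (bridge_mean E Sg r T a b 0 s) b s t +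
      (\<Phi> t ** R t ** \<Lambda> s ** \<Psi> s) *v (Gam E Sg s T *v J s \<omega>)"
    using assms by (simp add: U bridge_mean_affine)
  also have "\<dots> = bridge_mean E Sg r T a b 0 t + Gam E Sg t T *v J s \<omega>"
    using assms by (simp add: bridge_mean_compose Gam_T_eq matrix_vector_mul_assoc matrix_mul_assoc_rev cancel_\<Phi>\<Psi> R\<Lambda>)
  finally show ?thesis
    using assms by (simp add: U matrix_vector_mult_diff_distrib)
qed

subsection \<open>Convergence at the end point\<close>

text \<open>\<open>X\<close> is a martingale in reversed time: its increments have covariance \<open>N s - N t\<close> for \<open>s < t\<close>.\<close>

definition X :: "real \<Rightarrow> 'a \<Rightarrow> real^'d" where
  "X t \<omega> = N t *v (transpose (\<Phi> T) *v J t \<omega>)"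

lemma X_eq: "X t \<omega> = 0 + (N t ** transpose (\<Phi> T)) *v J t \<omega>"
  unfolding X_def matrix_vector_mul_assoc by (rule add_0[symmetric])

lemma gauss_char_X:
  assumes t: "0 < t" "t < T"
  shows "gauss_char M (X t) 0 (N t)"
proof -
  have "gauss_char M (X t) (0 + (N t ** transpose (\<Phi> T)) *v 0)
      ((N t ** transpose (\<Phi> T)) ** C 0 t ** transpose (N t ** transpose (\<Phi> T)))"
    unfolding X_eq[abs_def] using t by (intro gauss_char_affine gauss_char_J) auto
  moreover have "(N t ** transpose (\<Phi> T)) ** C 0 t ** transpose (N t ** transpose (\<Phi> T)) =
      N t ** ((\<Lambda> t - \<Lambda> 0) ** N t)"
    using t T_pos by (simp add: matrix_transpose_mul C_def N_sym matrix_mul_assoc_rev cancel_\<Phi>\<Psi>)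
  ultimately show ?thesis
    by (simp add: N_inverse[OF t])
qed

text \<open>With Y = transpose (\<Phi> T) J, the variable c.(X t - X s) splits into (N t c).(Y t - Y
  s) and ((N t - N s) c).(Y s). The left side adds the variances of these independent parts. It
  collapses because \<open>N\<close> inverts \<Lambda> - \<Lambda> 0 at \<open>s\<close> and at
  \<open>t\<close>.\<close>

lemma N_increment_quadratic:
  assumes st: "0 < s" "s \<le> t" "t < T"
  shows "(N t *v c) \<bullet> ((\<Lambda> t - \<Lambda> s) *v (N t *v c)) +
    ((N t - N s) *v c) \<bullet> ((\<Lambda> s - \<Lambda> 0) *v ((N t - N s) *v c)) = c \<bullet> ((N s - N t) *v c)"
proof -
  have t: "(\<Lambda> t - \<Lambda> 0) *v (N t *v c) = c" and s: "(\<Lambda> s - \<Lambda> 0) *v (N s *v c) = c"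
    using st by (simp_all only: matrix_vector_mul_cancel[OF N_inverse(2)] less_le_trans le_less_trans)
  have split: "(\<Lambda> t - \<Lambda> s) *v (N t *v c) = c - (\<Lambda> s - \<Lambda> 0) *v (N t *v c)"
    using t by (simp add: matrix_vector_mult_diff_rdistrib algebra_simps)
  have sym: "transpose (\<Lambda> s - \<Lambda> 0) = \<Lambda> s - \<Lambda> 0"
    using st by (simp add: transpose_diff \<Lambda>_sym)
  have "(N s *v c) \<bullet> ((\<Lambda> s - \<Lambda> 0) *v (N t *v c)) = c \<bullet> (N t *v c)"
    using inner_matrix_symmetric[OF sym, of "N s *v c" "N t *v c"] s by simp
  moreover have "(\<Lambda> s - \<Lambda> 0) *v ((N t - N s) *v c) = (\<Lambda> s - \<Lambda> 0) *v (N t *v c) - c"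
    using s by (simp only: matrix_vector_mult_diff_rdistrib matrix_vector_mult_diff_distrib)
  ultimately show ?thesis
    unfolding split
    by (simp only: matrix_vector_mult_diff_rdistrib[of "N _"] inner_diff_left inner_diff_right)
      (simp add: inner_commute)
qed

lemma gauss_char_X_increment:
  assumes st: "0 < s" "s \<le> t" "t < T"
  shows "gauss_char M (\<lambda>\<omega>. X t \<omega> - X s \<omega>) 0 (N s - N t)"
proof (rule gauss_charI)
  have ts: "0 < t" "s < T"
    using st by auto
  have Js: "J s \<in> borel_measurable (F s)"
    using st by (intro J_measurable_F) auto
  show "(\<lambda>\<omega>. X t \<omega> - X s \<omega>) \<in> borel_measurable M"
    using gauss_char_X[OF ts(1) st(3)] gauss_char_X[OF st(1) ts(2)]
    by (auto simp: gauss_char_def intro: borel_measurable_diff)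
  fix c
  let ?w = "N t *v c" and ?w' = "(N t - N s) *v c"
  have C: "(\<Phi> T *v w) \<bullet> (C u v *v (\<Phi> T *v w)) = w \<bullet> ((\<Lambda> v - \<Lambda> u) *v w)" for w u v
    using T_pos by (simp add: C_quadratic_form cancel_\<Phi>\<Psi>)
  have quad: "(\<Phi> T *v ?w) \<bullet> (C s t *v (\<Phi> T *v ?w)) + (\<Phi> T *v ?w') \<bullet> (C 0 s *v (\<Phi> T *v ?w')) = c \<bullet> ((N s - N t) *v c)"
    unfolding C by (rule N_increment_quadratic[OF st])
  have "0 \<le> (\<Phi> T *v ?w) \<bullet> (C s t *v (\<Phi> T *v ?w))" "0 \<le> (\<Phi> T *v ?w') \<bullet> (C 0 s *v (\<Phi> T *v ?w'))"
    using st by (auto intro!: C_nonneg)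
  then show "0 \<le> c \<bullet> ((N s - N t) *v c)"
    unfolding quad[symmetric] by (rule add_nonneg_nonneg)
  \<comment> \<open>The part known at time \<open>s\<close> is separated from the later increment,
    so that \<open>char_J_increment\<close> applies with the former as test variable.\<close>
  have inner: "c \<bullet> (X t \<omega> - X s \<omega>) = (\<Phi> T *v ?w') \<bullet> J s \<omega> + (\<Phi> T *v ?w) \<bullet> (J t \<omega> - J s \<omega>)" for \<omega>
  proof -
    have "(\<Phi> T *v (N u *v c)) \<bullet> y = c \<bullet> (N u *v (transpose (\<Phi> T) *v y))" if "0 < u" "u < T" for u y
      using inner_matrix_symmetric[OF N_sym[OF that], of c "transpose (\<Phi> T) *v y"]
        inner_transpose_left[of "transpose (\<Phi> T)" "N u *v c" y] by (simp only: transpose_transpose)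
    from this[OF ts(1) st(3)] this[OF st(1) ts(2)] show ?thesis
      unfolding X_def
      by (simp add: matrix_vector_mult_diff_rdistrib matrix_vector_mult_diff_distrib inner_diff_left inner_diff_right
          del: transpose_matrix_vector)
  qed
  have "(\<integral>\<omega>. iexp (c \<bullet> (X t \<omega> - X s \<omega>)) \<partial>M) =
      (\<integral>\<omega>. iexp ((\<Phi> T *v ?w') \<bullet> J s \<omega>) * iexp ((\<Phi> T *v ?w) \<bullet> (J t \<omega> - J s \<omega>)) \<partial>M)"
    unfolding inner by (simp add: distrib_left exp_add)
  also have "\<dots> = (\<integral>\<omega>. iexp ((\<Phi> T *v ?w') \<bullet> J s \<omega>) \<partial>M) * exp (- ((\<Phi> T *v ?w) \<bullet> (C s t *v (\<Phi> T *v ?w))) / 2)"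
    using st Js by (intro char_J_increment) auto
  also have "(\<integral>\<omega>. iexp ((\<Phi> T *v ?w') \<bullet> J s \<omega>) \<partial>M) = exp (- ((\<Phi> T *v ?w') \<bullet> (C 0 s *v (\<Phi> T *v ?w'))) / 2)"
  proof -
    have "normal_char M (\<lambda>\<omega>. (\<Phi> T *v ?w') \<bullet> J s \<omega>) ((\<Phi> T *v ?w') \<bullet> 0) ((\<Phi> T *v ?w') \<bullet> (C 0 s *v (\<Phi> T *v ?w')))"
      using gauss_char_J[of s] st unfolding gauss_char_def by simp
    from normal_charD(3)[OF this, of 1] show ?thesis
      by simp
  qed
  finally show "(\<integral>\<omega>. iexp (c \<bullet> (X t \<omega> - X s \<omega>)) \<partial>M) = exp (- (c \<bullet> ((N s - N t) *v c)) / 2)"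
    unfolding quad[symmetric]
    by (simp add: add_divide_distrib diff_divide_distrib flip: of_real_mult exp_add)
qed

text \<open>The trace of \<open>N\<close> is the clock. The start at T / 2 keeps away from 0, where
  \<open>\<Lambda> t - \<Lambda> 0\<close> vanishes and has no inverse; the constant 3 * CARD('d) is
  that of \<open>gauss_char_norm4\<close>.\<close>

lemma X_tendsto: "AE \<omega> in M. ((\<lambda>t. X t \<omega>) \<longlongrightarrow> 0) (at_left T)"
proof (rule AE_tendsto_0_fourth_moment[where t\<^sub>0="T / 2" and c="3 * CARD('d)" and h="\<lambda>t. trace (N t)"])
  have half: "0 < t" if "T / 2 \<le> t" for t
    using that T_pos by linarith
  show "T / 2 < T"
    using T_pos by simp
  show "X t \<in> borel_measurable M" if "T / 2 \<le> t" "t < T" for t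
    using gauss_char_X[OF half[OF that(1)] that(2)] by (simp add: gauss_char_def)
  show "AE \<omega> in M. continuous_on {T / 2..<T} (\<lambda>t. X t \<omega>)"
    using J_continuous
  proof eventually_elim
    case (elim \<omega>)
    show ?case
      unfolding X_def using half
      by (intro continuous_intros continuous_on_subset[OF cont_N] continuous_on_subset[OF elim])
        (use T_pos in auto)
  qed
  have "continuous_on {T / 2..T} (\<lambda>t. trace (N t))"
    using half by (intro continuous_intros continuous_on_subset[OF cont_N]) auto
  then have "((\<lambda>t. trace (N t)) \<longlongrightarrow> trace (N T)) (at T within {T / 2..T})"
    using T_pos by (auto simp: continuous_on_def)
  moreover have "at T within {T / 2..T} = at_left T"
    using T_pos by (intro at_within_Icc_at_left) simp
  moreover have "trace (N T) = 0"
    by (simp add: N_T trace_def)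
  ultimately show "((\<lambda>t. trace (N t)) \<longlongrightarrow> 0) (at_left T)"
    by simp
  fix s t assume st: "T / 2 \<le> s" "s \<le> t" "t < T"
  note incr = gauss_char_X_increment[OF half[OF st(1)] st(2,3)]
  show "trace (N t) \<le> trace (N s)"
    using gauss_char_trace_nonneg[OF incr] by (simp add: trace_diff)
  show "(\<integral>\<^sup>+\<omega>. ennreal (norm (X t \<omega> - X s \<omega>) ^ 4) \<partial>M) \<le> ennreal (3 * CARD('d) * (trace (N s) - trace (N t))\<^sup>2)"
    using gauss_char_norm4[OF incr] by (simp add: trace_diff)
next
  fix t assume t: "T / 2 \<le> t" "t < T"
  then have "0 < t"
    using T_pos by linarith
  note X = gauss_char_X[OF this t(2)]
  show "0 \<le> trace (N t)"
    by (rule gauss_char_trace_nonneg[OF X])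
  show "(\<integral>\<^sup>+\<omega>. ennreal (norm (X t \<omega>) ^ 4) \<partial>M) \<le> ennreal (3 * CARD('d) * (trace (N t))\<^sup>2)"
    by (rule gauss_char_norm4[OF X])
qed simp

text \<open>\<open>R t ** (\<Lambda> t - \<Lambda> 0)\<close> is 1 -
  \<open>R t ** \<Lambda> 0\<close>: expressed through \<open>X\<close>, the noise of the bridge has
  coefficients that stay bounded up to \<open>T\<close>.\<close>

lemma Gam_J_eq:
  assumes t: "0 < t" "t < T"
  shows "Gam E Sg t T *v J t \<omega> = \<Phi> t *v (X t \<omega> - R t *v (\<Lambda> 0 *v X t \<omega>))"
proof -
  have "R t *v ((\<Lambda> t - \<Lambda> 0) *v X t \<omega>) = X t \<omega> - R t *v (\<Lambda> 0 *v X t \<omega>)"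
    using t by (simp add: matrix_vector_mult_diff_rdistrib matrix_vector_mult_diff_distrib R\<Lambda>)
  moreover have "(\<Lambda> t - \<Lambda> 0) *v X t \<omega> = transpose (\<Phi> T) *v J t \<omega>"
    unfolding X_def by (rule matrix_vector_mul_cancel[OF N_inverse(2)[OF t]])
  ultimately show ?thesis
    using t by (simp add: Gam_T_eq matrix_vector_mul_assoc[symmetric] del: transpose_matrix_vector)
qed

lemma U_tendsto: "AE \<omega> in M. ((\<lambda>t. U t \<omega>) \<longlongrightarrow> b) (at_left T)"
  using X_tendsto AE_space
proof eventually_elim
  case (elim \<omega>)
  have "(mean_ext a b \<longlongrightarrow> b) (at_left T)"
    using tendsto_at_left_T[OF cont_mean_ext] by (simp add: mean_ext_T)
  moreover have "(\<Phi> \<longlongrightarrow> \<Phi> T) (at_left T)" "(R \<longlongrightarrow> R T) (at_left T)"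
    using tendsto_at_left_T[OF continuous_on_subset[OF cont_\<Phi>, of "{0..T}"]]
      tendsto_at_left_T[OF cont_R] by auto
  ultimately have "((\<lambda>t. mean_ext a b t + \<Phi> t *v (X t \<omega> - R t *v (\<Lambda> 0 *v X t \<omega>))) \<longlongrightarrow>
      b + \<Phi> T *v (0 - R T *v (\<Lambda> 0 *v 0))) (at_left T)"
    by (intro tendsto_intros elim(1))
  moreover have "\<forall>\<^sub>F t in at_left T. t \<in> {0<..<T}"
    using T_pos by (rule eventually_at_leftI[rotated]) simp
  then have "\<forall>\<^sub>F t in at_left T. mean_ext a b t + \<Phi> t *v (X t \<omega> - R t *v (\<Lambda> 0 *v X t \<omega>)) = U t \<omega>"
    by eventually_elim (use elim(2) in \<open>auto simp: U_eq Gam_J_eq\<close>)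
  ultimately show ?case
    by (auto elim: Lim_transform_eventually)
qed

section \<open>The extension of the bridge to the closed interval\<close>

definition V :: "real \<Rightarrow> 'a \<Rightarrow> real^'d" where
  "V t \<omega> = (if t < T then U t \<omega> else b)"

lemma V_U: "t < T \<Longrightarrow> V t = U t"
  by (simp add: V_def fun_eq_iff)

lemma V_T: "V T \<omega> = b"
  by (simp add: V_def)

lemma V_measurable: "0 \<le> t \<Longrightarrow> V t \<in> borel_measurable M"
  by (cases "t < T") (simp_all add: V_def[abs_def] U_measurable)

lemma at_within_left_part: "t < T \<Longrightarrow> at t within {0..T} = at t within {0..<T}"
  by (rule at_within_nhd[of t "{..<T}"]) auto

lemma V_continuous: "AE \<omega> in M. continuous_on {0..T} (\<lambda>t. V t \<omega>)"
  using J_continuous U_tendsto AE_space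
proof eventually_elim
  case (elim \<omega>)
  have "continuous_on {0..<T} (\<lambda>t. mean_ext a b t + Gam E Sg t T *v J t \<omega>)"
    by (intro continuous_intros elim(1) continuous_on_subset[OF cont_mean_ext]
        continuous_on_subset[OF cont_Gam_T]) auto
  then have cont: "continuous_on {0..<T} (\<lambda>t. V t \<omega>)"
    by (rule continuous_on_eq) (use elim(3) in \<open>auto simp: V_def U_eq\<close>)
  have lim_T: "((\<lambda>t. V t \<omega>) \<longlongrightarrow> V T \<omega>) (at_left T)"
  proof (rule Lim_transform_eventually)
    show "((\<lambda>t. U t \<omega>) \<longlongrightarrow> V T \<omega>) (at_left T)"
      using elim(2) by (simp add: V_T)
    show "\<forall>\<^sub>F t in at_left T. U t \<omega> = V t \<omega>"
      by (simp add: eventually_at_filter V_def)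
  qed
  show ?case
    unfolding continuous_on_def
  proof
    fix t assume t: "t \<in> {0..T}"
    show "((\<lambda>t. V t \<omega>) \<longlongrightarrow> V t \<omega>) (at t within {0..T})"
    proof (cases "t < T")
      case True
      then show ?thesis
        using cont t unfolding continuous_on_def by (simp add: at_within_left_part)
    next
      case False
      then show ?thesis
        using lim_T t T_pos by (simp add: at_within_Icc_at_left)
    qed
  qed
qed

lemma V_square_integrable: "0 \<le> t \<Longrightarrow> square_integrable M (V t)"
proof (cases "t < T")
  case True
  assume "0 \<le> t"
  then show ?thesis
    using True gauss_char_square_integrable[OF gauss_char_U] by (simp add: V_U)
next
  case False
  then show ?thesis
    by (simp add: V_def[abs_def] square_integrable_def)
qed

text \<open>Continuity in mean square concerns times on both sides of \<open>s\<close>; since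
  \<open>C s t\<close> changes sign when its arguments are exchanged, the absolute value covers both
  orders.\<close>

lemma J_increment_norm2:
  assumes "0 \<le> s" "s < T" "0 \<le> t" "t < T"
  shows "(\<integral>\<^sup>+\<omega>. ennreal ((norm (J t \<omega> - J s \<omega>))\<^sup>2) \<partial>M) = ennreal \<bar>trace (C s t)\<bar>"
proof -
  have *: "(\<integral>\<^sup>+\<omega>. ennreal ((norm (J t \<omega> - J s \<omega>))\<^sup>2) \<partial>M) = ennreal \<bar>trace (C s t)\<bar>"
    if st: "0 \<le> s" "s \<le> t" "t < T" for s t
    using gauss_char_norm2[OF gauss_char_J_increment[OF st]]
      gauss_char_trace_nonneg[OF gauss_char_J_increment[OF st]] by simp
  show ?thesis
  proof (cases "s \<le> t")
    case True
    then show ?thesis using assms by (intro *) auto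
  next
    case False
    have "C s t = 0 - C t s"
      by (simp add: C_def matrix_diff_ldistrib matrix_diff_rdistrib)
    then have "\<bar>trace (C s t)\<bar> = \<bar>trace (C t s)\<bar>"
      by (simp only: trace_diff) (simp add: trace_def)
    then show ?thesis
      using False assms *[of t s] by (simp add: norm_minus_commute)
  qed
qed

text \<open>Before \<open>T\<close> the difference splits into a mean part, an increment of
  \<open>J\<close>, and an increment of the deterministic factor applied to \<open>J s\<close>. At
  \<open>T\<close> there is no value of \<open>J\<close> to compare with, and the covariance of
  \<open>U t\<close> itself is shown to vanish.\<close>

lemma V_tendsto_L2:
  assumes s: "s \<in> {0..T}"
  shows "tendsto_L2 M V (V s) (at s within {0..T})"
  unfolding tendsto_L2_def
proof (intro conjI)
  have in_I: "\<forall>\<^sub>F t in at s within {0..T}. t \<in> {0..T}"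
    by (simp add: eventually_at_filter)
  then show "\<forall>\<^sub>F t in at s within {0..T}. square_integrable M (V t)"
    by eventually_elim (auto intro: V_square_integrable)
  show "square_integrable M (V s)"
    using s by (intro V_square_integrable) auto
  show "((\<lambda>t. \<integral>\<^sup>+\<omega>. ennreal ((norm (V t \<omega> - V s \<omega>))\<^sup>2) \<partial>M) \<longlongrightarrow> 0) (at s within {0..T})"
  proof (cases "s < T")
    case True
    obtain k where k: "0 < k" "\<And>(A :: real^'d^'d) (x :: real^'d). norm (A *v x) \<le> norm A * norm x * k"
      using bounded_bilinear.pos_bounded[OF bounded_bilinear_matrix_vector_mult] by metis
    have k2: "(norm (A *v x))\<^sup>2 \<le> (norm A * k)\<^sup>2 * (norm x)\<^sup>2" for A :: "real^'d^'d" and x :: "real^'d"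
    proof -
      have "(norm (A *v x))\<^sup>2 \<le> (norm A * norm x * k)\<^sup>2"
        by (intro power_mono k(2)) simp
      then show ?thesis
        by (simp add: power_mult_distrib ac_simps)
    qed
    let ?m = "mean_ext a b" and ?\<Gamma> = "\<lambda>t. Gam E Sg t T"
    \<comment> \<open>A continuous majorant that vanishes at \<open>s\<close>; the mean passes
      through \<open>norm_add_square_le\<close> once, the two noise terms twice, hence 2 and
      4.\<close>
    define f where "f t = 2 * (norm (?m t - ?m s))\<^sup>2 + (4 * (norm (?\<Gamma> t) * k)\<^sup>2 * \<bar>trace (C s t)\<bar> +
        4 * (norm (?\<Gamma> t - ?\<Gamma> s) * k)\<^sup>2 * trace (C 0 s))" for t
    have s0: "0 \<le> s"
      using s by simp
    have trs: "0 \<le> trace (C 0 s)"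
      using gauss_char_trace_nonneg[OF gauss_char_J[OF s0 True]] .
    have le: "(\<integral>\<^sup>+\<omega>. ennreal ((norm (V t \<omega> - V s \<omega>))\<^sup>2) \<partial>M) \<le> ennreal (f t)" if t: "t \<in> {0..<T}" for t
    proof -
      have t': "0 \<le> t" "t < T"
        using t by auto
      note [measurable] = J_measurable[OF t'] J_measurable[OF s0 True]
      have "(norm (V t \<omega> - V s \<omega>))\<^sup>2 \<le> 2 * (norm (?m t - ?m s))\<^sup>2 + (4 * (norm (?\<Gamma> t) * k)\<^sup>2 * (norm (J t \<omega> - J s \<omega>))\<^sup>2 +
          4 * (norm (?\<Gamma> t - ?\<Gamma> s) * k)\<^sup>2 * (norm (J s \<omega>))\<^sup>2)" if "\<omega> \<in> space M" for \<omega>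
      proof -
        have eq: "V t \<omega> - V s \<omega> = (?m t - ?m s) + (?\<Gamma> t *v (J t \<omega> - J s \<omega>) + (?\<Gamma> t - ?\<Gamma> s) *v J s \<omega>)"
          using t' s0 True that
          by (simp add: V_U U_eq matrix_vector_mult_diff_rdistrib matrix_vector_mult_diff_distrib)
        show ?thesis
          unfolding eq mult.assoc
          using norm_add_square_le[of "?m t - ?m s" "?\<Gamma> t *v (J t \<omega> - J s \<omega>) + (?\<Gamma> t - ?\<Gamma> s) *v J s \<omega>"]
            norm_add_square_le[of "?\<Gamma> t *v (J t \<omega> - J s \<omega>)" "(?\<Gamma> t - ?\<Gamma> s) *v J s \<omega>"]
            k2[of "?\<Gamma> t" "J t \<omega> - J s \<omega>"] k2[of "?\<Gamma> t - ?\<Gamma> s" "J s \<omega>"]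
          by linarith
      qed
      then have "(\<integral>\<^sup>+\<omega>. ennreal ((norm (V t \<omega> - V s \<omega>))\<^sup>2) \<partial>M) \<le>
          (\<integral>\<^sup>+\<omega>. ennreal (2 * (norm (?m t - ?m s))\<^sup>2 + (4 * (norm (?\<Gamma> t) * k)\<^sup>2 * (norm (J t \<omega> - J s \<omega>))\<^sup>2 +
            4 * (norm (?\<Gamma> t - ?\<Gamma> s) * k)\<^sup>2 * (norm (J s \<omega>))\<^sup>2)) \<partial>M)"
        by (intro nn_integral_mono ennreal_leI)
      also have "\<dots> = (\<integral>\<^sup>+\<omega>. ennreal (2 * (norm (?m t - ?m s))\<^sup>2) + (ennreal (4 * (norm (?\<Gamma> t) * k)\<^sup>2) * ennreal ((norm (J t \<omega> - J s \<omega>))\<^sup>2) +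
            ennreal (4 * (norm (?\<Gamma> t - ?\<Gamma> s) * k)\<^sup>2) * ennreal ((norm (J s \<omega>))\<^sup>2)) \<partial>M)"
        by (simp add: ennreal_plus[symmetric] ennreal_mult[symmetric] del: ennreal_plus)
      also have "\<dots> = ennreal (2 * (norm (?m t - ?m s))\<^sup>2) + (ennreal (4 * (norm (?\<Gamma> t) * k)\<^sup>2) * ennreal \<bar>trace (C s t)\<bar> +
            ennreal (4 * (norm (?\<Gamma> t - ?\<Gamma> s) * k)\<^sup>2) * ennreal (trace (C 0 s)))"
        using J_increment_norm2[OF s0 True t'] gauss_char_norm2[OF gauss_char_J[OF s0 True]]
        by (simp add: nn_integral_add nn_integral_cmult emeasure_space_1)
      also have "\<dots> = ennreal (f t)"
        using trs by (simp add: f_def ennreal_plus[symmetric] ennreal_mult[symmetric] del: ennreal_plus)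
      finally show ?thesis .
    qed
    have "continuous_on {0..<T} f"
      unfolding f_def
      by (intro continuous_intros continuous_on_subset[OF cont_mean_ext] continuous_on_subset[OF cont_Gam_T] cont_C) auto
    then have "(f \<longlongrightarrow> f s) (at s within {0..T})"
      using s True by (auto simp: continuous_on_def at_within_left_part)
    moreover have "f s = 0"
      by (simp add: f_def C_same) (simp add: trace_def)
    ultimately have "((\<lambda>t. ennreal (f t)) \<longlongrightarrow> ennreal 0) (at s within {0..T})"
      by (intro tendsto_ennrealI) simp
    then have lim: "((\<lambda>t. ennreal (f t)) \<longlongrightarrow> 0) (at s within {0..T})"
      by simp
    have ev: "\<forall>\<^sub>F t in at s within {0..T}. t \<in> {0..<T}"
      using True by (simp add: at_within_left_part eventually_at_filter)
    show ?thesis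
    proof (rule tendsto_sandwich[OF _ _ tendsto_const lim])
      show "\<forall>\<^sub>F t in at s within {0..T}. (\<integral>\<^sup>+\<omega>. ennreal ((norm (V t \<omega> - V s \<omega>))\<^sup>2) \<partial>M) \<le> ennreal (f t)"
        using ev by eventually_elim (rule le)
    qed simp
  next
    case False
    then have sT: "s = T"
      using s by simp
    \<comment> \<open>The covariance is rewritten as R t - R t \<Lambda>(0) R t, free of
      \<open>\<Lambda> t\<close>, and so is continuous at \<open>T\<close>.\<close>
    define f where "f t = 2 * (norm (mean_ext a b t - b))\<^sup>2 + 2 * trace (\<Phi> t ** (R t - R t ** \<Lambda> 0 ** R t) ** transpose (\<Phi> t))" for t
    have le: "(\<integral>\<^sup>+\<omega>. ennreal ((norm (V t \<omega> - V s \<omega>))\<^sup>2) \<partial>M) \<le> ennreal (f t)" if t: "t \<in> {0..<T}" for t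
    proof -
      have t': "0 \<le> t" "t < T"
        using t by auto
      have cov: "bridge_cov E Sg T 0 t = \<Phi> t ** (R t - R t ** \<Lambda> 0 ** R t) ** transpose (\<Phi> t)"
        using t' T_pos by (simp add: bridge_cov_eq S_eq matrix_diff_ldistrib matrix_diff_rdistrib R\<Lambda> matrix_mul_assoc_rev)
      have tr: "0 \<le> trace (bridge_cov E Sg T 0 t)"
        by (rule gauss_char_trace_nonneg[OF gauss_char_U[OF t']])
      note [measurable] = U_measurable[OF t']
      have "(\<integral>\<^sup>+\<omega>. ennreal ((norm (V t \<omega> - V s \<omega>))\<^sup>2) \<partial>M) \<le>
          (\<integral>\<^sup>+\<omega>. ennreal (2 * (norm (mean_ext a b t - b))\<^sup>2 + 2 * (norm (U t \<omega> - mean_ext a b t))\<^sup>2) \<partial>M)"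
      proof (intro nn_integral_mono ennreal_leI)
        fix \<omega>
        have "V t \<omega> - V s \<omega> = (mean_ext a b t - b) + (U t \<omega> - mean_ext a b t)"
          using t' by (simp add: sT V_T V_U)
        then show "(norm (V t \<omega> - V s \<omega>))\<^sup>2 \<le> 2 * (norm (mean_ext a b t - b))\<^sup>2 + 2 * (norm (U t \<omega> - mean_ext a b t))\<^sup>2"
          using norm_add_square_le[of "mean_ext a b t - b" "U t \<omega> - mean_ext a b t"] by simp
      qed
      also have "\<dots> = (\<integral>\<^sup>+\<omega>. ennreal (2 * (norm (mean_ext a b t - b))\<^sup>2) + ennreal 2 * ennreal ((norm (U t \<omega> - mean_ext a b t))\<^sup>2) \<partial>M)"
        by (simp add: ennreal_plus[symmetric] ennreal_mult[symmetric] del: ennreal_plus ennreal_numeral)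
      also have "\<dots> = ennreal (2 * (norm (mean_ext a b t - b))\<^sup>2) + ennreal 2 * ennreal (trace (bridge_cov E Sg T 0 t))"
        using gauss_char_norm2[OF gauss_char_U[OF t']]
        by (simp add: nn_integral_add nn_integral_cmult emeasure_space_1 del: ennreal_numeral)
      also have "\<dots> = ennreal (f t)"
        using tr by (simp add: f_def cov[symmetric] ennreal_plus[symmetric] ennreal_mult[symmetric] del: ennreal_plus ennreal_numeral)
      finally show ?thesis .
    qed
    have "continuous_on {0..T} f"
      unfolding f_def
      by (intro continuous_intros cont_mean_ext cont_R continuous_on_subset[OF cont_\<Phi>]) auto
    then have "(f \<longlongrightarrow> f T) (at_left T)"
      by (rule tendsto_at_left_T)
    moreover have "f T = 0"
      by (simp add: f_def mean_ext_T R_T) (simp add: trace_def)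
    ultimately have "((\<lambda>t. ennreal (f t)) \<longlongrightarrow> ennreal 0) (at_left T)"
      by (intro tendsto_ennrealI) simp
    then have lim: "((\<lambda>t. ennreal (f t)) \<longlongrightarrow> 0) (at_left T)"
      by simp
    have ev: "\<forall>\<^sub>F t in at_left T. t \<in> {0..<T}"
      unfolding at_left_T_eq by (simp add: eventually_at_filter)
    have "at s within {0..T} = at_left T"
      using T_pos by (simp add: sT at_within_Icc_at_left)
    then show ?thesis
      using tendsto_sandwich[OF _ eventually_mono[OF ev le] tendsto_const lim] by simp
  qed
qed

lemma U_tendsto_L2: "tendsto_L2 M U (\<lambda>_. b) (at_left T)"
proof -
  have V: "tendsto_L2 M V (\<lambda>_. b) (at_left T)"
    using V_tendsto_L2[of T] T_pos by (simp add: V_T[abs_def] at_within_Icc_at_left)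
  have ev: "\<forall>\<^sub>F t in at_left T. V t = U t"
    by (simp add: eventually_at_filter V_U)
  have "\<forall>\<^sub>F t in at_left T. square_integrable M (U t)"
    using V ev unfolding tendsto_L2_def by (auto elim: eventually_elim2)
  moreover have "((\<lambda>t. \<integral>\<^sup>+\<omega>. ennreal ((norm (U t \<omega> - b))\<^sup>2) \<partial>M) \<longlongrightarrow> 0) (at_left T)"
  proof (rule Lim_transform_eventually)
    show "((\<lambda>t. \<integral>\<^sup>+\<omega>. ennreal ((norm (V t \<omega> - b))\<^sup>2) \<partial>M) \<longlongrightarrow> 0) (at_left T)"
      using V by (simp add: tendsto_L2_def)
    show "\<forall>\<^sub>F t in at_left T. (\<integral>\<^sup>+\<omega>. ennreal ((norm (V t \<omega> - b))\<^sup>2) \<partial>M) = (\<integral>\<^sup>+\<omega>. ennreal ((norm (U t \<omega> - b))\<^sup>2) \<partial>M)"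
      using ev by eventually_elim simp
  qed
  ultimately show ?thesis
    using V by (simp add: tendsto_L2_def)
qed

subsection \<open>The Gauss property\<close>

text \<open>Induction on the latest time \<open>m\<close>: the term d m . J m is split at the
  previous time \<open>s\<close> into d m . J s, which joins the earlier sum, and an increment
  independent of that sum. Variances then add.\<close>

lemma J_combination_normal:
  assumes "finite I" "I \<subseteq> {0..<T}"
  shows "\<exists>v. normal_char M (\<lambda>\<omega>. \<Sum>t\<in>I. d t \<bullet> J t \<omega>) 0 v"
  using assms
proof (induction I arbitrary: d rule: finite_linorder_max_induct)
  case empty
  show ?case
    by (intro exI[of _ 0]) (simp add: normal_char_def prob_space)
next
  case (insert m I)
  have m: "0 \<le> m" "m < T"
    using insert.prems by auto
  show ?case
  proof (cases "I = {}")
    case True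
    then show ?thesis
      using gauss_char_J[OF m] by (auto simp: gauss_char_def)
  next
    case False
    define s where "s = Max I"
    have s: "s \<in> I" "\<And>t. t \<in> I \<Longrightarrow> t \<le> s"
      using insert.hyps(1) False by (auto simp: s_def)
    then have sm: "0 \<le> s" "s \<le> m" "s < T"
      using insert by (auto intro: less_imp_le)
    define d' where "d' = d(s := d s + d m)"
    obtain v where v: "normal_char M (\<lambda>\<omega>. \<Sum>t\<in>I. d' t \<bullet> J t \<omega>) 0 v"
      using insert by blast
    have split: "(\<Sum>t\<in>insert m I. d t \<bullet> J t \<omega>) = (\<Sum>t\<in>I. d' t \<bullet> J t \<omega>) + d m \<bullet> (J m \<omega> - J s \<omega>)" for \<omega>
    proof -
      have "(\<Sum>t\<in>I. d' t \<bullet> J t \<omega>) = (\<Sum>t\<in>I. d t \<bullet> J t \<omega>) + d m \<bullet> J s \<omega>"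
        using insert.hyps(1) s(1) by (simp add: sum.remove[of I s] d'_def inner_add_left)
      then show ?thesis
        using insert.hyps by (subst sum.insert) (auto simp: inner_diff_right)
    qed
    have J_F [measurable]: "J t \<in> borel_measurable (F s)" if "t \<in> I" for t
      using that s insert.prems by (intro J_measurable_F) auto
    let ?q = "d m \<bullet> (C s m *v d m)"
    have "normal_char M (\<lambda>\<omega>. \<Sum>t\<in>insert m I. d t \<bullet> J t \<omega>) 0 (v + ?q)"
      unfolding normal_char_def
    proof (intro conjI allI)
      show "(\<lambda>\<omega>. \<Sum>t\<in>insert m I. d t \<bullet> J t \<omega>) \<in> borel_measurable M"
        using insert.prems by (intro borel_measurable_sum borel_measurable_inner J_measurable) auto
      show "0 \<le> v + ?q"
        using normal_charD(2)[OF v] C_nonneg[OF sm(1,2) m(2)] by simp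
      fix \<tau>
      have "(\<integral>\<omega>. iexp (\<tau> * (\<Sum>t\<in>insert m I. d t \<bullet> J t \<omega>)) \<partial>M) =
          (\<integral>\<omega>. iexp (\<tau> * (\<Sum>t\<in>I. d' t \<bullet> J t \<omega>)) * iexp ((\<tau> *\<^sub>R d m) \<bullet> (J m \<omega> - J s \<omega>)) \<partial>M)"
        unfolding split by (simp add: distrib_left exp_add)
      also have "\<dots> = (\<integral>\<omega>. iexp (\<tau> * (\<Sum>t\<in>I. d' t \<bullet> J t \<omega>)) \<partial>M) * exp (- ((\<tau> *\<^sub>R d m) \<bullet> (C s m *v (\<tau> *\<^sub>R d m))) / 2)"
        using sm m by (intro char_J_increment) auto
      also have "\<dots> = exp (- (v * \<tau>\<^sup>2) / 2) * exp (- (?q * \<tau>\<^sup>2) / 2)"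
        using normal_charD(3)[OF v, of \<tau>]
        by (simp add: matrix_vector_mult_scaleR power2_eq_square ac_simps)
      finally show "(\<integral>\<omega>. iexp (\<tau> * (\<Sum>t\<in>insert m I. d t \<bullet> J t \<omega>)) \<partial>M) = iexp (\<tau> * 0) * exp (- ((v + ?q) * \<tau>\<^sup>2) / 2)"
        by (simp add: distrib_right add_divide_distrib diff_divide_distrib flip: of_real_mult exp_add)
    qed
    then show ?thesis ..
  qed
qed

lemma V_gauss_process: "gauss_process M {0..T} V"
  unfolding gauss_process_def
proof (intro conjI ballI allI impI)
  show "V t \<in> borel_measurable M" if "t \<in> {0..T}" for t
    using that by (intro V_measurable) auto
  fix I and c :: "real \<Rightarrow> real^'d" assume I: "finite I \<and> I \<subseteq> {0..T}"
  let ?I = "I \<inter> {..<T}"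
  \<comment> \<open>The deterministic part: the means at times before \<open>T\<close>, and the
    constant \<open>b\<close> at \<open>T\<close>.\<close>
  define k where "k = (\<Sum>t\<in>?I. c t \<bullet> mean_ext a b t) + (\<Sum>t\<in>I - ?I. c t \<bullet> b)"
  obtain v where v: "normal_char M (\<lambda>\<omega>. \<Sum>t\<in>?I. (transpose (Gam E Sg t T) *v c t) \<bullet> J t \<omega>) 0 v"
    using J_combination_normal[of ?I] I by force
  have "normal_char M (\<lambda>\<omega>. k + 1 * (\<Sum>t\<in>?I. (transpose (Gam E Sg t T) *v c t) \<bullet> J t \<omega>)) (k + 1 * 0) (1\<^sup>2 * v)"
    by (rule normal_char_affine[OF v])
  moreover have "(\<Sum>t\<in>I. c t \<bullet> V t \<omega>) = k + 1 * (\<Sum>t\<in>?I. (transpose (Gam E Sg t T) *v c t) \<bullet> J t \<omega>)"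
    if \<omega>: "\<omega> \<in> space M" for \<omega>
  proof -
    have "(\<Sum>t\<in>?I. c t \<bullet> V t \<omega>) = (\<Sum>t\<in>?I. c t \<bullet> mean_ext a b t + (transpose (Gam E Sg t T) *v c t) \<bullet> J t \<omega>)"
      unfolding inner_transpose_left using I \<omega>
      by (intro sum.cong) (auto simp: V_U U_eq inner_add_right)
    moreover have "(\<Sum>t\<in>I - ?I. c t \<bullet> V t \<omega>) = (\<Sum>t\<in>I - ?I. c t \<bullet> b)"
      by (intro sum.cong) (auto simp: V_def)
    moreover have "(\<Sum>t\<in>I. c t \<bullet> V t \<omega>) = (\<Sum>t\<in>I - ?I. c t \<bullet> V t \<omega>) + (\<Sum>t\<in>?I. c t \<bullet> V t \<omega>)"
      using I by (intro sum.subset_diff) auto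
    ultimately show ?thesis
      by (simp add: k_def sum.distrib)
  qed
  ultimately have "normal_char M (\<lambda>\<omega>. \<Sum>t\<in>I. c t \<bullet> V t \<omega>) (k + 1 * 0) (1\<^sup>2 * v)"
    by (subst normal_char_cong)
  then show "gauss_vector M (\<lambda>\<omega>. \<Sum>t\<in>I. c t \<bullet> V t \<omega>)"
    by (rule gauss_vector_real_if_normal_char)
qed

end

section \<open>Conditional laws, the Markov property and transition densities\<close>

lemma set_integral_gauss_density:
  assumes C: "pos_def C" and [measurable]: "A \<in> sets borel"
  shows "(LINT y:A|lborel. gauss_density m C y) = measure (gauss_measure m C) A"
proof -
  have "(LINT y:A|lborel. gauss_density m C y) = enn2real (\<integral>\<^sup>+y. ennreal (indicator A y *\<^sub>R gauss_density m C y) \<partial>lborel)"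
    unfolding set_lebesgue_integral_def
    by (rule integral_eq_nn_integral) (auto simp: gauss_density_nonneg[OF C] intro!: AE_I2)
  also have "(\<integral>\<^sup>+y. ennreal (indicator A y *\<^sub>R gauss_density m C y) \<partial>lborel) = emeasure (gauss_measure m C) A"
    unfolding gauss_measure_def
    by (subst emeasure_density) (auto intro!: nn_integral_cong simp: indicator_def)
  finally show ?thesis
    by (simp add: measure_def)
qed

text \<open>\<open>G\<close> is general because two choices occur: \<open>M\<close> itself, for the
  past to be a subalgebra, and \<open>F s\<close>, for the past to be contained in the
  filtration.\<close>

lemma sets_past_subset:
  fixes Y :: "real \<Rightarrow> 'a \<Rightarrow> 'b::topological_space"
  assumes "space G = space M" "\<And>u. u \<in> I \<Longrightarrow> u \<le> s \<Longrightarrow> Y u \<in> borel_measurable G"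
  shows "sets (past M I Y s) \<subseteq> sets G"
proof -
  have "{Y u -` A \<inter> space M | u A. u \<in> I \<and> u \<le> s \<and> A \<in> sets borel} \<subseteq> sets G"
  proof clarify
    fix u and A :: "'b set" assume "u \<in> I" "u \<le> s" "A \<in> sets borel"
    then show "Y u -` A \<inter> space M \<in> sets G"
      using measurable_sets[OF assms(2)] by (simp add: assms(1))
  qed
  then have "sigma_sets (space G) {Y u -` A \<inter> space M | u A. u \<in> I \<and> u \<le> s \<and> A \<in> sets borel} \<subseteq> sets G"
    by (rule sets.sigma_sets_subset)
  moreover have "sets (past M I Y s) = sigma_sets (space M) {Y u -` A \<inter> space M | u A. u \<in> I \<and> u \<le> s \<and> A \<in> sets borel}"
    unfolding past_def by (rule sets_measure_of) auto
  ultimately show ?thesis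
    by (simp add: assms(1))
qed

lemma space_past: "space (past M I Y s) = space M"
  unfolding past_def by (rule space_measure_of) auto

lemma measurable_past:
  fixes Y :: "real \<Rightarrow> 'a \<Rightarrow> 'b::topological_space"
  assumes "s \<in> I"
  shows "Y s \<in> borel_measurable (past M I Y s)"
proof (rule measurableI)
  fix A :: "'b set" assume "A \<in> sets borel"
  then show "Y s -` A \<inter> space (past M I Y s) \<in> sets (past M I Y s)"
    using assms unfolding space_past by (auto simp: past_def intro!: sigma_sets.Basic)
qed simp

lemma past_subalgebra:
  assumes "\<And>u. u \<in> I \<Longrightarrow> Y u \<in> borel_measurable M"
  shows "subalgebra M (past M I Y s)"
  unfolding subalgebra_def space_past using sets_past_subset[of M M I s Y] assms by auto

lemma vimage_subalgebra:
  fixes Y :: "'a \<Rightarrow> 'b::topological_space"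
  assumes "Y \<in> borel_measurable G" "space G = space M"
  shows "sets (vimage_algebra (space M) Y borel) \<subseteq> sets G"
  using assms measurable_sets[OF assms(1)] by (auto simp: sets_vimage_algebra2)

lemma measurable_vimage:
  fixes Y :: "'a \<Rightarrow> 'b::topological_space"
  shows "Y \<in> borel_measurable (vimage_algebra (space M) Y borel)"
  by (rule measurable_vimage_algebra1) simp

context bridge_process
begin

lemma measurable_bridge_mean [measurable]:
  assumes "0 \<le> s" "s \<le> t" "t < T"
  shows "(\<lambda>x. bridge_mean E Sg r T x b s t) \<in> borel_measurable borel"
  unfolding bridge_mean_eq[OF assms]
  by (intro borel_measurable_continuous_onI continuous_intros)

text \<open>\<open>G\<close> may be any sigma-algebra between the one generated by
  \<open>U s\<close> and \<open>F s\<close>. Used for the past and for \<open>U s\<close> alone, it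
  gives the same conditional law, and this is the Markov property. On each event of \<open>G\<close>
  the law of \<open>U t\<close> is recognised, by characteristic functions, as a Gauss mixture
  centred at the restarted bridge mean.\<close>

lemma conditional_law:
  assumes st: "0 \<le> s" "s < t" "t < T"
    and G: "subalgebra M G" "sets G \<subseteq> sets (F s)" and Us: "U s \<in> borel_measurable G"
    and A [measurable]: "A \<in> sets borel"
  shows "AE \<omega> in M. real_cond_exp M G (indicator (U t -` A \<inter> space M)) \<omega> =
    (LINT y:A|lborel. gauss_density (bridge_mean E Sg r T (U s \<omega>) b s t) (bridge_cov E Sg T s t) y)"
proof -
  interpret finite_measure_subalgebra M G
    by unfold_locales (rule G(1))
  have st': "0 \<le> t" "s \<le> t" "s < T"
    using st by auto
  let ?D = "bridge_cov E Sg T s t"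
  have D: "pos_def ?D"
    using st by (rule bridge_cov_pos_def)
  define W where "W \<omega> = bridge_mean E Sg r T (U s \<omega>) b s t" for \<omega>
  \<comment> \<open>The candidate for the conditional probability; it is \<open>G\<close>-measurable
    because it depends on the path only through \<open>U s\<close>.\<close>
  define \<kappa> where "\<kappa> \<omega> = measure (gauss_measure (W \<omega>) ?D) A" for \<omega>
  have spG: "space G = space M"
    using G(1) by (simp add: subalgebra_def)
  have WG: "W \<in> borel_measurable G"
    unfolding W_def by (rule measurable_compose[OF Us measurable_bridge_mean[OF st(1) st'(2) st(3)]])
  have WM [measurable]: "W \<in> borel_measurable M"
    by (rule measurable_from_subalg[OF G(1) WG])
  have WF: "W \<in> borel_measurable (F s)"
    using G(2) spG space_F[OF st(1)] by (intro measurable_from_subalg[OF _ WG]) (simp add: subalgebra_def)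
  note Ut [measurable] = U_measurable[OF st'(1) st(3)]
  have \<kappa>G: "\<kappa> \<in> borel_measurable G"
    unfolding \<kappa>_def measure_def
    by (intro measurable_compose[OF WG] borel_measurable_enn2real measurable_emeasure_gauss_measure[OF D A])
  have \<kappa>M [measurable]: "\<kappa> \<in> borel_measurable M"
    by (rule measurable_from_subalg[OF G(1) \<kappa>G])
  have \<kappa>: "emeasure (gauss_measure (W \<omega>) ?D) A = ennreal (\<kappa> \<omega>)" "0 \<le> \<kappa> \<omega>" "\<kappa> \<omega> \<le> 1" for \<omega>
  proof -
    interpret g: prob_space "gauss_measure (W \<omega>) ?D"
      by (rule prob_space_gauss_measure[OF D])
    show "emeasure (gauss_measure (W \<omega>) ?D) A = ennreal (\<kappa> \<omega>)" "0 \<le> \<kappa> \<omega>" "\<kappa> \<omega> \<le> 1"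
      by (simp_all add: \<kappa>_def g.emeasure_eq_measure)
  qed
  have "AE \<omega> in M. real_cond_exp M G (indicator (U t -` A \<inter> space M)) \<omega> = \<kappa> \<omega>"
  proof (rule real_cond_exp_charact)
    show "integrable M (indicator (U t -` A \<inter> space M) :: 'a \<Rightarrow> real)"
      by (rule integrable_const_bound[where B=1]) (auto simp: indicator_def)
    show "integrable M \<kappa>"
      using \<kappa> by (intro integrable_const_bound[where B=1]) auto
    show "\<kappa> \<in> borel_measurable G"
      by (rule \<kappa>G)
    fix A\<^sub>0 assume A\<^sub>0: "A\<^sub>0 \<in> sets G"
    then have A\<^sub>0M [measurable]: "A\<^sub>0 \<in> sets M"
      using G(1) by (auto simp: subalgebra_def)
    have A\<^sub>0F [measurable]: "A\<^sub>0 \<in> sets (F s)"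
      using A\<^sub>0 G(2) by auto
    \<comment> \<open>\<open>M\<close> restricted to the event: a finite measure under which the
      laws of \<open>U t\<close> and of the mixture are compared.\<close>
    define P where "P = density M (\<lambda>\<omega>. ennreal (indicator A\<^sub>0 \<omega>))"
    have sets_P [measurable_cong]: "sets P = sets M" and space_P: "space P = space M"
      by (simp_all add: P_def)
    have "emeasure P (space P) = emeasure M A\<^sub>0"
      unfolding P_def by (subst emeasure_density) (auto simp: ennreal_indicator nn_integral_indicator[symmetric] indicator_inter_arith[symmetric] intro!: nn_integral_cong simp del: nn_integral_indicator simp: indicator_def)
    then have P: "finite_measure P"
      by (intro finite_measureI) simp
    have WP: "W \<in> borel_measurable P" and UP: "U t \<in> borel_measurable P"
      by (simp_all add: measurable_cong_sets[OF sets_P refl] Ut)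
    have int_P: "(\<integral>\<omega>. iexp (c \<bullet> Y \<omega>) \<partial>P) = expectation (\<lambda>\<omega>. indicator A\<^sub>0 \<omega> * iexp (c \<bullet> Y \<omega>))"
      if [measurable]: "Y \<in> borel_measurable M" for Y :: "'a \<Rightarrow> real^'d" and c
      unfolding P_def by (subst integral_density) (auto simp: indicator_def intro!: Bochner_Integration.integral_cong)
    have law: "distr P borel (U t) = gauss_mixture P W ?D"
    proof (rule char_uniqueness)
      show "finite_measure (distr P borel (U t))"
        by (rule finite_measure.finite_measure_distr[OF P UP])
      show "finite_measure (gauss_mixture P W ?D)" "sets (gauss_mixture P W ?D) = sets borel"
        by (rule finite_gauss_mixture[OF P WP D] sets_gauss_mixture[OF P WP D])+
      fix c
      let ?\<Gamma> = "Gam E Sg t T"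
      have "(\<integral>y. iexp (c \<bullet> y) \<partial>distr P borel (U t)) = (\<integral>\<omega>. iexp (c \<bullet> U t \<omega>) \<partial>P)"
        using UP by (subst integral_distr) auto
      also have "\<dots> = expectation (\<lambda>\<omega>. indicator A\<^sub>0 \<omega> * iexp (c \<bullet> U t \<omega>))"
        by (rule int_P[OF Ut])
      also have "\<dots> = expectation (\<lambda>\<omega>. (indicator A\<^sub>0 \<omega> * iexp (c \<bullet> W \<omega>)) * iexp ((transpose ?\<Gamma> *v c) \<bullet> (J t \<omega> - J s \<omega>)))"
      proof (rule Bochner_Integration.integral_cong[OF refl])
        fix \<omega> assume "\<omega> \<in> space M"
        then have "c \<bullet> U t \<omega> = c \<bullet> W \<omega> + (transpose ?\<Gamma> *v c) \<bullet> (J t \<omega> - J s \<omega>)"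
          unfolding inner_transpose_left W_def
          using U_markov_step[OF st(1) st'(2) st(3)] by (simp add: inner_add_right)
        then show "indicator A\<^sub>0 \<omega> * iexp (c \<bullet> U t \<omega>) =
            (indicator A\<^sub>0 \<omega> * iexp (c \<bullet> W \<omega>)) * iexp ((transpose ?\<Gamma> *v c) \<bullet> (J t \<omega> - J s \<omega>))"
          by (simp only: of_real_add distrib_left exp_add mult.assoc)
      qed
      also have "\<dots> = expectation (\<lambda>\<omega>. indicator A\<^sub>0 \<omega> * iexp (c \<bullet> W \<omega>)) *
          exp (- ((transpose ?\<Gamma> *v c) \<bullet> (C s t *v (transpose ?\<Gamma> *v c))) / 2)"
      proof (rule char_J_increment[OF st(1) st'(2) st(3)])
        show "(\<lambda>\<omega>. indicator A\<^sub>0 \<omega> * iexp (c \<bullet> W \<omega>)) \<in> borel_measurable (F s)"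
          using WF by measurable
      qed (simp add: norm_mult indicator_def)
      also have "(transpose ?\<Gamma> *v c) \<bullet> (C s t *v (transpose ?\<Gamma> *v c)) = c \<bullet> (?D *v c)"
        unfolding inner_transpose_left matrix_vector_mul_assoc using Gam_C_Gam[OF st(1) st'(2) st(3)]
        by (simp add: matrix_mul_assoc)
      also have "expectation (\<lambda>\<omega>. indicator A\<^sub>0 \<omega> * iexp (c \<bullet> W \<omega>)) = (\<integral>\<omega>. iexp (c \<bullet> W \<omega>) \<partial>P)"
        by (rule int_P[OF WM, symmetric])
      finally show "(\<integral>y. iexp (c \<bullet> y) \<partial>distr P borel (U t)) = (\<integral>y. iexp (c \<bullet> y) \<partial>gauss_mixture P W ?D)"
        by (simp only: char_gauss_mixture[OF P WP D])
    qed simp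
    have "(\<integral>\<^sup>+\<omega>. ennreal (indicator A\<^sub>0 \<omega> *\<^sub>R indicator (U t -` A \<inter> space M) \<omega>) \<partial>M) = emeasure (distr P borel (U t)) A"
      using UP unfolding P_def
      by (subst emeasure_distr) (auto simp: emeasure_density ennreal_mult intro!: nn_integral_cong split: split_indicator)
    also have "\<dots> = (\<integral>\<^sup>+\<omega>. ennreal (\<kappa> \<omega>) \<partial>P)"
      unfolding law emeasure_gauss_mixture[OF P WP D A] \<kappa>(1) ..
    also have "\<dots> = (\<integral>\<^sup>+\<omega>. ennreal (indicator A\<^sub>0 \<omega> *\<^sub>R \<kappa> \<omega>) \<partial>M)"
      unfolding P_def by (subst nn_integral_density) (auto simp: ennreal_mult' intro!: nn_integral_cong)
    finally have eq: "(\<integral>\<^sup>+\<omega>. ennreal (indicator A\<^sub>0 \<omega> *\<^sub>R indicator (U t -` A \<inter> space M) \<omega>) \<partial>M) =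
        (\<integral>\<^sup>+\<omega>. ennreal (indicator A\<^sub>0 \<omega> *\<^sub>R \<kappa> \<omega>) \<partial>M)" .
    show "(\<integral>\<omega>\<in>A\<^sub>0. indicator (U t -` A \<inter> space M) \<omega> \<partial>M) = (\<integral>\<omega>\<in>A\<^sub>0. \<kappa> \<omega> \<partial>M)"
    proof -
      have "(\<integral>\<omega>. indicator A\<^sub>0 \<omega> *\<^sub>R indicator (U t -` A \<inter> space M) \<omega> \<partial>M) =
          enn2real (\<integral>\<^sup>+\<omega>. ennreal (indicator A\<^sub>0 \<omega> *\<^sub>R indicator (U t -` A \<inter> space M) \<omega>) \<partial>M)"
        by (rule integral_eq_nn_integral) auto
      moreover have "(\<integral>\<omega>. indicator A\<^sub>0 \<omega> *\<^sub>R \<kappa> \<omega> \<partial>M) = enn2real (\<integral>\<^sup>+\<omega>. ennreal (indicator A\<^sub>0 \<omega> *\<^sub>R \<kappa> \<omega>) \<partial>M)"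
        using \<kappa>(2) by (intro integral_eq_nn_integral) auto
      ultimately show ?thesis
        unfolding set_lebesgue_integral_def by (simp only: eq)
    qed
  qed
  then show ?thesis
    by (simp add: \<kappa>_def W_def set_integral_gauss_density[OF D A])
qed

lemma V_markov: "markov_process M {0..T} V"
  unfolding markov_process_def
proof (intro conjI ballI impI)
  show "V t \<in> borel_measurable M" if "t \<in> {0..T}" for t
    using that by (intro V_measurable) auto
  fix s t and A :: "(real^'d) set" assume s: "s \<in> {0..T}" and t: "t \<in> {0..T}" and le: "s \<le> t" and A: "A \<in> sets borel"
  let ?P = "past M {0..T} V s" and ?V = "vimage_algebra (space M) (V s) borel"
  have Vs: "V s \<in> borel_measurable M"
    using s by (intro V_measurable) auto
  have P: "subalgebra M ?P"
    by (rule past_subalgebra) (auto intro: V_measurable)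
  have V: "subalgebra M ?V"
    using vimage_subalgebra[OF Vs refl] by (simp add: subalgebra_def)
  have VP: "sets ?V \<subseteq> sets ?P"
    by (rule vimage_subalgebra[OF measurable_past[OF s] space_past])
  interpret P: finite_measure_subalgebra M ?P
    by unfold_locales (rule P)
  interpret V: finite_measure_subalgebra M ?V
    by unfold_locales (rule V)
  show "AE \<omega> in M. real_cond_exp M ?P (indicator (V t -` A \<inter> space M)) \<omega> =
      real_cond_exp M ?V (indicator (V t -` A \<inter> space M)) \<omega>"
  proof (cases "s < t \<and> t < T")
    case True
    then have st: "0 \<le> s" "s < t" "t < T" "s < T"
      using s by auto
    have VF: "V u \<in> borel_measurable (F s)" if "u \<in> {0..T}" "u \<le> s" for u
      using that st by (simp add: V_U U_measurable_F)
    have PF: "sets ?P \<subseteq> sets (F s)"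
      by (rule sets_past_subset[OF space_F[OF st(1)] VF])
    have VU: "V s = U s" "V t = U t"
      using st by (simp_all add: V_U)
    have "U s \<in> borel_measurable ?P"
      using measurable_past[OF s, of V M] by (simp add: VU)
    from conditional_law[OF st(1-3) P PF this A]
    have 1: "AE \<omega> in M. real_cond_exp M ?P (indicator (U t -` A \<inter> space M)) \<omega> =
        (LINT y:A|lborel. gauss_density (bridge_mean E Sg r T (U s \<omega>) b s t) (bridge_cov E Sg T s t) y)" .
    have "U s \<in> borel_measurable ?V"
      using measurable_vimage[of "V s"] by (simp add: VU)
    from conditional_law[OF st(1-3) V order_trans[OF VP PF] this A]
    have 2: "AE \<omega> in M. real_cond_exp M ?V (indicator (U t -` A \<inter> space M)) \<omega> =
        (LINT y:A|lborel. gauss_density (bridge_mean E Sg r T (U s \<omega>) b s t) (bridge_cov E Sg T s t) y)" .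
    from 1 2 show ?thesis
      unfolding VU(2) by eventually_elim simp
  next
    \<comment> \<open>Either t = s, or t = T and \<open>V t\<close> is constant. In both cases the
      event is generated by \<open>V s\<close> already, and both conditional expectations return its
      indicator.\<close>
    case False
    have "V t -` A \<inter> space M \<in> sets ?V"
    proof (cases "t < T")
      case True
      then have "s = t"
        using False le by auto
      then show ?thesis
        using in_vimage_algebra[OF A] by simp
    next
      case False
      then have "V t -` A \<inter> space M = (if b \<in> A then space ?V else {})"
        by (auto simp: V_def)
      then show ?thesis
        by (simp only: sets.top sets.empty_sets split: if_split) simp
    qed
    then have ind: "(indicator (V t -` A \<inter> space M) :: 'a \<Rightarrow> real) \<in> borel_measurable ?V"
        "(indicator (V t -` A \<inter> space M) :: 'a \<Rightarrow> real) \<in> borel_measurable ?P"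
      using VP by (auto intro: borel_measurable_indicator)
    have int: "integrable M (indicator (V t -` A \<inter> space M) :: 'a \<Rightarrow> real)"
      using measurable_from_subalg[OF P ind(2)]
      by (intro integrable_const_bound[where B=1]) (auto simp: indicator_def)
    from P.real_cond_exp_F_meas[OF int ind(2)] V.real_cond_exp_F_meas[OF int ind(1)] show ?thesis
      by eventually_elim simp
  qed
qed

lemma U_transition_densities:
  "transition_densities M {0..<T} U
    (\<lambda>s t x y. gauss_density (bridge_mean E Sg r T x b s t) (bridge_cov E Sg T s t) y)"
  unfolding transition_densities_def
proof (intro conjI ballI impI allI)
  show "U t \<in> borel_measurable M" if "t \<in> {0..<T}" for t
    using that by (intro U_measurable) auto
next
  fix s t assume "s \<in> {0..<T}" "t \<in> {0..<T}" "s < t"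
  then have st: "0 \<le> s" "s \<le> t" "t < T" "s < t" and s: "s \<in> {0..<T}"
    by auto
  have D: "pos_def (bridge_cov E Sg T s t)"
    using st by (intro bridge_cov_pos_def)
  note [measurable] = measurable_bridge_mean[OF st(1-3)]
  show "(\<lambda>(x, y). gauss_density (bridge_mean E Sg r T x b s t) (bridge_cov E Sg T s t) y) \<in> borel_measurable (borel \<Otimes>\<^sub>M borel)"
    using measurable_compose[OF _ measurable_gauss_density_pair, of "\<lambda>p. (bridge_mean E Sg r T (fst p) b s t, snd p)"]
    by (simp add: case_prod_unfold)
  show "0 \<le> gauss_density (bridge_mean E Sg r T x b s t) (bridge_cov E Sg T s t) y" for x y
    by (rule gauss_density_nonneg[OF D])
  show "(\<integral>\<^sup>+y. ennreal (gauss_density (bridge_mean E Sg r T x b s t) (bridge_cov E Sg T s t) y) \<partial>lborel) = 1" for x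
    using prob_space.emeasure_space_1[OF prob_space_gauss_measure[OF D], of "bridge_mean E Sg r T x b s t"]
    by (simp add: gauss_measure_def emeasure_density)
  fix A :: "(real^'d) set" assume A: "A \<in> sets borel"
  have "U u \<in> borel_measurable (F s)" if "u \<in> {0..<T}" "u \<le> s" for u
    using that by (intro U_measurable_F) auto
  then have PF: "sets (past M {0..<T} U s) \<subseteq> sets (F s)"
    by (rule sets_past_subset[OF space_F[OF st(1)]])
  have "subalgebra M (past M {0..<T} U s)"
    by (rule past_subalgebra) (auto intro: U_measurable)
  from conditional_law[OF st(1,4,3) this PF measurable_past[OF s] A]
  show "AE \<omega> in M. real_cond_exp M (past M {0..<T} U s) (indicator (U t -` A \<inter> space M)) \<omega> =
      (LINT y:A|lborel. gauss_density (bridge_mean E Sg r T (U s \<omega>) b s t) (bridge_cov E Sg T s t) y)" .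
next
  fix s u t :: real and x :: "real^'d"
  assume "s \<in> {0..<T}" "u \<in> {0..<T}" "t \<in> {0..<T}" "s < u \<and> u < t"
  then have st: "0 \<le> s" "s < u" "u < t" "t < T" "0 \<le> u" "u < T" "s < t" "s \<le> u" "u \<le> t"
    by auto
  \<comment> \<open>The linear part of the bridge mean from \<open>u\<close> to \<open>t\<close> as
    a function of the starting point; it propagates the covariance collected up to
    \<open>u\<close>.\<close>
  let ?A = "\<Phi> t ** R t ** \<Lambda> u ** \<Psi> u"
  have cov: "bridge_cov E Sg T s t = bridge_cov E Sg T u t + ?A ** bridge_cov E Sg T s u ** transpose ?A"
    using st by (intro bridge_cov_compose) auto
  have w: "bridge_mean E Sg r T y b u t = bridge_mean E Sg r T 0 b u t + ?A *v y" for y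
    using bridge_mean_affine[OF st(5,9,4), of 0 y b] by simp
  have comp: "bridge_mean E Sg r T (bridge_mean E Sg r T x b s u) b u t = bridge_mean E Sg r T x b s t"
    using st by (intro bridge_mean_compose) auto
  have "AE z in lborel. ennreal (gauss_density (bridge_mean E Sg r T (bridge_mean E Sg r T x b s u) b u t)
      (bridge_cov E Sg T u t + ?A ** bridge_cov E Sg T s u ** transpose ?A) z) =
    (\<integral>\<^sup>+y. ennreal (gauss_density (bridge_mean E Sg r T x b s u) (bridge_cov E Sg T s u) y *
      gauss_density (bridge_mean E Sg r T y b u t) (bridge_cov E Sg T u t) z) \<partial>lborel)"
  proof (rule gauss_density_convolution[where w="\<lambda>y. bridge_mean E Sg r T y b u t"])
    show "pos_def (bridge_cov E Sg T s u)" "pos_def (bridge_cov E Sg T u t)"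
      using st by (auto intro!: bridge_cov_pos_def)
    show "pos_def (bridge_cov E Sg T u t + ?A ** bridge_cov E Sg T s u ** transpose ?A)"
      unfolding cov[symmetric] using st by (intro bridge_cov_pos_def)
  qed (rule w)
  then show "AE z in lborel. ennreal (gauss_density (bridge_mean E Sg r T x b s t) (bridge_cov E Sg T s t) z) =
    (\<integral>\<^sup>+y. ennreal (gauss_density (bridge_mean E Sg r T x b s u) (bridge_cov E Sg T s u) y *
      gauss_density (bridge_mean E Sg r T y b u t) (bridge_cov E Sg T u t) z) \<partial>lborel)"
    unfolding comp cov .
qed

end

theorem theorem2p1:
  fixes Q :: "real \<Rightarrow> real^'d^'d"
    and Sg :: "real \<Rightarrow> real^'p^'d"
    and r :: "real \<Rightarrow> real^'d"
    and E :: "real \<Rightarrow> real \<Rightarrow> real^'d^'d"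
    and M :: "'a measure" and F :: "real \<Rightarrow> 'a measure"
    and B :: "real \<Rightarrow> 'a \<Rightarrow> real^'p"
    and J U :: "real \<Rightarrow> 'a \<Rightarrow> real^'d"
    and a b :: "real^'d" and T :: real
  assumes "continuous_on {0..} Q" and "continuous_on {0..} Sg" and "continuous_on {0..} r"
    and "evolution_matrices Q E"
    and "\<And>s t. 0 \<le> s \<Longrightarrow> s < t \<Longrightarrow> pos_def (kappa E Sg s t)"
    and "usual_filtered_space M F" and "wiener_process M F B"
    and "0 < T"
    and "ito_integral M F B T (\<lambda>u \<omega>. matrix_inv (Gam E Sg u T) ** Sg u) J"
    and "\<And>t \<omega>. 0 \<le> t \<Longrightarrow> t < T \<Longrightarrow> \<omega> \<in> space M \<Longrightarrow>
           U t \<omega> = bridge_mean E Sg r T a b 0 t + Gam E Sg t T *v J t \<omega>"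
  shows "(\<forall>t\<in>{0..<T}. gauss_with M (U t) (bridge_mean E Sg r T a b 0 t) (bridge_cov E Sg T 0 t)) \<and>
    (AE \<omega> in M. ((\<lambda>t. U t \<omega>) \<longlongrightarrow> b) (at_left T)) \<and>
    tendsto_prob M U (\<lambda>_. b) (at_left T) \<and>
    tendsto_L2 M U (\<lambda>_. b) (at_left T) \<and>
    (\<exists>V :: real \<Rightarrow> 'a \<Rightarrow> real^'d.
       (\<forall>t\<in>{0..<T}. \<forall>\<omega>\<in>space M. V t \<omega> = U t \<omega>) \<and>
       (AE \<omega> in M. V 0 \<omega> = a) \<and> (\<forall>\<omega>\<in>space M. V T \<omega> = b) \<and>
       (AE \<omega> in M. continuous_on {0..T} (\<lambda>t. V t \<omega>)) \<and>
       (\<forall>t\<in>{0..T}. tendsto_prob M V (V t) (at t within {0..T})) \<and>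
       (\<forall>t\<in>{0..T}. tendsto_L2 M V (V t) (at t within {0..T})) \<and>
       gauss_process M {0..T} V \<and> markov_process M {0..T} V) \<and>
    transition_densities M {0..<T} U
      (\<lambda>s t x y. gauss_density (bridge_mean E Sg r T x b s t) (bridge_cov E Sg T s t) y) \<and>
    (\<forall>s t x y. 0 \<le> s \<and> s < t \<and> t < T \<longrightarrow>
       gauss_density (bridge_mean E Sg r T x b s t) (bridge_cov E Sg T s t) y =
       pZ E Sg r s t x y * pZ E Sg r t T y b / pZ E Sg r s T x b)"
proof -
  interpret bridge_process Q Sg r E T M F B J U a b
    by unfold_locales (fact assms)+
  show ?thesis
  proof (intro conjI)
    show "\<forall>t\<in>{0..<T}. gauss_with M (U t) (bridge_mean E Sg r T a b 0 t) (bridge_cov E Sg T 0 t)"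
      using gauss_with_if_gauss_char[OF gauss_char_U] by (simp add: bridge_mean_0_eq bridge_cov_sym)
    show "AE \<omega> in M. ((\<lambda>t. U t \<omega>) \<longlongrightarrow> b) (at_left T)"
      by (rule U_tendsto)
    show "tendsto_prob M U (\<lambda>_. b) (at_left T)"
      by (rule tendsto_prob_if_tendsto_L2[OF U_tendsto_L2])
    show "tendsto_L2 M U (\<lambda>_. b) (at_left T)"
      by (rule U_tendsto_L2)
    show "\<exists>V :: real \<Rightarrow> 'a \<Rightarrow> real^'d.
       (\<forall>t\<in>{0..<T}. \<forall>\<omega>\<in>space M. V t \<omega> = U t \<omega>) \<and>
       (AE \<omega> in M. V 0 \<omega> = a) \<and> (\<forall>\<omega>\<in>space M. V T \<omega> = b) \<and>
       (AE \<omega> in M. continuous_on {0..T} (\<lambda>t. V t \<omega>)) \<and>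
       (\<forall>t\<in>{0..T}. tendsto_prob M V (V t) (at t within {0..T})) \<and>
       (\<forall>t\<in>{0..T}. tendsto_L2 M V (V t) (at t within {0..T})) \<and>
       gauss_process M {0..T} V \<and> markov_process M {0..T} V"
    proof (intro exI[of _ V] conjI)
      show "\<forall>t\<in>{0..<T}. \<forall>\<omega>\<in>space M. V t \<omega> = U t \<omega>"
        by (simp add: V_U)
      show "AE \<omega> in M. V 0 \<omega> = a"
        using U_0 T_pos by (simp add: V_U)
      show "\<forall>\<omega>\<in>space M. V T \<omega> = b"
        by (simp add: V_T)
      show "\<forall>t\<in>{0..T}. tendsto_prob M V (V t) (at t within {0..T})"
        using tendsto_prob_if_tendsto_L2[OF V_tendsto_L2] by blast
    qed (use V_continuous V_tendsto_L2 V_gauss_process V_markov in blast)+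
    show "transition_densities M {0..<T} U
      (\<lambda>s t x y. gauss_density (bridge_mean E Sg r T x b s t) (bridge_cov E Sg T s t) y)"
      by (rule U_transition_densities)
    show "\<forall>s t x y. 0 \<le> s \<and> s < t \<and> t < T \<longrightarrow>
       gauss_density (bridge_mean E Sg r T x b s t) (bridge_cov E Sg T s t) y =
       pZ E Sg r s t x y * pZ E Sg r t T y b / pZ E Sg r s T x b"
      using bridge_density_eq by blast
  qed
qed

end
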